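(* Let $\Omega\subset\mathbb C$ be a simply connected domain containing $0$ with $\Omega\neq\mathbb C$, and let $g_0\in H(\Omega)$ satisfy $g_0(0)=1$ and have no zeros in $\Omega$. (i) For every $n\in\mathbb N\cup\{-\infty,0\}$, every finite or empty set $\Lambda\subset\mathbb C\setminus\Omega$ and every multiple variety $\Upsilon=\{(\lambda,n_\lambda)\,|\,\lambda\in\Lambda\}$ in $\mathbb C\setminus\Omega$ (with $n_\lambda\in\mathbb N$), the set $g_0\left(\mathbb C[z]_n+\mathbb C^-_\Upsilon(z)\right)$ is a closed $D_{0,g_0}$-invariant subspace of $H(\Omega)$. Moreover, it is proper if and only if $n\neq-\infty$ or $\Lambda$ is nonempty. (ii) Every proper closed $D_{0,g_0}$-invariant subspace $S$ of $H(\Omega)$ is contained in $g_0\mathbb C(z)$, and $$S=g_0\left(\mathbb C[z]_{n(S)}+\mathbb C^-_{\Upsilon(S)}(z)\right).$$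
   Context: $H(\Omega)$ is the Fréchet space of all holomorphic functions on $\Omega$ with the topology of compact convergence. The generalized backward shift (Pommiez operator) is the continuous linear operator $D_{0,g_0}:H(\Omega)\to H(\Omega)$, $D_{0,g_0}(f)(t)=\frac{f(t)-g_0(t)f(0)}{t}$ for $t\ne0$, $D_{0,g_0}(f)(0)=f'(0)-g_0'(0)f(0)$. A subspace of $H(\Omega)$ is proper if it is neither $\{0\}$ nor $H(\Omega)$. $\mathbb C[z]_n$ ($n\ge0$) is the set of complex polynomials of degree at most $n$; $\mathbb C[z]_{-\infty}:=\{0\}$; the zero polynomial has degree $-\infty$. $\mathbb C(z)$ is the set of all rational functions over $\mathbb C$; a set $S\subset H(\Omega)$ is contained in $g_0\mathbb C(z)$ if each $f\in S$ has the form $f=g_0R$ with $R$ rational. For a function $h\in H(\Omega)$ and $Q\subset H(\Omega)$, $hQ:=\{hf\,|\,f\in Q\}$. For $\lambda\in\mathbb C$, $k\in\mathbb N=\{1,2,\dots\}$ put $q_{\lambda,k}(t):=\frac1{(t-\lambda)^k}$. For a finite set $\Lambda\subset\mathbb C\setminus\Omega$ and a finite multiple variety $\Upsilon=\{(\lambda,n_\lambda)\,|\,\lambda\in\Lambda\}$, $n_\lambda\in\mathbb N$, put $\mathbb C^-_\Upsilon(z):=\mathrm{span}\{q_{\lambda,k}\,|\,\lambda\in\Lambda,\ 1\le k\le n_\lambda\}$; if $\Upsilon$ is empty, $\mathbb C^-_\Upsilon(z):=\{0\}$. Definition of $n(S)$ and $\Upsilon(S)$ (for $g_0$ without zeros in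 $\Omega$): let $S\subset g_0\mathbb C(z)$ be a proper closed $D_{0,g_0}$-invariant subspace. Each nonzero $f\in S$ is uniquely written as $f=g_0 r(f)+g_0\frac{u(f)}{v(f)}$ with polynomials $r(f),u(f),v(f)$ such that $\deg u(f)<\deg v(f)$, $v(f)$ is monic without roots in $\Omega$, and $u(f),v(f)$ have no common roots; for $f=0$ put $r(f)=u(f)=0$, $v(f)=1$. Put $n(S):=\sup_{f\in S}\deg r(f)$, $\mathcal P(S):=\{\lambda\in\mathbb C\setminus\Omega\,|\,\exists f\in S\setminus\{0\}:\ v(f)(\lambda)=0\}$, let $n_\lambda(S)$ be the supremum over $f\in S$ of the multiplicity of $\lambda$ as a root of $v(f)$ (multiplicity $0$ if it is not a root), and $\Upsilon(S):=\{(\lambda,n_\lambda(S))\,|\,\lambda\in\mathcal P(S)\}$. (For such $S$ one has $n(S)<+\infty$, $\mathcal P(S)$ is finite or empty, and each $n_\lambda(S)$ is finite, so $\Upsilon(S)$ is a finite or empty multiple variety.) *)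

theory Defs
  imports
    "HOL-Complex_Analysis.Complex_Analysis"
    "HOL-Library.Function_Algebras"
    "HOL-Library.Set_Algebras"
begin

definition fscale :: "complex \<Rightarrow> (complex \<Rightarrow> complex) \<Rightarrow> complex \<Rightarrow> complex" where
  "fscale c f = (\<lambda>z. c * f z)"

global_interpretation cfun: vector_space fscale
  by unfold_locales (auto simp: fscale_def fun_eq_iff algebra_simps)

text \<open>Elements of \<open>H(\<Omega>)\<close> are represented by total functions that vanish outside \<open>\<Omega>\<close>, so that
  HOL equality of elements is equality on \<open>\<Omega>\<close>.\<close>

definition hol_space :: "complex set \<Rightarrow> (complex \<Rightarrow> complex) set" where
  "hol_space \<Omega> = {f. f holomorphic_on \<Omega> \<and> (\<forall>z. z \<notin> \<Omega> \<longrightarrow> f z = 0)}"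

definition compact_nbhd ::
  "complex set \<Rightarrow> (complex \<Rightarrow> complex) \<Rightarrow> complex set \<Rightarrow> real \<Rightarrow> (complex \<Rightarrow> complex) set" where
  "compact_nbhd \<Omega> f K e = {g \<in> hol_space \<Omega>. \<forall>z\<in>K. dist (g z) (f z) < e}"

definition compact_convergence :: "complex set \<Rightarrow> (complex \<Rightarrow> complex) topology" where
  "compact_convergence \<Omega> = topology (\<lambda>U. U \<subseteq> hol_space \<Omega> \<and>
     (\<forall>f\<in>U. \<exists>K e. compact K \<and> K \<subseteq> \<Omega> \<and> 0 < e \<and> compact_nbhd \<Omega> f K e \<subseteq> U))"

lemma openin_compact_convergence:
  "openin (compact_convergence \<Omega>) U \<longleftrightarrow> U \<subseteq> hol_space \<Omega> \<and>
     (\<forall>f\<in>U. \<exists>K e. compact K \<and> K \<subseteq> \<Omega> \<and> 0 < e \<and> compact_nbhd \<Omega> f K e \<subseteq> U)"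
proof -
  let ?P = "\<lambda>U. U \<subseteq> hol_space \<Omega> \<and>
     (\<forall>f\<in>U. \<exists>K e. compact K \<and> K \<subseteq> \<Omega> \<and> 0 < e \<and> compact_nbhd \<Omega> f K e \<subseteq> U)"
  have inter: "?P (S \<inter> T)" if S: "?P S" and T: "?P T" for S T
  proof (intro conjI ballI)
    show "S \<inter> T \<subseteq> hol_space \<Omega>" using S by blast
    fix f assume f: "f \<in> S \<inter> T"
    obtain K d where 1: "compact K" "K \<subseteq> \<Omega>" "0 < d" "compact_nbhd \<Omega> f K d \<subseteq> S"
      using bspec[OF conjunct2[OF S], of f] f by auto
    obtain L e where 2: "compact L" "L \<subseteq> \<Omega>" "0 < e" "compact_nbhd \<Omega> f L e \<subseteq> T"
      using bspec[OF conjunct2[OF T], of f] f by auto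
    have "compact_nbhd \<Omega> f (K \<union> L) (min d e) \<subseteq> compact_nbhd \<Omega> f K d \<inter> compact_nbhd \<Omega> f L e"
      unfolding compact_nbhd_def by auto
    moreover have "compact (K \<union> L)" "K \<union> L \<subseteq> \<Omega>" "0 < min d e"
      using 1 2 by (auto intro: compact_Un)
    moreover have "compact_nbhd \<Omega> f K d \<inter> compact_nbhd \<Omega> f L e \<subseteq> S \<inter> T"
      using 1(4) 2(4) by (rule Int_mono)
    ultimately show "\<exists>K e. compact K \<and> K \<subseteq> \<Omega> \<and> 0 < e \<and> compact_nbhd \<Omega> f K e \<subseteq> S \<inter> T"
      by (meson order_trans)
  qed
  have union: "?P (\<Union>\<U>)" if U: "\<forall>U\<in>\<U>. ?P U" for \<U>
  proof (intro conjI ballI)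
    show "\<Union>\<U> \<subseteq> hol_space \<Omega>" using U by blast
    fix f assume "f \<in> \<Union>\<U>"
    then obtain V where V: "V \<in> \<U>" "f \<in> V" by blast
    obtain K e where K: "compact K" "K \<subseteq> \<Omega>" "0 < e" "compact_nbhd \<Omega> f K e \<subseteq> V"
      using bspec[OF conjunct2[OF bspec[OF U V(1)]] V(2)] by auto
    have "compact_nbhd \<Omega> f K e \<subseteq> \<Union>\<U>"
      using K(4) Union_upper[OF V(1)] by (rule order_trans)
    with K(1-3) show "\<exists>K e. compact K \<and> K \<subseteq> \<Omega> \<and> 0 < e \<and> compact_nbhd \<Omega> f K e \<subseteq> \<Union>\<U>"
      by blast
  qed
  have "istopology ?P"
    unfolding istopology_def
  proof (intro conjI allI impI)
    fix S T assume "?P S" "?P T"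
    then show "S \<inter> T \<subseteq> hol_space \<Omega>" by blast
  next
    fix S T assume "?P S" "?P T"
    then show "\<forall>f\<in>S \<inter> T. \<exists>K e. compact K \<and> K \<subseteq> \<Omega> \<and> 0 < e \<and> compact_nbhd \<Omega> f K e \<subseteq> S \<inter> T"
      by (rule conjunct2[OF inter])
  next
    fix \<K> assume "\<forall>K\<in>\<K>. ?P K"
    from conjunct1[OF union[OF this]] show "\<Union>\<K> \<subseteq> hol_space \<Omega>" .
  next
    fix \<K> assume "\<forall>K\<in>\<K>. ?P K"
    from conjunct2[OF union[OF this]]
    show "\<forall>f\<in>\<Union>\<K>. \<exists>K e. compact K \<and> K \<subseteq> \<Omega> \<and> 0 < e \<and> compact_nbhd \<Omega> f K e \<subseteq> \<Union>\<K>" .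
  qed
  then show ?thesis
    unfolding compact_convergence_def by (simp add: topology_inverse')
qed

lemma topspace_compact_convergence: "topspace (compact_convergence \<Omega>) = hol_space \<Omega>"
proof -
  have "openin (compact_convergence \<Omega>) (hol_space \<Omega>)"
    unfolding openin_compact_convergence
    by (auto simp: compact_nbhd_def intro!: exI[of _ "{}"] exI[of _ "1::real"])
  then have "hol_space \<Omega> \<subseteq> topspace (compact_convergence \<Omega>)"
    by (rule openin_subset)
  moreover have "topspace (compact_convergence \<Omega>) \<subseteq> hol_space \<Omega>"
    using openin_topspace[of "compact_convergence \<Omega>"]
    unfolding openin_compact_convergence by (rule conjunct1)
  ultimately show ?thesis by (rule subset_antisym[rotated])
qed

definition pommiez :: "complex set \<Rightarrow> (complex \<Rightarrow> complex) \<Rightarrow> (complex \<Rightarrow> complex) \<Rightarrow> complex \<Rightarrow> complex" where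
  "pommiez \<Omega> g0 f = (\<lambda>t. if t \<notin> \<Omega> then 0
     else if t = 0 then deriv f 0 - deriv g0 0 * f 0
     else (f t - g0 t * f 0) / t)"

definition closed_invariant_subspace ::
  "complex set \<Rightarrow> (complex \<Rightarrow> complex) \<Rightarrow> (complex \<Rightarrow> complex) set \<Rightarrow> bool" where
  "closed_invariant_subspace \<Omega> g0 S \<longleftrightarrow>
     S \<subseteq> hol_space \<Omega> \<and> cfun.subspace S \<and> closedin (compact_convergence \<Omega>) S \<and>
     pommiez \<Omega> g0 ` S \<subseteq> S"

definition proper_in :: "complex set \<Rightarrow> (complex \<Rightarrow> complex) set \<Rightarrow> bool" where
  "proper_in \<Omega> S \<longleftrightarrow> S \<noteq> {0} \<and> S \<noteq> hol_space \<Omega>"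

text \<open>The degree with the convention that the zero polynomial has degree \<open>-\<infinity>\<close>.\<close>

definition pdeg :: "complex poly \<Rightarrow> ereal" where
  "pdeg p = (if p = 0 then -\<infinity> else ereal (real (degree p)))"

definition degree_bounds :: "ereal set" where
  "degree_bounds = insert (-\<infinity>) (range (\<lambda>k::nat. ereal (real k)))"

definition polys_upto :: "ereal \<Rightarrow> (complex \<Rightarrow> complex) set" where
  "polys_upto n = {poly p | p. pdeg p \<le> n}"

text \<open>The value of \<open>qpole w k\<close> at its pole \<open>w\<close> is irrelevant: only \<open>w \<notin> \<Omega>\<close> is used, and
  such functions are multiplied by \<open>g0\<close>, which vanishes outside \<open>\<Omega>\<close>.\<close>

definition qpole :: "complex \<Rightarrow> nat \<Rightarrow> complex \<Rightarrow> complex" where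
  "qpole w k = (\<lambda>t. 1 / (t - w) ^ k)"

text \<open>A multiple variety is a set of pairs of a point and a multiplicity. Multiplicities are of
  type \<^typ>\<open>enat\<close> because those of a subspace are introduced below as suprema.\<close>

definition multiple_variety :: "complex set \<Rightarrow> (complex \<Rightarrow> nat) \<Rightarrow> (complex \<times> enat) set" where
  "multiple_variety \<Lambda> m = {(w, enat (m w)) | w. w \<in> \<Lambda>}"

definition finite_multiple_variety_outside :: "complex set \<Rightarrow> (complex \<times> enat) set \<Rightarrow> bool" where
  "finite_multiple_variety_outside \<Omega> \<Upsilon> \<longleftrightarrow>
     (\<exists>\<Lambda> m. finite \<Lambda> \<and> \<Lambda> \<subseteq> - \<Omega> \<and> (\<forall>w\<in>\<Lambda>. 1 \<le> m w) \<and> \<Upsilon> = multiple_variety \<Lambda> m)"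

definition pole_space :: "(complex \<times> enat) set \<Rightarrow> (complex \<Rightarrow> complex) set" where
  "pole_space \<Upsilon> = cfun.span {qpole w k | w k. \<exists>m. (w, m) \<in> \<Upsilon> \<and> 1 \<le> k \<and> enat k \<le> m}"

definition fmult :: "(complex \<Rightarrow> complex) \<Rightarrow> (complex \<Rightarrow> complex) set \<Rightarrow> (complex \<Rightarrow> complex) set" where
  "fmult h Q = {h * f | f. f \<in> Q}"

text \<open>\<open>g0 \<complex>(z)\<close>: since the elements of \<open>H(\<Omega>)\<close> have no poles in \<open>\<Omega>\<close> and \<open>g0\<close> has no zeros there,
  a rational factor, in lowest terms, has no poles in \<open>\<Omega>\<close>.\<close>

definition rational_multiples :: "complex set \<Rightarrow> (complex \<Rightarrow> complex) \<Rightarrow> (complex \<Rightarrow> complex) set" where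
  "rational_multiples \<Omega> g0 = {f. \<exists>p q. (\<forall>z\<in>\<Omega>. poly q z \<noteq> 0) \<and>
     (\<forall>z\<in>\<Omega>. f z = g0 z * (poly p z / poly q z))}"

definition is_rat_decomp ::
  "complex set \<Rightarrow> (complex \<Rightarrow> complex) \<Rightarrow> (complex \<Rightarrow> complex) \<Rightarrow>
     complex poly \<times> complex poly \<times> complex poly \<Rightarrow> bool" where
  "is_rat_decomp \<Omega> g0 f = (\<lambda>(r, u, v).
     (\<forall>z\<in>\<Omega>. f z = g0 z * poly r z + g0 z * (poly u z / poly v z)) \<and>
     pdeg u < pdeg v \<and> lead_coeff v = 1 \<and> (\<forall>z\<in>\<Omega>. poly v z \<noteq> 0) \<and>
     (\<nexists>z. poly u z = 0 \<and> poly v z = 0))"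

definition rat_decomp ::
  "complex set \<Rightarrow> (complex \<Rightarrow> complex) \<Rightarrow> (complex \<Rightarrow> complex) \<Rightarrow>
     complex poly \<times> complex poly \<times> complex poly" where
  "rat_decomp \<Omega> g0 f = (if f = 0 then (0, 0, 1) else (THE d. is_rat_decomp \<Omega> g0 f d))"

definition poly_part where "poly_part \<Omega> g0 f = fst (rat_decomp \<Omega> g0 f)"

definition denom_part where "denom_part \<Omega> g0 f = snd (snd (rat_decomp \<Omega> g0 f))"

definition max_degree :: "complex set \<Rightarrow> (complex \<Rightarrow> complex) \<Rightarrow> (complex \<Rightarrow> complex) set \<Rightarrow> ereal" where
  "max_degree \<Omega> g0 S = (SUP f\<in>S. pdeg (poly_part \<Omega> g0 f))"

definition pole_set :: "complex set \<Rightarrow> (complex \<Rightarrow> complex) \<Rightarrow> (complex \<Rightarrow> complex) set \<Rightarrow> complex set" where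
  "pole_set \<Omega> g0 S = {w. w \<notin> \<Omega> \<and> (\<exists>f\<in>S - {0}. poly (denom_part \<Omega> g0 f) w = 0)}"

definition pole_mult ::
  "complex set \<Rightarrow> (complex \<Rightarrow> complex) \<Rightarrow> (complex \<Rightarrow> complex) set \<Rightarrow> complex \<Rightarrow> enat" where
  "pole_mult \<Omega> g0 S w = (SUP f\<in>S. enat (order w (denom_part \<Omega> g0 f)))"

definition pole_variety ::
  "complex set \<Rightarrow> (complex \<Rightarrow> complex) \<Rightarrow> (complex \<Rightarrow> complex) set \<Rightarrow> (complex \<times> enat) set" where
  "pole_variety \<Omega> g0 S = {(w, pole_mult \<Omega> g0 S w) | w. w \<in> pole_set \<Omega> g0 S}"

end

theory Submission
  imports Defs
    "HOL-Computational_Algebra.Fundamental_Theorem_Algebra"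
    "HOL-Computational_Algebra.Polynomial_Factorial"
    "HOL-Computational_Algebra.Field_as_Ring"
begin

text \<open>
  Division by \<open>g0\<close> turns the Pommiez operator into the backward shift \<open>D f = (f - f 0) / t\<close>.
  Let \<open>S\<close> be a proper closed invariant subspace. By Hahn-Banach some functional \<open>L \<noteq> 0\<close>, bounded by
  a supremum over a compact \<open>K \<subseteq> \<Omega>\<close>, annihilates \<open>S\<close>. For \<open>f \<in> S\<close> the function
  \<open>N f (x) = L ((f x - f t) / (x - t))\<close> is holomorphic on \<open>\<Omega>\<close> and satisfies
  \<open>N f (x) = x * N (D f) (x)\<close>, so it vanishes to infinite order at \<open>0\<close>, hence identically. This says
  \<open>f x * G x = L (f t / (t - x))\<close> on \<open>\<Omega> - K\<close>, where \<open>G x = L (1 / (t - x))\<close>. The right-hand side and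
  \<open>G\<close> are holomorphic on the unbounded component of \<open>- K\<close>, which contains \<open>- \<Omega>\<close> since \<open>\<Omega>\<close> is simply
  connected, and \<open>G\<close> is not identically zero there: otherwise, for every \<open>h\<close>, the function \<open>N h\<close> and the
  Cauchy transform of \<open>h\<close> would glue to an entire function vanishing at infinity, which forces \<open>L h = 0\<close>.
  Hence each \<open>f \<in> S\<close> extends meromorphically to the Riemann sphere, with poles only at the zeros of \<open>G\<close>
  and of no higher order, so \<open>S\<close> lies in a finite-dimensional space of rational functions.

  If \<open>P / Q\<close> is in lowest terms and \<open>d = max (degree P + 1) (degree Q)\<close>, then \<open>D\<^sup>j (P / Q)\<close> for \<open>j < d\<close> are
  linearly independent, because a relation between them would represent \<open>P / Q\<close> with a smaller
  numerator and denominator. Counting dimensions, they span all quotients \<open>p / Q\<close> with \<open>degree p < d\<close>,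
  so \<open>S\<close> contains every monomial and every pole term that occurs in one of its elements.
\<close>


section \<open>The Hahn-Banach theorem\<close>

text \<open>Partial linear functionals are encoded by their graphs; domination by \<open>p\<close> already forces a
  graph that is a linear subspace to be single-valued, since \<open>p 0 = 0\<close>.\<close>

definition dominated_graph ::
  "(real \<Rightarrow> 'b::ab_group_add \<Rightarrow> 'b) \<Rightarrow> 'b set \<Rightarrow> ('b \<Rightarrow> real) \<Rightarrow> ('b \<times> real) set \<Rightarrow> bool" where
  "dominated_graph scl E p G \<longleftrightarrow> (0, 0) \<in> G \<and>
     (\<forall>(x::'b) (a::real) y b. (x, a) \<in> G \<longrightarrow> (y, b) \<in> G \<longrightarrow> (x + y, a + b) \<in> G) \<and>
     (\<forall>(x::'b) (a::real) c. (x, a) \<in> G \<longrightarrow> (scl c x, c * a) \<in> G) \<and>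
     (\<forall>(x::'b) (a::real). (x, a) \<in> G \<longrightarrow> x \<in> E \<and> a \<le> p x)"

text \<open>A value \<open>c\<close> at \<open>x0\<close> is admissible iff it lies above every
  \<open>a - p (x - x0)\<close> and below every \<open>p (y + x0) - b\<close> with
  \<open>(x, a)\<close> and \<open>(y, b)\<close> in \<open>G\<close>; subadditivity makes the two
  families compatible. If \<open>x0\<close> already has a value, domination forces \<open>c\<close>
  to agree with it, so no case distinction arises.\<close>

lemma dominated_graph_extend:
  fixes scl :: "real \<Rightarrow> 'b::ab_group_add \<Rightarrow> 'b"
  assumes "vector_space scl" and E: "module.subspace scl E"
    and p_add: "\<And>x y. x \<in> E \<Longrightarrow> y \<in> E \<Longrightarrow> p (x + y) \<le> p x + p y"
    and p_scale: "\<And>c x. x \<in> E \<Longrightarrow> 0 \<le> c \<Longrightarrow> p (scl c x) = c * p x"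
    and G: "dominated_graph scl E p G" and x0: "x0 \<in> E"
  obtains G' c where "dominated_graph scl E p G'" "G \<subseteq> G'" "(x0, c) \<in> G'"
proof -
  interpret vector_space scl by fact
  have G0: "(0, 0) \<in> G"
    and Gadd: "\<And>x a y b. (x, a) \<in> G \<Longrightarrow> (y, b) \<in> G \<Longrightarrow> (x + y, a + b) \<in> G"
    and Gscale: "\<And>x a c. (x, a) \<in> G \<Longrightarrow> (scl c x, c * a) \<in> G"
    and GE: "\<And>x a. (x, a) \<in> G \<Longrightarrow> x \<in> E"
    and Gp: "\<And>x a. (x, a) \<in> G \<Longrightarrow> a \<le> p x"
    using G unfolding dominated_graph_def by blast+
  define A where "A = {a - p (x - x0) | x a. (x, a) \<in> G}"
  define c where "c = Sup A"
  have sep: "a - p (x - x0) \<le> p (y + x0) - b" if "(x, a) \<in> G" "(y, b) \<in> G" for x a y b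
  proof -
    have "a + b \<le> p (x + y)" using Gp[OF Gadd[OF that]] .
    also have "x + y = (x - x0) + (y + x0)" by simp
    also have "p \<dots> \<le> p (x - x0) + p (y + x0)"
      by (intro p_add subspace_diff[OF E] subspace_add[OF E] GE[OF that(1)] GE[OF that(2)] x0)
    finally show ?thesis by simp
  qed
  have bdd: "bdd_above A"
    unfolding A_def bdd_above_def using sep[OF _ G0] by blast
  have lower: "a - p (x - x0) \<le> c" if "(x, a) \<in> G" for x a
    unfolding c_def by (rule cSup_upper[OF _ bdd]) (use that in \<open>auto simp: A_def\<close>)
  have upper: "c \<le> p (y + x0) - b" if "(y, b) \<in> G" for y b
    unfolding c_def
  proof (rule cSup_least)
    show "A \<noteq> {}" using G0 by (auto simp: A_def)
  qed (use sep[OF _ that] in \<open>auto simp: A_def\<close>)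
  define G' where "G' = {(x + scl t x0, a + t * c) | x a t. (x, a) \<in> G}"
  \<comment> \<open>Dividing by the modulus of \<open>t\<close> reduces domination to the
    coefficients \<open>1\<close> and \<open>-1\<close> of \<open>x0\<close>, that is, to
    \<open>upper\<close> and \<open>lower\<close>.\<close>
  have dom: "a + t * c \<le> p (x + scl t x0)" if xa: "(x, a) \<in> G" for x a t
  proof (cases t "0::real" rule: linorder_cases)
    case equal then show ?thesis using Gp[OF xa] by simp
  next
    case greater
    have "c \<le> p (scl (1/t) x + x0) - 1/t * a" by (rule upper[OF Gscale[OF xa]])
    hence "a + t * c \<le> t * p (scl (1/t) x + x0)" using greater by (simp add: field_simps)
    also have "\<dots> = p (scl t (scl (1/t) x + x0))"
      by (rule p_scale[symmetric])
        (use greater in \<open>auto intro!: subspace_add[OF E] subspace_scale[OF E] GE[OF xa] x0\<close>)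
    also have "scl t (scl (1/t) x + x0) = x + scl t x0"
      using greater by (simp add: scale_right_distrib)
    finally show ?thesis .
  next
    case less
    define s where "s = - t"
    have s: "s > 0" "t = - s" using less by (auto simp: s_def)
    have "1/s * a - p (scl (1/s) x - x0) \<le> c" by (rule lower[OF Gscale[OF xa]])
    hence "a - s * c \<le> s * p (scl (1/s) x - x0)" using s by (simp add: field_simps)
    also have "\<dots> = p (scl s (scl (1/s) x - x0))"
      by (rule p_scale[symmetric])
        (use s in \<open>auto intro!: subspace_diff[OF E] subspace_scale[OF E] GE[OF xa] x0\<close>)
    also have "scl s (scl (1/s) x - x0) = x + scl t x0"
      using s by (simp add: scale_right_diff_distrib)
    finally show ?thesis using s by simp
  qed
  have "dominated_graph scl E p G'"
    unfolding dominated_graph_def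
  proof (intro conjI allI impI)
    show "(0, 0) \<in> G'"
      unfolding G'_def using G0 by (force intro: exI[of _ 0])
    fix x a assume "(x, a) \<in> G'"
    then obtain x1 a1 t where 1: "(x1, a1) \<in> G" "x = x1 + scl t x0" "a = a1 + t * c"
      unfolding G'_def by blast
    show "x \<in> E" unfolding 1
      by (intro subspace_add[OF E] subspace_scale[OF E] GE[OF 1(1)] x0)
    show "a \<le> p x" unfolding 1 by (rule dom[OF 1(1)])
    show "(scl r x, r * a) \<in> G'" for r
      unfolding G'_def 1 mem_Collect_eq
      by (rule exI[of _ "scl r x1"], rule exI[of _ "r * a1"], rule exI[of _ "r * t"])
        (use Gscale[OF 1(1), of r] in \<open>simp add: scale_right_distrib algebra_simps\<close>)
    fix y b assume "(y, b) \<in> G'"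
    then obtain x2 a2 s where 2: "(x2, a2) \<in> G" "y = x2 + scl s x0" "b = a2 + s * c"
      unfolding G'_def by blast
    show "(x + y, a + b) \<in> G'"
      unfolding G'_def 1 2 mem_Collect_eq
      by (rule exI[of _ "x1 + x2"], rule exI[of _ "a1 + a2"], rule exI[of _ "t + s"])
        (use Gadd[OF 1(1) 2(1)] in \<open>simp add: scale_left_distrib algebra_simps\<close>)
  qed
  moreover have "G \<subseteq> G'"
  proof clarify
    fix x a assume "(x, a) \<in> G"
    then have "(x + scl 0 x0, a + 0 * c) \<in> G'" unfolding G'_def by blast
    then show "(x, a) \<in> G'" by simp
  qed
  moreover have "(x0, c) \<in> G'"
  proof -
    have "(0 + scl 1 x0, 0 + 1 * c) \<in> G'" unfolding G'_def using G0 by blast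
    then show ?thesis by simp
  qed
  ultimately show ?thesis using that by blast
qed

text \<open>Zorn's lemma on the dominated graphs containing \<open>F\<close>: a maximal one is
  defined on all of \<open>E\<close> by the one-step extension.\<close>

theorem Hahn_Banach_dominated:
  fixes scl :: "real \<Rightarrow> 'b::ab_group_add \<Rightarrow> 'b"
  assumes "vector_space scl" and E: "module.subspace scl E"
    and p_add: "\<And>x y. x \<in> E \<Longrightarrow> y \<in> E \<Longrightarrow> p (x + y) \<le> p x + p y"
    and p_scale: "\<And>c x. x \<in> E \<Longrightarrow> 0 \<le> c \<Longrightarrow> p (scl c x) = c * p x"
    and F: "dominated_graph scl E p F"
  shows "\<exists>u. (\<forall>(x, a)\<in>F. u x = a) \<and> (\<forall>x\<in>E. u x \<le> p x) \<and>
    (\<forall>x\<in>E. \<forall>y\<in>E. u (x + y) = u x + u y) \<and> (\<forall>x\<in>E. \<forall>c. u (scl c x) = c * u x)"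
proof -
  interpret vector_space scl by fact
  let ?P = "{G. dominated_graph scl E p G \<and> F \<subseteq> G}"
  have "\<exists>M\<in>?P. \<forall>X\<in>?P. M \<subseteq> X \<longrightarrow> X = M"
  proof (rule subset_Zorn_nonempty)
    show "?P \<noteq> {}" using F by blast
    fix C assume C: "C \<noteq> {}" "subset.chain ?P C"
    then have dg: "\<And>G. G \<in> C \<Longrightarrow> dominated_graph scl E p G" and FG: "\<And>G. G \<in> C \<Longrightarrow> F \<subseteq> G"
      and lin: "\<And>G H. G \<in> C \<Longrightarrow> H \<in> C \<Longrightarrow> G \<subseteq> H \<or> H \<subseteq> G"
      unfolding subset.chain_def by blast+
    have "dominated_graph scl E p (\<Union>C)"
      unfolding dominated_graph_def
    proof (intro conjI allI impI)
      show "(0, 0) \<in> \<Union>C" using C(1) dg unfolding dominated_graph_def by blast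
      fix x a assume "(x, a) \<in> \<Union>C"
      then obtain G where G: "G \<in> C" "(x, a) \<in> G" by blast
      show "x \<in> E" "a \<le> p x" "\<And>c. (scl c x, c * a) \<in> \<Union>C"
        using dg[OF G(1)] G unfolding dominated_graph_def by blast+
      fix y b assume "(y, b) \<in> \<Union>C"
      then obtain H where H: "H \<in> C" "(y, b) \<in> H" by blast
      obtain J where J: "J \<in> C" "(x, a) \<in> J" "(y, b) \<in> J"
        using lin[OF G(1) H(1)] G H by blast
      show "(x + y, a + b) \<in> \<Union>C"
        using dg[OF J(1)] J unfolding dominated_graph_def by blast
    qed
    then show "\<Union>C \<in> ?P" using C(1) FG by blast
  qed
  then obtain M where M: "dominated_graph scl E p M" "F \<subseteq> M"
    and max: "\<forall>X\<in>?P. M \<subseteq> X \<longrightarrow> X = M" by auto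
  have M0: "(0, 0) \<in> M"
    and Madd: "\<And>x a y b. (x, a) \<in> M \<Longrightarrow> (y, b) \<in> M \<Longrightarrow> (x + y, a + b) \<in> M"
    and Mscale: "\<And>x a c. (x, a) \<in> M \<Longrightarrow> (scl c x, c * a) \<in> M"
    and ME: "\<And>x a. (x, a) \<in> M \<Longrightarrow> x \<in> E"
    and Mp: "\<And>x a. (x, a) \<in> M \<Longrightarrow> a \<le> p x"
    using M unfolding dominated_graph_def by blast+
  have total: "\<exists>a. (x, a) \<in> M" if xE: "x \<in> E" for x
  proof -
    obtain X a where X: "dominated_graph scl E p X" "M \<subseteq> X" "(x, a) \<in> X"
      using dominated_graph_extend[OF assms(1) E p_add p_scale M(1) xE] .
    then have "X = M" using max M(2) by simp
    then show ?thesis using X(3) by auto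
  qed
  have p0: "p 0 = 0" using p_scale[of 0 0] subspace_0[OF E] by simp
  \<comment> \<open>The pair \<open>(0, a - b)\<close> lies in \<open>M\<close>, so domination and
    \<open>p 0 = 0\<close> give \<open>a \<le> b\<close>.\<close>
  have le: "a \<le> b" if "(x, a) \<in> M" "(x, b) \<in> M" for x a b
    using Mp[OF Madd[OF that(1) Mscale[OF that(2), of "-1"]]] p0 by simp
  have uniq: "a = b" if "(x, a) \<in> M" "(x, b) \<in> M" for x a b
    using le[OF that] le[OF that(2,1)] by simp
  define u where "u x = (THE a. (x, a) \<in> M)" for x
  have u: "u x = a" if "(x, a) \<in> M" for x a
    unfolding u_def using that uniq by blast
  have uM: "(x, u x) \<in> M" if "x \<in> E" for x using total[OF that] u by blast
  show ?thesis
  proof (intro exI[of _ u] conjI ballI allI)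
    show "case xa of (x, a) \<Rightarrow> u x = a" if "xa \<in> F" for xa using u M(2) that by blast
    show "u x \<le> p x" if "x \<in> E" for x using Mp uM[OF that] by blast
    show "u (x + y) = u x + u y" if "x \<in> E" "y \<in> E" for x y
      using u[OF Madd[OF uM[OF that(1)] uM[OF that(2)]]] .
    show "u (scl c x) = c * u x" if "x \<in> E" for c x using u[OF Mscale[OF uM[OF that]]] .
  qed
qed


section \<open>Functionals bounded by a supremum over a compact set\<close>

text \<open>\<open>L\<close> acts on all functions, not only on \<open>hol_space \<Omega>\<close>,
  so that it can be applied to kernels such as \<open>1 / (t - x)\<close>. Linearity is required
  only for functions bounded on \<open>K\<close>; the last clause is boundedness in the supremum
  norm over \<open>K\<close>.\<close>

definition sup_functional :: "complex set \<Rightarrow> ((complex \<Rightarrow> complex) \<Rightarrow> complex) \<Rightarrow> bool" where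
  "sup_functional K L \<longleftrightarrow>
     (\<forall>f g. bounded (f ` K) \<longrightarrow> bounded (g ` K) \<longrightarrow> L (\<lambda>z. f z + g z) = L f + L g) \<and>
     (\<forall>c f. bounded (f ` K) \<longrightarrow> L (\<lambda>z. c * f z) = c * L f) \<and>
     (\<exists>C\<ge>0. \<forall>f B. (\<forall>z\<in>K. norm (f z) \<le> B) \<longrightarrow> norm (L f) \<le> C * B)"

lemma bounded_image_iff: "bounded (f ` K) \<longleftrightarrow> (\<exists>B. \<forall>z\<in>K. norm (f z) \<le> B)"
  by (auto simp: bounded_iff)

text \<open>Some \<open>K\<close> and \<open>e\<close> witness that the complement of
  \<open>S\<close> is open, so \<open>f0\<close> has distance at least \<open>e\<close> from
  \<open>S\<close> in the supremum norm \<open>p\<close> over \<open>K\<close>. Hahn-Banach is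
  applied over the reals and the result is complexified.\<close>

lemma separating_functional:
  assumes S: "S \<subseteq> hol_space \<Omega>" "cfun.subspace S" "closedin (compact_convergence \<Omega>) S"
    and f0: "f0 \<in> hol_space \<Omega>" "f0 \<notin> S"
  obtains K L where "compact K" "K \<subseteq> \<Omega>" "K \<noteq> {}" "sup_functional K L"
    "\<And>f. f \<in> S \<Longrightarrow> L f = 0" "L f0 \<noteq> 0"
proof -
  have "openin (compact_convergence \<Omega>) (hol_space \<Omega> - S)"
    using S(3) by (simp add: closedin_def topspace_compact_convergence)
  then obtain K e where K: "compact K" "K \<subseteq> \<Omega>" and e: "0 < e"
    and nb: "compact_nbhd \<Omega> f0 K e \<subseteq> hol_space \<Omega> - S"
    using f0 unfolding openin_compact_convergence by blast
  have far: "\<exists>z\<in>K. e \<le> dist (f z) (f0 z)" if "f \<in> S" for f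
    using that S(1) nb unfolding compact_nbhd_def by (force simp: not_less)
  have zS: "0 \<in> S" using S(2) by (rule cfun.subspace_0)
  \<comment> \<open>With \<open>K\<close> empty, no element of \<open>S\<close> could be far from
    \<open>f0\<close> at a point of \<open>K\<close>, not even \<open>0\<close>.\<close>
  then have Kne: "K \<noteq> {}" using far by blast
  define E where "E = {f :: complex \<Rightarrow> complex. bounded (f ` K)}"
  define p where "p f = (SUP z\<in>K. norm (f z))" for f :: "complex \<Rightarrow> complex"
  define scl where "scl r f = fscale (complex_of_real r) f" for r f
  interpret rv: vector_space scl
    by unfold_locales (auto simp: scl_def fscale_def fun_eq_iff algebra_simps)
  have upper: "norm (f z) \<le> p f" if "f \<in> E" "z \<in> K" for f z
    unfolding p_def by (rule cSUP_upper)
      (use that in \<open>auto simp: E_def bounded_image_iff bdd_above_def\<close>)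
  have least: "p f \<le> B" if "\<And>z. z \<in> K \<Longrightarrow> norm (f z) \<le> B" for f B
    unfolding p_def by (rule cSUP_least) (use that Kne in auto)
  have EI: "f \<in> E" if "\<And>z. z \<in> K \<Longrightarrow> norm (f z) \<le> B" for f B
    using that by (auto simp: E_def bounded_image_iff)
  have Eadd: "(\<lambda>z. f z + g z) \<in> E" if "f \<in> E" "g \<in> E" for f g
    by (rule EI[of _ "p f + p g"]) (intro norm_triangle_mono upper that)
  have Escale: "(\<lambda>z. c * f z) \<in> E" if "f \<in> E" for c f
    by (rule EI[of _ "norm c * p f"]) (use upper[OF that] in \<open>auto simp: norm_mult mult_left_mono\<close>)
  have hol_E: "f \<in> E" if "f \<in> hol_space \<Omega>" for f
  proof -
    have "continuous_on K f"
      using that K by (auto simp: hol_space_def intro: holomorphic_on_imp_continuous_on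
          holomorphic_on_subset)
    then show ?thesis
      unfolding E_def using compact_imp_bounded[OF compact_continuous_image[OF _ K(1)]] by simp
  qed
  have plus: "f + g = (\<lambda>z. f z + g z)" for f g :: "complex \<Rightarrow> complex"
    by (simp add: fun_eq_iff)
  have sclE: "scl r f = (\<lambda>z. of_real r * f z)" for r f
    by (simp add: scl_def fscale_def)
  have subE: "rv.subspace E"
    by (rule rv.subspaceI) (auto simp: plus sclE intro: Eadd Escale EI[of _ 0])
  have p_add: "p (f + g) \<le> p f + p g" if "f \<in> E" "g \<in> E" for f g
    unfolding plus by (rule least) (intro norm_triangle_mono upper that)
  have p_scale_le: "p (scl c f) \<le> \<bar>c\<bar> * p f" if "f \<in> E" for c f
    by (rule least) (use upper[OF that] in \<open>auto simp: sclE norm_mult mult_left_mono\<close>)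
  have p_scale: "p (scl c f) = c * p f" if f: "f \<in> E" and c: "0 \<le> c" for c f
  proof (cases "c = 0")
    case True
    have "p (scl c f) = (SUP z\<in>K. 0)" by (simp add: p_def sclE True)
    then show ?thesis using Kne True by simp
  next
    case False
    have "p f = p (scl (1/c) (scl c f))" using False by simp
    also have "\<dots> \<le> \<bar>1/c\<bar> * p (scl c f)"
      by (rule p_scale_le) (use Escale[OF f] in \<open>simp add: sclE\<close>)
    finally have "c * p f \<le> p (scl c f)" using c False by (simp add: field_simps)
    with p_scale_le[OF f, of c] c show ?thesis by simp
  qed
  \<comment> \<open>The functional to be extended is zero on \<open>S\<close> and has value
    \<open>e\<close> at \<open>f0\<close>, on the real span of both.\<close>
  define F where "F = {(s + scl t f0, t * e) | s t. s \<in> S}"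
  have "dominated_graph scl E p F"
    unfolding dominated_graph_def
  proof (intro conjI allI impI)
    show "(0, 0) \<in> F" unfolding F_def using zS by (force intro: exI[of _ 0])
    fix f a assume "(f, a) \<in> F"
    then obtain s t where 1: "s \<in> S" "f = s + scl t f0" "a = t * e" unfolding F_def by blast
    show fE: "f \<in> E"
      unfolding 1 plus sclE
      by (intro Eadd Escale hol_E f0) (use S 1 in blast)
    show "a \<le> p f"
    proof (cases "t > 0")
      case False
      obtain z where "z \<in> K" using Kne by blast
      then have "0 \<le> p f" using upper[OF fE] norm_ge_zero order_trans by blast
      then show ?thesis using False e 1 by (auto simp: mult_nonpos_nonneg intro: order_trans[rotated])
    next
      case True
      \<comment> \<open>Since \<open>f = t * (f0 - (-s/t))\<close>, the distance of
        \<open>f0\<close> from the element \<open>-s/t\<close> of \<open>S\<close> bounds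
        \<open>p f\<close> below by \<open>t * e\<close>.\<close>
      have "fscale (- 1 / of_real t) s \<in> S" by (rule cfun.subspace_scale[OF S(2) 1(1)])
      from far[OF this] obtain z where z: "z \<in> K" "e \<le> dist (fscale (- 1 / of_real t) s z) (f0 z)"
        by blast
      have "e \<le> norm (f z / of_real t)"
      proof -
        have "f z / of_real t = - (fscale (- 1 / of_real t) s z - f0 z)"
          using True by (simp add: 1 sclE fscale_def add_divide_distrib)
        then show ?thesis using z(2) by (metis dist_norm norm_minus_cancel)
      qed
      then have "a \<le> norm (f z)" using True by (simp add: 1 norm_divide field_simps)
      also have "\<dots> \<le> p f" by (rule upper[OF fE z(1)])
      finally show ?thesis .
    qed
    show "(scl c f, c * a) \<in> F" for c
      unfolding F_def 1 mem_Collect_eq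
      by (rule exI[of _ "scl c s"], rule exI[of _ "c * t"])
        (use cfun.subspace_scale[OF S(2) 1(1)] in \<open>simp add: cfun.scale_right_distrib scl_def\<close>)
    fix g b assume "(g, b) \<in> F"
    then obtain s' t' where 2: "s' \<in> S" "g = s' + scl t' f0" "b = t' * e" unfolding F_def by blast
    show "(f + g, a + b) \<in> F"
      unfolding F_def 1 2 mem_Collect_eq
      by (rule exI[of _ "s + s'"], rule exI[of _ "t + t'"])
        (use cfun.subspace_add[OF S(2) 1(1) 2(1)] in \<open>simp add: rv.scale_left_distrib algebra_simps\<close>)
  qed
  then have F: "dominated_graph scl E p F" .
  have "\<exists>u. (\<forall>(f, a)\<in>F. u f = a) \<and> (\<forall>f\<in>E. u f \<le> p f) \<and>
    (\<forall>f\<in>E. \<forall>g\<in>E. u (f + g) = u f + u g) \<and> (\<forall>f\<in>E. \<forall>c. u (scl c f) = c * u f)"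
    by (rule Hahn_Banach_dominated) (fact rv.vector_space_axioms subE p_add p_scale F)+
  then obtain u where u: "\<forall>(f, a)\<in>F. u f = a" "\<forall>f\<in>E. u f \<le> p f"
    "\<forall>f\<in>E. \<forall>g\<in>E. u (f + g) = u f + u g" "\<forall>f\<in>E. \<forall>c. u (scl c f) = c * u f"
    by (elim exE conjE) (rule that)
  have uF: "u f = a" if "(f, a) \<in> F" for f a using u(1) that by auto
  have up: "u f \<le> p f" if "f \<in> E" for f using u(2) that by blast
  have uadd: "u (f + g) = u f + u g" if "f \<in> E" "g \<in> E" for f g using u(3) that by blast
  have uscale: "u (scl c f) = c * u f" if "f \<in> E" for c f using u(4) that by blast
  have uabs: "\<bar>u f\<bar> \<le> p f" if "f \<in> E" for f
  proof -
    have "- u f = u (scl (-1) f)" using uscale[OF that, of "-1"] by simp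
    also have "\<dots> \<le> p (scl (-1) f)" by (rule up) (unfold sclE, rule Escale[OF that])
    also have "\<dots> \<le> p f" using p_scale_le[OF that, of "-1"] by simp
    finally show ?thesis using up[OF that] by linarith
  qed
  \<comment> \<open>The standard complexification: the complex-linear functional with real part
    \<open>u\<close>.\<close>
  define L where "L f = of_real (u f) - \<i> * of_real (u (\<lambda>z. \<i> * f z))" for f
  have uadd': "u (\<lambda>z. f z + g z) = u f + u g" if "f \<in> E" "g \<in> E" for f g
    using uadd[OF that] by (simp add: plus)
  have ulin: "u (\<lambda>z. of_real a * f z + of_real b * g z) = a * u f + b * u g"
    if "f \<in> E" "g \<in> E" for a b f g
    using uadd'[OF Escale[OF that(1)] Escale[OF that(2)]] uscale[OF that(1), of a]
      uscale[OF that(2), of b] by (simp add: sclE)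
  have "sup_functional K L"
    unfolding sup_functional_def
  proof (intro conjI allI impI)
    fix f g :: "complex \<Rightarrow> complex" assume "bounded (f ` K)" "bounded (g ` K)"
    then have E: "f \<in> E" "g \<in> E" by (auto simp: E_def)
    show "L (\<lambda>z. f z + g z) = L f + L g"
      using uadd'[OF E] uadd'[OF Escale[OF E(1), of \<i>] Escale[OF E(2), of \<i>]]
      by (simp add: L_def algebra_simps)
  next
    fix c and f :: "complex \<Rightarrow> complex" assume "bounded (f ` K)"
    then have f: "f \<in> E" by (simp add: E_def)
    note g = Escale[OF f, of \<i>]
    have c: "c = of_real (Re c) + of_real (Im c) * \<i>" by (simp add: complex_eq_iff)
    have 1: "u (\<lambda>z. c * f z) = Re c * u f + Im c * u (\<lambda>z. \<i> * f z)"
      using ulin[OF f g, of "Re c" "Im c"] by (subst (1) c) (simp add: algebra_simps)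
    have 2: "u (\<lambda>z. \<i> * (c * f z)) = Re c * u (\<lambda>z. \<i> * f z) - Im c * u f"
    proof -
      have "(\<lambda>z. \<i> * (c * f z)) = (\<lambda>z. of_real (Re c) * (\<i> * f z) + of_real (- Im c) * f z)"
        by (auto simp: fun_eq_iff complex_eq_iff)
      then show ?thesis using ulin[OF g f, of "Re c" "- Im c"] by simp
    qed
    show "L (\<lambda>z. c * f z) = c * L f"
      unfolding L_def 1 2 by (simp add: complex_eq_iff algebra_simps)
  next
    show "\<exists>C\<ge>0. \<forall>f B. (\<forall>z\<in>K. cmod (f z) \<le> B) \<longrightarrow> cmod (L f) \<le> C * B"
    proof (intro exI[of _ 2] conjI allI impI)
      fix f :: "complex \<Rightarrow> complex" and B assume B: "\<forall>z\<in>K. cmod (f z) \<le> B"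
      then have f: "f \<in> E" by (auto intro: EI)
      have "cmod (L f) \<le> \<bar>u f\<bar> + \<bar>u (\<lambda>z. \<i> * f z)\<bar>"
        unfolding L_def by (rule order_trans[OF norm_triangle_ineq4]) (simp add: norm_mult)
      also have "\<dots> \<le> p f + p (\<lambda>z. \<i> * f z)"
        using uabs[OF f] uabs[OF Escale[OF f]] by (rule add_mono)
      also have "\<dots> \<le> B + B"
        by (intro add_mono least) (use B in \<open>auto simp: norm_mult\<close>)
      finally show "cmod (L f) \<le> 2 * B" by simp
    qed simp
  qed
  moreover have "L f = 0" if "f \<in> S" for f
  proof -
    have "u g = 0" if "g \<in> S" for g
    proof (rule uF)
      have "(g + scl 0 f0, 0 * e) \<in> F" unfolding F_def using that by blast
      then show "(g, 0) \<in> F" by simp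
    qed
    \<comment> \<open>The imaginary part vanishes because \<open>S\<close> is closed under
      multiplication by \<open>\<i>\<close>.\<close>
    then show ?thesis using that cfun.subspace_scale[OF S(2) that, of \<i>] by (simp add: L_def fscale_def)
  qed
  moreover have "L f0 \<noteq> 0"
  proof -
    have "(0 + scl 1 f0, 1 * e) \<in> F" unfolding F_def using zS by blast
    then have "u f0 = e" by (intro uF) simp
    then have "Re (L f0) = e" by (simp add: L_def)
    then show ?thesis using e by auto
  qed
  ultimately show ?thesis using that K Kne by blast
qed


section \<open>Linearity, locality and holomorphic parameter dependence of bounded
  functionals\<close>

lemma holomorphic_bounded_on_compact:
  "f holomorphic_on U \<Longrightarrow> compact C \<Longrightarrow> C \<subseteq> U \<Longrightarrow> bounded (f ` C)"
  by (intro compact_imp_bounded compact_continuous_image holomorphic_on_imp_continuous_on)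
    (rule holomorphic_on_subset)

locale bounded_functional =
  fixes K :: "complex set" and L :: "(complex \<Rightarrow> complex) \<Rightarrow> complex"
  assumes compact_K: "compact K" and nonempty_K: "K \<noteq> {}" and L: "sup_functional K L"
begin

lemma L_add: "bounded (f ` K) \<Longrightarrow> bounded (g ` K) \<Longrightarrow> L (\<lambda>z. f z + g z) = L f + L g"
  using L by (simp add: sup_functional_def)

lemma L_scale: "bounded (f ` K) \<Longrightarrow> L (\<lambda>z. c * f z) = c * L f"
  using L by (simp add: sup_functional_def)

lemma L_bound: "\<exists>C\<ge>0. \<forall>f B. (\<forall>z\<in>K. norm (f z) \<le> B) \<longrightarrow> norm (L f) \<le> C * B"
  using L by (simp add: sup_functional_def)

lemma bounded_add: "bounded (f ` K) \<Longrightarrow> bounded (g ` K) \<Longrightarrow> bounded ((\<lambda>z. f z + g z :: complex) ` K)"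
  unfolding bounded_image_iff by (meson norm_triangle_mono)

lemma bounded_scale: "bounded (f ` K) \<Longrightarrow> bounded ((\<lambda>z. c * f z :: complex) ` K)"
  unfolding bounded_image_iff norm_mult by (meson mult_left_mono norm_ge_zero)

lemma L_diff:
  assumes "bounded (f ` K)" "bounded (g ` K)"
  shows "L (\<lambda>z. f z - g z) = L f - L g"
  using L_add[OF assms(1) bounded_scale[OF assms(2), of "-1"]] L_scale[OF assms(2), of "-1"]
  by simp

text \<open>The difference has supremum \<open>0\<close> on \<open>K\<close>, so the bound on
  \<open>L\<close> annihilates it. This allows kernels to be rewritten on \<open>K\<close> alone,
  whatever they are elsewhere.\<close>

lemma L_cong:
  assumes "\<And>z. z \<in> K \<Longrightarrow> f z = g z" "bounded (f ` K)"
  shows "L f = L g"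
proof -
  obtain C where C: "0 \<le> C" "\<And>f B. (\<And>z. z \<in> K \<Longrightarrow> norm (f z) \<le> B) \<Longrightarrow> norm (L f) \<le> C * B"
    using L_bound by blast
  have g: "bounded (g ` K)" using assms by (metis image_cong)
  have "norm (L (\<lambda>z. f z - g z)) \<le> C * 0" by (rule C(2)) (simp add: assms)
  then show ?thesis using L_diff[OF assms(2) g] by simp
qed

lemma bounded_holomorphic: "f holomorphic_on U \<Longrightarrow> K \<subseteq> U \<Longrightarrow> bounded (f ` K)"
  by (rule holomorphic_bounded_on_compact[OF _ compact_K])

text \<open>Differentiation under \<open>L\<close>. A bound uniform in \<open>t\<close> and locally
  uniform in \<open>x\<close> controls second derivatives by Cauchy's inequality, so the first-order
  Taylor remainders of all \<open>H t\<close> are quadratically small with one constant, and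
  \<open>L\<close> preserves this.\<close>

lemma holomorphic_L:
  assumes U: "open U" and hol: "\<And>t. t \<in> K \<Longrightarrow> H t holomorphic_on U"
    and bdd: "\<And>x. x \<in> U \<Longrightarrow> \<exists>r>0. \<exists>B. \<forall>t\<in>K. \<forall>y\<in>U \<inter> cball x r. norm (H t y) \<le> B"
  shows "(\<lambda>x. L (\<lambda>t. H t x)) holomorphic_on U"
proof -
  obtain C where C: "0 \<le> C" "\<And>f B. (\<And>z. z \<in> K \<Longrightarrow> norm (f z) \<le> B) \<Longrightarrow> norm (L f) \<le> C * B"
    using L_bound by blast
  have "\<exists>D. ((\<lambda>x. L (\<lambda>t. H t x)) has_field_derivative D) (at x)" if x: "x \<in> U" for x
  proof -
    obtain r1 B where r1: "r1 > 0" "\<And>t y. t \<in> K \<Longrightarrow> y \<in> U \<Longrightarrow> y \<in> cball x r1 \<Longrightarrow> norm (H t y) \<le> B"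
      using bdd[OF x] by (metis Int_iff)
    obtain r2 where r2: "r2 > 0" "cball x r2 \<subseteq> U" using U x open_contains_cball by blast
    \<comment> \<open>Halving leaves room: discs of radius \<open>r\<close> centred in
      \<open>cball x r\<close> stay in \<open>cball x (2 * r)\<close>, where the bound
      \<open>B\<close> holds.\<close>
    define r where "r = min r1 r2 / 2"
    have r: "r > 0" "cball x (2 * r) \<subseteq> U" "cball x (2 * r) \<subseteq> cball x r1"
      using r1 r2 by (auto simp: r_def)
    have HB: "norm (H t y) \<le> B" if "t \<in> K" "y \<in> cball x (2 * r)" for t y
      using r1(2) that r by blast
    have deriv_bd: "norm ((deriv ^^ n) (H t) y) \<le> fact n * B / r ^ n" if "t \<in> K" "y \<in> cball x r" for n t y
    proof (rule Cauchy_inequality)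
      have sub: "cball y r \<subseteq> cball x (2 * r)"
      proof
        fix z assume "z \<in> cball y r"
        with that(2) dist_triangle[of x z y] show "z \<in> cball x (2 * r)" by simp
      qed
      have h: "H t holomorphic_on cball y r"
        using hol[OF that(1)] sub r by (meson holomorphic_on_subset order_trans)
      then show "H t holomorphic_on ball y r" "continuous_on (cball y r) (H t)"
        by (auto intro: holomorphic_on_imp_continuous_on elim: holomorphic_on_subset)
      show "0 < r" by fact
      show "norm (H t z) \<le> B" if "norm (y - z) = r" for z
        by (rule HB) (use \<open>t \<in> K\<close> sub that in \<open>auto simp: dist_norm\<close>)
    qed
    have taylor: "norm (H t y - H t x - (y - x) * deriv (H t) x) \<le> (2 * B / r\<^sup>2) * norm (y - x) ^ 2"
      if t: "t \<in> K" and y: "y \<in> ball x r" for t y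
    proof -
      have "cmod ((deriv ^^ 0) (H t) y - (\<Sum>i\<le>1. (deriv ^^ i) (H t) x * (y-x) ^ i / (fact i)))
        \<le> (fact 2 * B / r^2) * cmod (y - x) ^ Suc 1 / fact 1"
      proof (rule complex_Taylor[of "ball x r"])
        fix i z assume z: "z \<in> ball x r"
        have "H t holomorphic_on ball x r"
          using hol[OF t] r by (rule_tac holomorphic_on_subset) auto
        then have "(deriv ^^ i) (H t) holomorphic_on ball x r" by (rule holomorphic_higher_deriv) simp
        then show "((deriv ^^ i) (H t) has_field_derivative (deriv ^^ Suc i) (H t) z) (at z within ball x r)"
          using z by (metis funpow.simps(2) comp_apply holomorphic_derivI open_ball
              has_field_derivative_at_within)
      next
        fix z assume "z \<in> ball x r"
        then show "norm ((deriv ^^ Suc 1) (H t) z) \<le> fact 2 * B / r ^ 2"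
          using deriv_bd[OF t, of z 2] by (simp add: numeral_2_eq_2)
      qed (use r y in auto)
      then show ?thesis by (simp add: algebra_simps numeral_2_eq_2)
    qed
    define D where "D = L (\<lambda>t. deriv (H t) x)"
    have bH: "bounded ((\<lambda>t. H t y) ` K)" if "y \<in> ball x r" for y
      unfolding bounded_image_iff using HB that r by (intro exI[of _ B]) auto
    have bD: "bounded ((\<lambda>t. deriv (H t) x) ` K)"
      unfolding bounded_image_iff using deriv_bd[of _ x 1] r by (intro exI[of _ "B / r"]) auto
    have est: "norm (L (\<lambda>t. H t y) - L (\<lambda>t. H t x) - (y - x) * D) \<le> C * ((2 * B / r\<^sup>2) * norm (y - x) ^ 2)"
      if y: "y \<in> ball x r" for y
    proof -
      have "L (\<lambda>t. H t y) - L (\<lambda>t. H t x) - (y - x) * D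
          = L (\<lambda>t. H t y + (-1) * H t x + (- (y - x)) * deriv (H t) x)"
        using bH[OF y] bH[of x] bD r
        by (simp only: L_add L_scale bounded_add bounded_scale D_def centre_in_ball)
            (simp add: algebra_simps)
      also have "norm \<dots> \<le> C * ((2 * B / r\<^sup>2) * norm (y - x) ^ 2)"
        by (rule C(2)) (use taylor[OF _ y] in \<open>simp add: algebra_simps\<close>)
      finally show ?thesis .
    qed
    have "((\<lambda>y. (L (\<lambda>t. H t y) - L (\<lambda>t. H t x)) / (y - x)) \<longlongrightarrow> D) (at x)"
    proof (rule Lim_transform_within_open[of "\<lambda>y. ((L (\<lambda>t. H t y) - L (\<lambda>t. H t x)) / (y - x) - D) + D"])
      have "((\<lambda>y. (L (\<lambda>t. H t y) - L (\<lambda>t. H t x)) / (y - x) - D) \<longlongrightarrow> 0) (at x)"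
      proof (rule Lim_null_comparison)
        show "\<forall>\<^sub>F y in at x. norm ((L (\<lambda>t. H t y) - L (\<lambda>t. H t x)) / (y - x) - D)
            \<le> C * (2 * B / r\<^sup>2) * norm (y - x)"
          unfolding eventually_at
        proof (intro exI[of _ r] conjI ballI impI)
          fix y assume "y \<noteq> x \<and> dist y x < r"
          then have y: "y \<in> ball x r" "y \<noteq> x" by (auto simp: dist_commute)
          have "(L (\<lambda>t. H t y) - L (\<lambda>t. H t x)) / (y - x) - D
              = (L (\<lambda>t. H t y) - L (\<lambda>t. H t x) - (y - x) * D) / (y - x)"
            using y by (simp add: field_simps)
          also have "norm \<dots> \<le> C * ((2 * B / r\<^sup>2) * norm (y - x) ^ 2) / norm (y - x)"
            unfolding norm_divide using est[OF y(1)] by (rule divide_right_mono) simp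
          also have "\<dots> = C * (2 * B / r\<^sup>2) * norm (y - x)"
            using y by (simp add: power2_eq_square)
          finally show "norm ((L (\<lambda>t. H t y) - L (\<lambda>t. H t x)) / (y - x) - D)
            \<le> C * (2 * B / r\<^sup>2) * norm (y - x)" .
        qed (use r in auto)
        have "((\<lambda>y. C * (2 * B / r\<^sup>2) * norm (y - x)) \<longlongrightarrow> C * (2 * B / r\<^sup>2) * norm (x - x)) (at x)"
          by (intro tendsto_intros)
        then show "((\<lambda>y. C * (2 * B / r\<^sup>2) * norm (y - x)) \<longlongrightarrow> 0) (at x)" by simp
      qed
      from tendsto_add[OF this tendsto_const[of D]]
      show "((\<lambda>y. (L (\<lambda>t. H t y) - L (\<lambda>t. H t x)) / (y - x) - D + D) \<longlongrightarrow> D) (at x)" by simp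
    qed (use U x in auto)
    then show ?thesis by (auto simp: has_field_derivative_iff)
  qed
  then show ?thesis using U by (auto simp: holomorphic_on_open)
qed

end


section \<open>Zeros and growth of holomorphic functions\<close>

text \<open>The zeros in \<open>A\<close> are divided out one point at a time, each with its full
  order. That order is finite since \<open>g w \<noteq> 0\<close> on a connected domain excludes the
  zero function.\<close>

lemma holomorphic_factor_poly:
  assumes "finite A" "A \<subseteq> W" and g: "g holomorphic_on W" "open W" "connected W" "w \<in> W" "g w \<noteq> 0"
  shows "\<exists>Q g1. g1 holomorphic_on W \<and> (\<forall>x\<in>W. g x = poly Q x * g1 x) \<and> (\<forall>x\<in>A. g1 x \<noteq> 0) \<and>
    (\<forall>x. poly Q x = 0 \<longrightarrow> x \<in> A)"
  using assms(1,2)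
proof (induction A)
  case empty
  show ?case by (rule exI[of _ 1], rule exI[of _ g]) (use g in auto)
next
  case (insert a A)
  then obtain Q g1 where IH: "g1 holomorphic_on W" "\<And>x. x \<in> W \<Longrightarrow> g x = poly Q x * g1 x"
    "\<And>x. x \<in> A \<Longrightarrow> g1 x \<noteq> 0" "\<And>x. poly Q x = 0 \<Longrightarrow> x \<in> A"
    by blast
  show ?case
  proof (cases "g1 a = 0")
    case False
    then show ?thesis using IH by blast
  next
    case True
    have "g1 w \<noteq> 0" using g IH(2)[of w] by auto
    have aW: "a \<in> W" using insert.prems by simp
    have nc: "\<not> g1 constant_on W"
      using True g aW \<open>g1 w \<noteq> 0\<close> unfolding constant_on_def by metis
    obtain h r n where "0 < n" and h: "0 < r" "ball a r \<subseteq> W" "h holomorphic_on ball a r"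
      "\<And>x. x \<in> ball a r \<Longrightarrow> g1 x = (x - a) ^ n * h x" "\<And>x. x \<in> ball a r \<Longrightarrow> h x \<noteq> 0"
      by (rule holomorphic_factor_zero_nonconstant[OF IH(1) g(2,3) aW True nc]) (rule that; assumption)
    \<comment> \<open>The quotient by \<open>(x - a) ^ n\<close>, with the value of the local
      cofactor \<open>h\<close> filling the removable singularity at \<open>a\<close>.\<close>
    define g2 where "g2 x = (if x = a then h a else g1 x / (x - a) ^ n)" for x
    have "g2 holomorphic_on (W - {a}) \<union> ball a r"
    proof (rule holomorphic_on_Un)
      have "(\<lambda>x. g1 x / (x - a) ^ n) holomorphic_on W - {a}"
        by (intro holomorphic_intros holomorphic_on_subset[OF IH(1)]) auto
      then show "g2 holomorphic_on W - {a}"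
        by (rule holomorphic_transform) (auto simp: g2_def)
      show "g2 holomorphic_on ball a r"
        by (rule holomorphic_transform[OF h(3)]) (auto simp: g2_def h(4))
    qed (use g in auto)
    also have "(W - {a}) \<union> ball a r = W" using h insert.prems by auto
    finally have 1: "g2 holomorphic_on W" .
    have 2: "g x = poly (Q * [:-a, 1:] ^ n) x * g2 x" if "x \<in> W" for x
    proof (cases "x = a")
      case True
      then show ?thesis using IH(2)[OF that] h(1) h(4)[of a] by (auto simp: g2_def)
    next
      case False
      then show ?thesis using IH(2)[OF that] by (auto simp: g2_def)
    qed
    have 3: "g2 x \<noteq> 0" if "x \<in> insert a A" for x
      using that IH(3) h(1,5) by (auto simp: g2_def)
    have 4: "x \<in> insert a A" if "poly (Q * [:-a, 1:] ^ n) x = 0" for x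
      using that IH(4) by (auto split: if_splits)
    show ?thesis using 1 2 3 4 by blast
  qed
qed

lemma Liouville_polynomial_poly:
  fixes f :: "complex \<Rightarrow> complex"
  assumes "f holomorphic_on UNIV"
    and "\<And>z. A \<le> norm z \<Longrightarrow> norm (f z) \<le> B * norm z ^ n"
  shows "\<exists>p :: complex poly. degree p \<le> n \<and> (\<forall>z. f z = poly p z)"
proof (intro exI conjI allI)
  let ?p = "\<Sum>k\<le>n. monom ((deriv ^^ k) f 0 / fact k) k"
  show "degree ?p \<le> n"
    by (intro degree_sum_le) (auto intro: order_trans[OF degree_monom_le])
  show "f z = poly ?p z" for z
    using Liouville_polynomial[OF assms, where \<xi> = z] by (simp add: poly_sum poly_monom)
qed

lemma poly_growth:
  fixes p :: "complex poly"
  obtains A where "0 \<le> A" "\<And>z. 1 \<le> norm z \<Longrightarrow> norm (poly p z) \<le> A * norm z ^ degree p"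
proof
  show "0 \<le> (\<Sum>i\<le>degree p. norm (coeff p i))" by (simp add: sum_nonneg)
  fix z :: complex assume z: "1 \<le> norm z"
  have "norm (poly p z) \<le> (\<Sum>i\<le>degree p. norm (coeff p i * z ^ i))"
    unfolding poly_altdef by (rule norm_sum)
  also have "\<dots> \<le> (\<Sum>i\<le>degree p. norm (coeff p i) * norm z ^ degree p)"
    by (intro sum_mono) (use z in \<open>auto simp: norm_mult norm_power intro!: mult_left_mono power_increasing\<close>)
  finally show "norm (poly p z) \<le> (\<Sum>i\<le>degree p. norm (coeff p i)) * norm z ^ degree p"
    by (simp add: sum_distrib_right)
qed

section \<open>Cauchy transforms and divided differences\<close>

context bounded_functional begin

definition cauchy :: "(complex \<Rightarrow> complex) \<Rightarrow> complex \<Rightarrow> complex" where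
  "cauchy f x = L (\<lambda>t. f t / (t - x))"

lemma bounded_cauchy_kernel:
  assumes "bounded (f ` K)" "x \<notin> K"
  shows "bounded ((\<lambda>t. f t / (t - x)) ` K)"
proof -
  obtain B where B: "\<And>t. t \<in> K \<Longrightarrow> norm (f t) \<le> B" using assms by (auto simp: bounded_image_iff)
  obtain r where r: "r > 0" "ball x r \<subseteq> - K"
    using assms compact_K by (meson ComplI compact_imp_closed open_Compl openE)
  have "norm (f t / (t - x)) \<le> B / r" if "t \<in> K" for t
    unfolding norm_divide
  proof (rule frac_le)
    show "r \<le> norm (t - x)" using that r by (force simp: dist_norm norm_minus_commute not_less)
    show "norm (f t) \<le> B" by (rule B) fact
    then show "0 \<le> B" using norm_ge_zero order_trans by blast
  qed (use r in auto)
  then show ?thesis by (auto simp: bounded_image_iff)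
qed

lemma holomorphic_cauchy:
  assumes f: "bounded (f ` K)"
  shows "cauchy f holomorphic_on - K"
  unfolding cauchy_def[abs_def]
proof (rule holomorphic_L)
  show "open (- K)" using compact_K by (simp add: compact_imp_closed open_Compl)
  show "(\<lambda>x. f t / (t - x)) holomorphic_on - K" if "t \<in> K" for t
    using that by (intro holomorphic_intros) auto
  fix x assume x: "x \<in> - K"
  obtain B where B: "\<And>t. t \<in> K \<Longrightarrow> norm (f t) \<le> B" using f by (auto simp: bounded_image_iff)
  obtain r where r: "r > 0" "ball x r \<subseteq> - K"
    using \<open>open (- K)\<close> x openE by blast
  have "norm (f t / (t - y)) \<le> B / (r/2)" if "t \<in> K" "y \<in> cball x (r/2)" for t y
    unfolding norm_divide
  proof (rule frac_le)
    have "r \<le> dist x t" using that r by (force simp: not_less)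
    then show "r/2 \<le> norm (t - y)" using that dist_triangle[of x t y]
      by (simp add: dist_norm norm_minus_commute)
    show "norm (f t) \<le> B" by (rule B) fact
    then show "0 \<le> B" using norm_ge_zero order_trans by blast
  qed (use r in auto)
  then show "\<exists>r>0. \<exists>B. \<forall>t\<in>K. \<forall>y\<in>- K \<inter> cball x r. norm (f t / (t - y)) \<le> B"
    using r by (intro exI[of _ "r/2"] conjI exI[of _ "B / (r/2)"]) auto
qed

lemma K_subset_ball: "\<exists>\<rho>>0. \<forall>t\<in>K. norm t < \<rho>"
  using bounded_subset_ballD[OF compact_imp_bounded[OF compact_K], of 0] by force

lemma outside_large:
  assumes "\<And>t. t \<in> K \<Longrightarrow> norm t < \<rho>" "\<rho> \<le> norm x"
  shows "x \<in> outside K"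
proof -
  have "K \<subseteq> ball 0 \<rho>" using assms by auto
  then have "outside (ball 0 \<rho>) \<subseteq> outside K" by (rule outside_mono)
  moreover have "outside (ball 0 \<rho>) = - ball (0::complex) \<rho>"
    by (intro outside_convex) auto
  ultimately show ?thesis using assms by auto
qed

text \<open>Once \<open>norm x\<close> is at least twice the radius of a disc containing
  \<open>K\<close>, \<open>norm (t - x)\<close> is at least \<open>norm x / 2\<close> on
  \<open>K\<close>, so the transform decays like \<open>1 / norm x\<close>.\<close>

lemma cauchy_at_infinity:
  assumes f: "bounded (f ` K)"
  shows "(cauchy f \<longlongrightarrow> 0) at_infinity"
proof -
  obtain \<rho> where \<rho>: "\<rho> > 0" "\<And>t. t \<in> K \<Longrightarrow> norm t < \<rho>" using K_subset_ball by blast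
  obtain B where B: "\<And>t. t \<in> K \<Longrightarrow> norm (f t) \<le> B" using f by (auto simp: bounded_image_iff)
  obtain C where C: "0 \<le> C" "\<And>f B. (\<And>z. z \<in> K \<Longrightarrow> norm (f z) \<le> B) \<Longrightarrow> norm (L f) \<le> C * B"
    using L_bound by blast
  have B0: "0 \<le> B" using B nonempty_K norm_ge_zero order_trans by blast
  have "norm (cauchy f x) \<le> C * (2 * B) * norm (inverse x)" if x: "2 * \<rho> \<le> norm x" for x
  proof -
    have "norm (cauchy f x) \<le> C * (B / (norm x / 2))"
      unfolding cauchy_def
    proof (rule C(2))
      fix t assume t: "t \<in> K"
      have "norm x / 2 \<le> norm (t - x)"
        using \<rho>(2)[OF t] x norm_triangle_ineq2[of x t] by (simp add: norm_minus_commute)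
      then show "norm (f t / (t - x)) \<le> B / (norm x / 2)"
        unfolding norm_divide using x \<rho> B[OF t] B0 by (intro frac_le) auto
    qed
    then show ?thesis by (simp add: norm_inverse norm_divide field_simps)
  qed
  then have "\<forall>\<^sub>F x in at_infinity. norm (cauchy f x) \<le> C * (2 * B) * norm (inverse x)"
    unfolding eventually_at_infinity by blast
  moreover have "((\<lambda>x. C * (2 * B) * norm (inverse x :: complex)) \<longlongrightarrow> C * (2 * B) * norm (0::complex)) at_infinity"
    by (intro tendsto_intros tendsto_inverse_0)
  ultimately show ?thesis by (rule_tac Lim_null_comparison) auto
qed

definition ddiff :: "(complex \<Rightarrow> complex) \<Rightarrow> complex \<Rightarrow> complex \<Rightarrow> complex" where
  "ddiff f t x = (if x = t then deriv f t else (f x - f t) / (x - t))"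

text \<open>Two regimes: if \<open>t\<close> lies in the doubled disc about \<open>x\<close>, the
  mean value inequality bounds the quotient by the derivative; otherwise \<open>t\<close> and
  \<open>y\<close> are at distance at least \<open>r\<close>.\<close>

lemma ddiff_bounded:
  assumes U: "open U" "K \<subseteq> U" and f: "f holomorphic_on U" and x: "x \<in> U"
  shows "\<exists>r>0. \<exists>B. \<forall>t\<in>K. \<forall>y\<in>U \<inter> cball x r. norm (ddiff f t y) \<le> B"
proof -
  obtain s where s: "s > 0" "cball x s \<subseteq> U" using U x open_contains_cball by blast
  define r where "r = s / 2"
  have r: "r > 0" "cball x (2 * r) \<subseteq> U" using s by (auto simp: r_def)
  have "deriv f holomorphic_on U" using f U by (intro holomorphic_deriv)
  then have "bounded (deriv f ` cball x (2 * r))" "bounded (f ` cball x (2 * r))"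
    using r f by (auto intro!: holomorphic_bounded_on_compact)
  then obtain B1 B2 where "\<forall>y\<in>cball x (2 * r). norm (deriv f y) \<le> B1"
    and "\<forall>y\<in>cball x (2 * r). norm (f y) \<le> B2"
    unfolding bounded_image_iff by blast
  then have B1: "\<And>y. y \<in> cball x (2 * r) \<Longrightarrow> norm (deriv f y) \<le> B1"
    and B2: "\<And>y. y \<in> cball x (2 * r) \<Longrightarrow> norm (f y) \<le> B2" by auto
  obtain B3 where B3: "\<And>t. t \<in> K \<Longrightarrow> norm (f t) \<le> B3"
    using bounded_holomorphic[OF f U(2)] unfolding bounded_image_iff by blast
  have "0 \<le> B2" using order_trans[OF norm_ge_zero B2[of x]] r by simp
  moreover have "0 \<le> B3" using B3 nonempty_K norm_ge_zero order_trans by blast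
  ultimately have B0: "0 \<le> B2" "0 \<le> B3" .
  have "norm (ddiff f t y) \<le> max B1 ((B2 + B3) / r)" if t: "t \<in> K" and y: "y \<in> cball x r" for t y
  proof (cases "t \<in> cball x (2 * r)")
    case True
    have y2: "y \<in> cball x (2 * r)" using y r by auto
    have "norm (f y - f t) \<le> B1 * norm (y - t)"
    proof (rule field_differentiable_bound[of "cball x (2 * r)" f "deriv f"])
      show "(f has_field_derivative deriv f z) (at z within cball x (2 * r))"
        if "z \<in> cball x (2 * r)" for z
        using holomorphic_derivI[OF f U(1)] that r(2) by (blast intro: has_field_derivative_at_within)
    qed (use B1 True y2 in auto)
    then have "norm (ddiff f t y) \<le> B1"
      using B1[OF True] by (auto simp: ddiff_def norm_divide field_simps)
    then show ?thesis by simp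
  next
    case False
    have d: "r \<le> norm (y - t)"
      using False y dist_triangle[of x t y] by (auto simp: dist_norm)
    then have "y \<noteq> t" using r by auto
    then have "norm (ddiff f t y) = norm (f y - f t) / norm (y - t)" by (simp add: ddiff_def norm_divide)
    also have "\<dots> \<le> (B2 + B3) / r"
      using B0 d r B2[of y] B3[OF t] y norm_triangle_ineq4[of "f y" "f t"] by (intro frac_le) auto
    finally show ?thesis by simp
  qed
  then show ?thesis using r by (intro exI[of _ r] conjI exI[of _ "max B1 ((B2 + B3) / r)"]) auto
qed

lemma holomorphic_ddiff:
  assumes U: "open U" and f: "f holomorphic_on U"
  shows "ddiff f t holomorphic_on U"
  using pole_lemma_open[OF f U, of t] unfolding ddiff_def[abs_def] by simp

lemma ddiff_sym_bounded:
  assumes U: "open U" "K \<subseteq> U" and f: "f holomorphic_on U" and x: "x \<in> U"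
  shows "bounded ((\<lambda>t. ddiff f t x) ` K)"
  using ddiff_bounded[OF assms] x unfolding bounded_image_iff by fastforce

text \<open>Off \<open>K\<close> the divided difference splits into two Cauchy kernels, while the
  left-hand side stays meaningful on all of \<open>U\<close>. This is the bridge between functions
  holomorphic on \<open>U\<close> and Cauchy transforms.\<close>

lemma L_ddiff:
  assumes U: "open U" "K \<subseteq> U" and f: "f holomorphic_on U" and x: "x \<in> U - K"
  shows "L (\<lambda>t. ddiff f t x) = cauchy f x - f x * cauchy (\<lambda>_. 1) x"
proof -
  have b: "bounded ((\<lambda>t. f t / (t - x)) ` K)" "bounded ((\<lambda>t. 1 / (t - x)) ` K)"
    using x bounded_holomorphic[OF f U(2)] bounded_cauchy_kernel[of "\<lambda>_. 1" x]
    by (auto intro!: bounded_cauchy_kernel simp: bounded_image_iff[of "\<lambda>_. 1"])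
  have "L (\<lambda>t. ddiff f t x) = L (\<lambda>t. f t / (t - x) - f x * (1 / (t - x)))"
  proof (rule L_cong)
    show "ddiff f t x = f t / (t - x) - f x * (1 / (t - x))" if "t \<in> K" for t
    proof -
      have "x - t \<noteq> 0" "t - x \<noteq> 0" using that x by auto
      moreover have "x \<noteq> t" using that x by auto
      ultimately show ?thesis by (simp add: ddiff_def divide_simps) (simp add: algebra_simps)
    qed
    show "bounded ((\<lambda>t. ddiff f t x) ` K)" using ddiff_sym_bounded[OF U f] x by simp
  qed
  also have "\<dots> = cauchy f x - f x * cauchy (\<lambda>_. 1) x"
    using b by (simp only: L_diff L_scale bounded_scale cauchy_def)
  finally show ?thesis .
qed

end


section \<open>Functionals annihilating a shift-invariant space\<close>

text \<open>\<open>S\<close> is meant to be the invariant subspace divided by \<open>g0\<close>.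
  Invariance under the backward shift is stated by the identity \<open>f z = f 0 + z * g z\<close>
  on \<open>\<Omega>\<close>, and \<open>h0\<close> witnesses that \<open>L\<close> is nonzero on
  holomorphic functions.\<close>

locale shift_annihilator = bounded_functional +
  fixes \<Omega> :: "complex set" and S :: "(complex \<Rightarrow> complex) set" and h0 :: "complex \<Rightarrow> complex"
  assumes open_Om: "open \<Omega>" and connected_Om: "connected \<Omega>" and simply: "simply_connected \<Omega>"
    and zero_Om: "0 \<in> \<Omega>" and K_sub: "K \<subseteq> \<Omega>"
    and S_hol: "\<And>f. f \<in> S \<Longrightarrow> f holomorphic_on \<Omega>"
    and S_shift: "\<And>f. f \<in> S \<Longrightarrow> \<exists>g\<in>S. \<forall>z\<in>\<Omega>. f z = f 0 + z * g z"
    and S_null: "\<And>f. f \<in> S \<Longrightarrow> L f = 0"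
    and h0_hol: "h0 holomorphic_on \<Omega>" and h0_nz: "L h0 \<noteq> 0"
begin

definition N :: "(complex \<Rightarrow> complex) \<Rightarrow> complex \<Rightarrow> complex" where
  "N f x = L (\<lambda>t. ddiff f t x)"

abbreviation G :: "complex \<Rightarrow> complex" where "G \<equiv> cauchy (\<lambda>_. 1)"

lemma N_holomorphic: "f holomorphic_on \<Omega> \<Longrightarrow> N f holomorphic_on \<Omega>"
  unfolding N_def[abs_def]
  by (intro holomorphic_L open_Om holomorphic_ddiff ddiff_bounded K_sub) auto

lemma N_eq_cauchy: "f holomorphic_on \<Omega> \<Longrightarrow> x \<in> \<Omega> \<Longrightarrow> x \<notin> K \<Longrightarrow> N f x = cauchy f x - f x * G x"
  unfolding N_def by (rule L_ddiff[OF open_Om K_sub]) auto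

text \<open>Leibniz rule for divided differences, applied to the product \<open>z * g z\<close>; the
  constant \<open>c\<close> drops out.\<close>

lemma ddiff_shift:
  assumes f: "f holomorphic_on \<Omega>" and g: "g holomorphic_on \<Omega>"
    and fg: "\<forall>z\<in>\<Omega>. f z = c + z * g z" and "t \<in> \<Omega>" "x \<in> \<Omega>"
  shows "ddiff f t x = g t + x * ddiff g t x"
proof (cases "x = t")
  case True
  have "((\<lambda>z. c + z * g z) has_field_derivative (g t + t * deriv g t)) (at t)"
    using holomorphic_derivI[OF g open_Om \<open>t \<in> \<Omega>\<close>] by (auto intro!: derivative_eq_intros)
  then have "(f has_field_derivative (g t + t * deriv g t)) (at t)"
    by (rule has_field_derivative_transform_within_open[OF _ open_Om \<open>t \<in> \<Omega>\<close>]) (use fg in auto)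
  then show ?thesis using True by (simp add: ddiff_def DERIV_imp_deriv)
next
  case False
  have "f x = c + x * g x" "f t = c + t * g t" using fg assms by auto
  then show ?thesis using False by (simp add: ddiff_def field_simps)
qed

text \<open>When \<open>L\<close> is applied to \<open>ddiff_shift\<close>, the term
  \<open>L g\<close> vanishes because \<open>g \<in> S\<close>.\<close>

lemma N_shift:
  assumes "f \<in> S"
  shows "\<exists>g\<in>S. \<forall>x\<in>\<Omega>. N f x = x * N g x"
proof -
  obtain g where g: "g \<in> S" "\<forall>z\<in>\<Omega>. f z = f 0 + z * g z" using S_shift assms by blast
  have "N f x = x * N g x" if x: "x \<in> \<Omega>" for x
  proof -
    have b: "bounded ((\<lambda>t. ddiff g t x) ` K)"
      using ddiff_sym_bounded[OF open_Om K_sub S_hol[OF g(1)] x] .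
    have bg: "bounded (g ` K)" by (rule bounded_holomorphic[OF S_hol[OF g(1)] K_sub])
    have "N f x = L (\<lambda>t. g t + x * ddiff g t x)"
      unfolding N_def
    proof (rule L_cong)
      show "ddiff f t x = g t + x * ddiff g t x" if "t \<in> K" for t
        by (rule ddiff_shift[OF S_hol[OF assms] S_hol[OF g(1)] g(2)]) (use that K_sub x in auto)
      show "bounded ((\<lambda>t. ddiff f t x) ` K)"
        using ddiff_sym_bounded[OF open_Om K_sub S_hol[OF assms] x] .
    qed
    also have "\<dots> = x * N g x"
      using b bg S_null[OF g(1)] by (simp add: L_add bounded_scale L_scale N_def)
    finally show ?thesis .
  qed
  then show ?thesis using g(1) by blast
qed

lemma N_shift_power: "f \<in> S \<Longrightarrow> \<exists>g\<in>S. \<forall>x\<in>\<Omega>. N f x = x ^ k * N g x"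
proof (induction k arbitrary: f)
  case 0
  then show ?case by (intro bexI[of _ f]) auto
next
  case (Suc k)
  obtain g where g: "g \<in> S" "\<forall>x\<in>\<Omega>. N f x = x * N g x" using N_shift[OF Suc.prems] by blast
  obtain h where h: "h \<in> S" "\<forall>x\<in>\<Omega>. N g x = x ^ k * N h x" using Suc.IH[OF g(1)] by blast
  show ?case by (rule bexI[OF _ h(1)]) (use g h in auto)
qed

lemma N_zero:
  assumes f: "f \<in> S" and "x \<in> \<Omega>"
  shows "N f x = 0"
proof (rule ccontr)
  assume nz: "N f x \<noteq> 0"
  have N0: "N f 0 = 0" using N_shift[OF f] zero_Om by auto
  have nc: "\<not> N f constant_on \<Omega>"
    using nz N0 zero_Om assms unfolding constant_on_def by metis
  obtain h r n where h: "0 < r" "ball 0 r \<subseteq> \<Omega>" "h holomorphic_on ball 0 r"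
      "\<And>w. w \<in> ball 0 r \<Longrightarrow> N f w = (w - 0) ^ n * h w" "\<And>w. w \<in> ball 0 r \<Longrightarrow> h w \<noteq> 0"
    by (rule holomorphic_factor_zero_nonconstant[OF N_holomorphic[OF S_hol[OF f]] open_Om
          connected_Om zero_Om N0 nc]) (rule that; assumption)
  \<comment> \<open>One factor more than the order \<open>n\<close> of the zero at \<open>0\<close>
    leaves \<open>h w = w * N g w\<close>, hence \<open>h 0 = 0\<close> in the limit, contradicting
    the choice of \<open>h\<close>.\<close>
  obtain g where g: "g \<in> S" "\<forall>x\<in>\<Omega>. N f x = x ^ Suc n * N g x" using N_shift_power[OF f] by blast
  have "h 0 = 0 * N g 0"
  proof (rule tendsto_unique[of "at 0"])
    have c: "isCont h 0" "isCont (N g) 0"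
      using h(1-3) N_holomorphic[OF S_hol[OF g(1)]] zero_Om open_Om
      by (auto simp: continuous_on_eq_continuous_at dest!: holomorphic_on_imp_continuous_on)
    show "(h \<longlongrightarrow> h 0) (at 0)" using c by (simp add: isCont_def)
    have "((\<lambda>w. w * N g w) \<longlongrightarrow> 0 * N g 0) (at 0)"
      using c by (intro tendsto_intros) (simp add: isCont_def)
    then show "(h \<longlongrightarrow> 0 * N g 0) (at 0)"
    proof (rule Lim_transform_within_open)
      fix w assume w: "w \<in> ball 0 r" "w \<noteq> (0::complex)"
      then show "w * N g w = h w" using h(2) h(4)[OF w(1)] g(2) by auto
    qed (use h in auto)
  qed auto
  then show False using h(5)[of 0] h(1) by simp
qed

lemma cauchy_eq: "f \<in> S \<Longrightarrow> x \<in> \<Omega> \<Longrightarrow> x \<notin> K \<Longrightarrow> cauchy f x = f x * G x"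
  using N_eq_cauchy[OF S_hol] N_zero by simp

section \<open>The unbounded component of the complement of \<open>K\<close> and the behaviour of
  \<open>G\<close> on it\<close>

lemma open_W: "open (outside K)"
  by (rule open_outside) (rule compact_imp_closed[OF compact_K])

lemma connected_W: "connected (outside K)"
  by (rule connected_outside) (auto intro: compact_imp_bounded[OF compact_K])

lemma W_sub: "outside K \<subseteq> - K"
  using outside_no_overlap by blast

text \<open>Since \<open>\<Omega>\<close> is simply connected, the bounded components of the
  complement of \<open>K\<close> lie inside \<open>\<Omega>\<close>. So Cauchy transforms on
  \<open>outside K\<close> reach every point off \<open>\<Omega>\<close>.\<close>

lemma Om_Un_W: "\<Omega> \<union> outside K = UNIV"
  using subset_simply_connected_imp_inside_subset[OF simply open_Om K_sub] K_sub
    inside_Un_outside[of K] by blast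

lemma holomorphic_cauchy_W: "bounded (f ` K) \<Longrightarrow> cauchy f holomorphic_on outside K"
  using holomorphic_cauchy W_sub by (rule holomorphic_on_subset)

lemma bounded_1: "bounded ((\<lambda>_. 1 :: complex) ` K)"
  by (auto simp: bounded_image_iff)

lemma G_nonzero: "\<exists>x\<in>outside K. G x \<noteq> 0"
proof (rule ccontr)
  assume "\<not> ?thesis"
  then have G0: "G x = 0" if "x \<in> outside K" for x using that by blast
  have bh: "bounded (h0 ` K)" by (rule bounded_holomorphic[OF h0_hol K_sub])
  have bth: "bounded ((\<lambda>t. t * h0 t) ` K)"
    by (rule bounded_holomorphic[OF _ K_sub]) (intro holomorphic_intros h0_hol)
  \<comment> \<open>With \<open>G = 0\<close> on \<open>outside K\<close>, the identity
    \<open>N h0 = cauchy h0 - h0 * G\<close> makes the two branches agree on the overlap.\<close>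
  define E where "E x = (if x \<in> \<Omega> then N h0 x else cauchy h0 x)" for x
  have E_W: "E x = cauchy h0 x" if "x \<in> outside K" for x
    using that W_sub N_eq_cauchy[OF h0_hol, of x] G0 by (auto simp: E_def)
  have "E holomorphic_on UNIV"
    unfolding Om_Un_W[symmetric] E_def[abs_def]
  proof (rule holomorphic_on_If_Un)
    show "N h0 x = cauchy h0 x" if "x \<in> \<Omega>" "x \<in> outside K" for x
      using E_W[OF that(2)] that(1) by (simp add: E_def)
  qed (intro N_holomorphic h0_hol holomorphic_cauchy_W bh open_Om open_W)+
  moreover obtain \<rho> where \<rho>: "\<rho> > 0" "\<And>t. t \<in> K \<Longrightarrow> norm t < \<rho>" using K_subset_ball by blast
  have ev: "\<forall>\<^sub>F x in at_infinity. x \<in> outside K"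
    unfolding eventually_at_infinity using outside_large[OF \<rho>(2)] by blast
  have "(E \<longlongrightarrow> 0) at_infinity"
    by (rule Lim_transform_eventually[OF cauchy_at_infinity[OF bh]])
      (use ev E_W in \<open>auto elim: eventually_mono\<close>)
  ultimately have E0: "E x = 0" for x by (rule Liouville_weak_0)
  \<comment> \<open>From \<open>t / (t - x) = 1 + x / (t - x)\<close> one gets
    \<open>cauchy (\<lambda>t. t * h0 t) x = L h0 + x * cauchy h0 x\<close>. Since
    \<open>E = 0\<close>, the constant \<open>L h0\<close> equals a transform that tends to zero at
    infinity.\<close>
  have "L h0 = cauchy (\<lambda>t. t * h0 t) x" if x: "x \<in> outside K" for x
  proof -
    have b: "bounded ((\<lambda>t. h0 t / (t - x)) ` K)"
      using bounded_cauchy_kernel[OF bh] W_sub x by blast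
    have "cauchy (\<lambda>t. t * h0 t) x = L (\<lambda>t. h0 t + x * (h0 t / (t - x)))"
      unfolding cauchy_def
    proof (rule L_cong)
      show "t * h0 t / (t - x) = h0 t + x * (h0 t / (t - x))" if "t \<in> K" for t
      proof -
        have "t - x \<noteq> 0" using that x W_sub by auto
        then show ?thesis by (simp add: field_simps)
      qed
      show "bounded ((\<lambda>t. t * h0 t / (t - x)) ` K)"
        using bounded_cauchy_kernel[OF bth] W_sub x by blast
    qed
    also have "\<dots> = L h0 + x * cauchy h0 x"
      using bh b by (simp only: L_add bounded_scale L_scale cauchy_def)
    finally show ?thesis using E0[of x] E_W[OF x] by simp
  qed
  then have "\<forall>\<^sub>F x in at_infinity. cauchy (\<lambda>t. t * h0 t) x = L h0"
    using ev by (auto elim: eventually_mono)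
  then have "((\<lambda>x::complex. L h0) \<longlongrightarrow> 0) at_infinity"
    by (rule Lim_transform_eventually[OF cauchy_at_infinity[OF bth]])
  then have "L h0 = 0"
    by (rule tendsto_unique[OF trivial_limit_at_infinity tendsto_const])
  then show False using h0_nz by contradiction
qed

text \<open>In the coordinate \<open>w = 1 / x\<close>, \<open>G\<close> extends holomorphically to
  \<open>w = 0\<close> as \<open>Gi\<close>. It does not vanish identically, so its zero at
  \<open>w = 0\<close> has a finite order \<open>n\<close>, which bounds \<open>G\<close> below by a
  multiple of \<open>1 / norm x ^ n\<close>.\<close>

lemma G_lower_bound:
  "\<exists>c>0. \<exists>n \<rho>. \<rho> \<ge> 1 \<and> (\<forall>x. \<rho> \<le> norm x \<longrightarrow> x \<in> outside K \<and> c / norm x ^ n \<le> norm (G x))"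
proof -
  obtain \<rho> where \<rho>: "\<rho> > 0" "\<And>t. t \<in> K \<Longrightarrow> norm t < \<rho>" using K_subset_ball by blast
  \<comment> \<open>For \<open>norm w < 1 / (2 * \<rho>)\<close> one has
    \<open>norm (t * w) \<le> 1/2\<close> on \<open>K\<close>, so the kernel
    \<open>w / (t * w - 1)\<close> has no pole in \<open>U\<close>.\<close>
  define U where "U = ball (0::complex) (1 / (2 * \<rho>))"
  have small: "1/2 \<le> norm (t * w - 1)" if "t \<in> K" "w \<in> U" for t w
  proof -
    have "norm (t * w) \<le> \<rho> * (1 / (2 * \<rho>))"
      unfolding norm_mult using that \<rho>(1) \<rho>(2)[of t] by (intro mult_mono) (auto simp: U_def)
    then have "norm (t * w) \<le> 1/2" using \<rho> by simp
    then show ?thesis using norm_triangle_ineq2[of 1 "t * w"] by (simp add: norm_minus_commute)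
  qed
  define Gi where "Gi w = L (\<lambda>t. w / (t * w - 1))" for w
  have Gi: "Gi holomorphic_on U"
    unfolding Gi_def[abs_def]
  proof (rule holomorphic_L)
    show "(\<lambda>w. w / (t * w - 1)) holomorphic_on U" if "t \<in> K" for t
      using small[OF that] by (intro holomorphic_intros) fastforce
    fix x assume "x \<in> U"
    have "norm (w / (t * w - 1)) \<le> (1 / (2 * \<rho>)) / (1/2)" if "t \<in> K" "w \<in> U" for t w
      unfolding norm_divide using small[OF that] that \<rho> by (intro frac_le) (auto simp: U_def)
    then show "\<exists>r>0. \<exists>B. \<forall>t\<in>K. \<forall>y\<in>U \<inter> cball x r. norm (y / (t * y - 1)) \<le> B"
      by (intro exI[of _ 1] conjI exI[of _ "(1 / (2 * \<rho>)) / (1/2)"]) auto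
  qed (simp add: U_def)
  have GiG: "Gi w = G (1 / w)" if "w \<in> U" "w \<noteq> 0" for w
    unfolding Gi_def cauchy_def
  proof (rule L_cong)
    show "w / (t * w - 1) = 1 / (t - 1 / w)" if "t \<in> K" for t
      using \<open>w \<noteq> 0\<close> by (simp add: field_simps)
    show "bounded ((\<lambda>t. w / (t * w - 1)) ` K)"
      unfolding bounded_image_iff
    proof (intro exI ballI)
      show "norm (w / (t * w - 1)) \<le> norm w / (1/2)" if "t \<in> K" for t
        unfolding norm_divide using small[OF that \<open>w \<in> U\<close>] by (intro frac_le) auto
    qed
  qed
  have Gi0: "Gi 0 = 0"
    using L_scale[OF bounded_1, of 0] by (simp add: Gi_def)
  have U0: "0 \<in> U" "open U" "connected U" using \<rho> by (auto simp: U_def)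
  \<comment> \<open>A constant \<open>Gi\<close> would be \<open>0\<close>, so \<open>G\<close>
    would vanish near infinity and then, by the identity theorem, on the connected set
    \<open>outside K\<close>.\<close>
  have nc: "\<not> Gi constant_on U"
  proof
    assume "Gi constant_on U"
    then have Z: "Gi w = 0" if "w \<in> U" for w using that Gi0 U0(1) by (metis constant_on_def)
    have Gz: "G x = 0" if "x \<in> - cball 0 (2 * \<rho>)" for x
    proof -
      have "2 * \<rho> < norm x" "x \<noteq> 0" using that \<rho> by auto
      then have "1 / x \<in> U" using \<rho>(1) by (simp add: U_def norm_divide frac_less2)
      then show ?thesis using GiG[of "1/x"] Z[of "1/x"] \<open>x \<noteq> 0\<close> by simp
    qed
    obtain w where w: "w \<in> outside K" "G w \<noteq> 0" using G_nonzero by blast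
    have "G w = 0"
    proof (rule analytic_continuation_open[of "- cball 0 (2 * \<rho>)" "outside K" G "\<lambda>_. 0"])
      have "complex_of_real (3 * \<rho>) \<in> - cball 0 (2 * \<rho>)" using \<rho> by simp
      then show "- cball (0::complex) (2 * \<rho>) \<noteq> {}" by blast
      show "- cball 0 (2 * \<rho>) \<subseteq> outside K"
        using \<rho>(1) by (auto intro!: outside_large[OF \<rho>(2)])
    qed (use Gz w in \<open>auto intro!: holomorphic_cauchy_W bounded_1 open_W connected_W\<close>)
    then show False using w(2) by contradiction
  qed
  obtain h r n where h: "0 < r" "ball 0 r \<subseteq> U" "h holomorphic_on ball 0 r"
      "\<And>w. w \<in> ball 0 r \<Longrightarrow> Gi w = (w - 0) ^ n * h w" "\<And>w. w \<in> ball 0 r \<Longrightarrow> h w \<noteq> 0"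
    by (rule holomorphic_factor_zero_nonconstant[OF Gi U0(2,3,1) Gi0 nc]) (rule that; assumption)
  \<comment> \<open>The least modulus of the nonvanishing cofactor \<open>h\<close> on the closed
    disc of half the radius supplies the constant \<open>c\<close>.\<close>
  have "cball 0 (r/2) \<noteq> ({} :: complex set)" using h(1) by simp
  moreover have "continuous_on (cball 0 (r/2)) h"
    using h(1,3) by (intro holomorphic_on_imp_continuous_on) (auto elim: holomorphic_on_subset)
  ultimately have "\<exists>w0\<in>cball 0 (r/2). \<forall>w\<in>cball 0 (r/2). norm (h w0) \<le> norm (h w)"
    by (intro continuous_attains_inf continuous_intros) auto
  then obtain w0 where w0: "w0 \<in> cball 0 (r/2)" "\<And>w. w \<in> cball 0 (r/2) \<Longrightarrow> norm (h w0) \<le> norm (h w)"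
    by blast
  \<comment> \<open>Beyond \<open>\<rho>\<close> a point lies in \<open>outside K\<close>; beyond
    \<open>2 / r\<close> its inverse lies in \<open>cball 0 (r/2)\<close>; the \<open>1\<close> is
    demanded by the statement.\<close>
  define \<sigma> where "\<sigma> = max 1 (max \<rho> (2 / r))"
  have "x \<in> outside K \<and> norm (h w0) / norm x ^ n \<le> norm (G x)" if x: "\<sigma> \<le> norm x" for x
  proof
    show "x \<in> outside K" by (rule outside_large[OF \<rho>(2)]) (use x in \<open>auto simp: \<sigma>_def\<close>)
    have "2 / r \<le> norm x" "x \<noteq> 0" using x by (auto simp: \<sigma>_def)
    then have w: "1 / x \<in> cball 0 (r/2)" using h(1) by (simp add: norm_divide field_simps)
    then have wr: "1 / x \<in> ball 0 r" using h(1) by simp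
    have "norm (G x) = norm (Gi (1 / x))" using GiG[of "1/x"] h(2) wr \<open>x \<noteq> 0\<close> by auto
    also have "\<dots> = norm (h (1 / x)) / norm x ^ n"
      using h(4)[OF wr] by (simp add: norm_mult norm_power norm_divide power_divide)
    also have "\<dots> \<ge> norm (h w0) / norm x ^ n" using w0(2)[OF w] by (intro divide_right_mono) auto
    finally show "norm (h w0) / norm x ^ n \<le> norm (G x)" .
  qed
  moreover have "norm (h w0) > 0" using h(5)[of w0] w0(1) h(1) by simp
  moreover have "\<sigma> \<ge> 1" by (simp add: \<sigma>_def)
  ultimately show ?thesis by blast
qed

text \<open>The quotient \<open>cauchy f / G\<close> continues \<open>f\<close> to
  \<open>outside K\<close>. Write \<open>G = Q * g\<close> with \<open>g\<close> free of zeros off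
  \<open>\<Omega>\<close>. Then \<open>Q * f\<close> on \<open>\<Omega>\<close> and
  \<open>cauchy f / g\<close> elsewhere form an entire function of polynomial growth, hence a
  polynomial. \<open>Q\<close> and the degree bound come from \<open>G\<close> alone, so they serve
  all \<open>f\<close>.\<close>

theorem common_denominator:
  "\<exists>Q n. (\<forall>z\<in>\<Omega>. poly Q z \<noteq> 0) \<and> (\<forall>f\<in>S. \<exists>p :: complex poly. degree p \<le> n \<and> (\<forall>z\<in>\<Omega>. poly Q z * f z = poly p z))"
proof -
  obtain c n \<rho> where c: "c > 0" "\<rho> \<ge> 1"
    and out: "\<And>x. \<rho> \<le> norm x \<Longrightarrow> x \<in> outside K"
    and low: "\<And>x. \<rho> \<le> norm x \<Longrightarrow> c / norm x ^ n \<le> norm (G x)"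
    using G_lower_bound by blast
  have Gnz: "G x \<noteq> 0" if "\<rho> \<le> norm x" for x
  proof -
    have "0 < c / norm x ^ n" using that c by (intro divide_pos_pos zero_less_power) auto
    then show ?thesis using low[OF that] by auto
  qed
  \<comment> \<open>Only zeros off \<open>\<Omega>\<close> must be cancelled, and \<open>Gnz\<close>
    confines them to a compact set.\<close>
  define A where "A = {x \<in> - \<Omega> \<inter> cball 0 \<rho>. G x = 0}"
  obtain w where w: "w \<in> outside K" "G w \<noteq> 0" using G_nonzero by blast
  have Ghol: "G holomorphic_on outside K" by (intro holomorphic_cauchy_W bounded_1)
  have coW: "- \<Omega> \<subseteq> outside K" using Om_Un_W by blast
  have finA: "finite A"
  proof (cases "G constant_on outside K")
    case True
    then have "A = {}" using w coW unfolding A_def constant_on_def by fastforce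
    then show ?thesis by simp
  next
    case False
    have "compact (- \<Omega> \<inter> cball 0 \<rho>)" using open_Om by (intro closed_Int_compact) auto
    then show ?thesis
      unfolding A_def using coW
      by (intro holomorphic_compact_finite_zeros[OF Ghol open_W connected_W _ _ False]) auto
  qed
  obtain Q g where g: "g holomorphic_on outside K" "\<And>x. x \<in> outside K \<Longrightarrow> G x = poly Q x * g x"
    "\<And>x. x \<in> A \<Longrightarrow> g x \<noteq> 0" "\<And>x. poly Q x = 0 \<Longrightarrow> x \<in> A"
  proof -
    have "A \<subseteq> outside K" using coW by (auto simp: A_def)
    from holomorphic_factor_poly[OF finA this Ghol open_W connected_W w] show ?thesis
      using that by blast
  qed
  have gnz: "g x \<noteq> 0" if "x \<notin> \<Omega>" for x
  proof (cases "x \<in> A")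
    case True then show ?thesis by (rule g(3))
  next
    case False
    have "G x \<noteq> 0"
      using False Gnz[of x] that by (cases "\<rho> \<le> norm x") (auto simp: A_def)
    then show ?thesis using g(2)[of x] coW that by auto
  qed
  have Qnz: "poly Q z \<noteq> 0" if "z \<in> \<Omega>" for z using g(4)[of z] that by (auto simp: A_def)
  obtain B where B: "0 \<le> B" "\<And>z. 1 \<le> norm z \<Longrightarrow> norm (poly Q z) \<le> B * norm z ^ degree Q"
    using poly_growth by blast
  have "\<exists>p :: complex poly. degree p \<le> degree Q + n \<and> (\<forall>z\<in>\<Omega>. poly Q z * f z = poly p z)" if f: "f \<in> S" for f
  proof -
    have bf: "bounded (f ` K)" by (rule bounded_holomorphic[OF S_hol[OF f] K_sub])
    \<comment> \<open>\<open>outside K\<close> without the zeros of \<open>g\<close>. All of these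
      lie in \<open>\<Omega>\<close>, so \<open>\<Omega>\<close> and \<open>W'\<close> still cover
      the plane.\<close>
    define W' where "W' = outside K - (outside K \<inter> g -` {0})"
    have "closedin (top_of_set (outside K)) (outside K \<inter> g -` {0})"
      by (intro continuous_closedin_preimage holomorphic_on_imp_continuous_on g(1)) auto
    then have "openin (top_of_set (outside K)) W'"
      unfolding W'_def by (intro openin_diff) auto
    then have oW': "open W'" using open_W openin_open_trans by blast
    have UN: "\<Omega> \<union> W' = UNIV" using gnz coW by (auto simp: W'_def)
    define E where "E x = (if x \<in> \<Omega> then poly Q x * f x else cauchy f x / g x)" for x
    have E_W: "E x = cauchy f x / g x" if "x \<in> W'" for x
    proof (cases "x \<in> \<Omega>")
      case True
      have x: "x \<in> outside K" "g x \<noteq> 0" "x \<notin> K" using that W_sub by (auto simp: W'_def)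
      then show ?thesis using cauchy_eq[OF f True x(3)] g(2)[OF x(1)] True by (simp add: E_def)
    qed (simp add: E_def)
    have "E holomorphic_on UNIV"
      unfolding UN[symmetric] E_def[abs_def]
    proof (rule holomorphic_on_If_Un)
      show "(\<lambda>x. poly Q x * f x) holomorphic_on \<Omega>"
        by (intro holomorphic_intros S_hol f)
      show "(\<lambda>x. cauchy f x / g x) holomorphic_on W'"
        by (intro holomorphic_intros holomorphic_on_subset[OF holomorphic_cauchy_W[OF bf]]
            holomorphic_on_subset[OF g(1)]) (auto simp: W'_def)
      show "poly Q x * f x = cauchy f x / g x" if "x \<in> \<Omega>" "x \<in> W'" for x
        using E_W[OF that(2)] that(1) by (simp add: E_def)
    qed (intro open_Om oW')+
    moreover
    obtain \<tau> where \<tau>: "\<And>x. \<tau> \<le> norm x \<Longrightarrow> norm (cauchy f x) < 1"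
      using cauchy_at_infinity[OF bf] unfolding Lim_at_infinity by (metis dist_0_norm dist_commute zero_less_one)
    \<comment> \<open>For large \<open>x\<close> the three factors of
      \<open>Q * cauchy f / G\<close> are bounded by \<open>B * norm x ^ degree Q\<close>, by
      \<open>1\<close>, and by the reciprocal of the lower bound for \<open>G\<close>.\<close>
    have "norm (E x) \<le> (B / c) * norm x ^ (degree Q + n)" if x: "max \<rho> \<tau> \<le> norm x" for x
    proof -
      have x1: "\<rho> \<le> norm x" "\<tau> \<le> norm x" "1 \<le> norm x" using x c by auto
      have Q: "poly Q x \<noteq> 0" "g x \<noteq> 0" using Gnz[OF x1(1)] g(2)[OF out[OF x1(1)]] by auto
      then have "E x = cauchy f x / g x" by (intro E_W) (auto simp: W'_def out x1)
      also have "\<dots> = poly Q x * cauchy f x / G x" using Q g(2)[OF out[OF x1(1)]] by simp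
      also have "norm \<dots> \<le> (B * norm x ^ degree Q) * 1 / (c / norm x ^ n)"
        unfolding norm_divide norm_mult
        using B \<tau>[OF x1(2)] low[OF x1(1)] x1 c
        by (intro frac_le mult_mono) (auto intro!: divide_pos_pos zero_less_power mult_nonneg_nonneg)
      also have "\<dots> = (B / c) * norm x ^ (degree Q + n)" by (simp add: power_add)
      finally show ?thesis .
    qed
    ultimately obtain p where p: "degree p \<le> degree Q + n" "\<And>z. E z = poly p z"
      using Liouville_polynomial_poly by metis
    then show ?thesis by (intro exI[of _ p]) (simp add: E_def flip: p(2))
  qed
  then show ?thesis using Qnz by blast
qed

end


section \<open>Spaces of rational functions with a common denominator\<close>

text \<open>Indexed by the dimension, with a strict degree bound, so that \<open>d = 0\<close> gives
  the zero space and the zero polynomial needs no degree convention.\<close>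

definition polys_below :: "nat \<Rightarrow> complex poly set" where
  "polys_below d = {p. \<forall>i\<ge>d. coeff p i = 0}"

lemma polys_below_iff: "p \<in> polys_below d \<longleftrightarrow> p = 0 \<or> degree p < d"
proof
  assume p: "p \<in> polys_below d"
  show "p = 0 \<or> degree p < d"
  proof (rule ccontr)
    assume "\<not> ?thesis"
    then have "lead_coeff p \<noteq> 0" "d \<le> degree p" by auto
    then show False using p by (auto simp: polys_below_def)
  qed
qed (auto simp: polys_below_def coeff_eq_0)

lemma polys_below_add: "p \<in> polys_below d \<Longrightarrow> q \<in> polys_below d \<Longrightarrow> p + q \<in> polys_below d"
  and polys_below_diff: "p \<in> polys_below d \<Longrightarrow> q \<in> polys_below d \<Longrightarrow> p - q \<in> polys_below d"
  and polys_below_smult: "p \<in> polys_below d \<Longrightarrow> smult c p \<in> polys_below d"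
  and polys_below_0: "0 \<in> polys_below d"
  and polys_below_mono: "p \<in> polys_below d \<Longrightarrow> d \<le> e \<Longrightarrow> p \<in> polys_below e"
  by (auto simp: polys_below_def)

lemma polys_below_sum: "(\<And>x. x \<in> A \<Longrightarrow> f x \<in> polys_below d) \<Longrightarrow> sum f A \<in> polys_below d"
  by (auto simp: polys_below_def coeff_sum intro!: sum.neutral)

lemma polys_below_mult:
  assumes "p \<in> polys_below d" "degree q \<le> e"
  shows "p * q \<in> polys_below (d + e)"
  using assms degree_mult_le[of p q] by (auto simp: polys_below_iff)

text \<open>Induction on the degree of \<open>v\<close>: at a root \<open>a\<close> of order
  \<open>k\<close>, subtracting a suitable multiple of \<open>qpole a k\<close> leaves a numerator
  vanishing at \<open>a\<close>, so one linear factor cancels.\<close>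

lemma partial_fractions:
  assumes "v \<noteq> 0" "u \<in> polys_below (degree v)"
  shows "\<exists>h\<in>cfun.span {qpole w k | w k. poly v w = 0 \<and> 1 \<le> k \<and> k \<le> order w v}.
    \<forall>z. poly v z \<noteq> 0 \<longrightarrow> poly u z / poly v z = h z"
  using assms
proof (induction "degree v" arbitrary: u v rule: less_induct)
  case less
  let ?B = "\<lambda>v. {qpole w k | w k. poly v w = 0 \<and> 1 \<le> k \<and> k \<le> order w v}"
  show ?case
  proof (cases "u = 0")
    case True
    show ?thesis by (rule bexI[of _ 0]) (use True in \<open>auto simp: cfun.span_zero\<close>)
  next
    case False
    then have dv: "degree u < degree v" using less.prems(2) by (auto simp: polys_below_iff)
    then obtain a where a: "poly v a = 0" using alg_closed_imp_poly_has_root[of v] by auto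
    define k where "k = order a v"
    have k: "1 \<le> k" using a less.prems(1) by (simp add: k_def order_root Suc_le_eq)
    obtain v2 where v2: "v = [:-a, 1:] ^ k * v2" "\<not> [:-a, 1:] dvd v2"
      using order_decomp[OF less.prems(1), of a] unfolding k_def by blast
    have v2a: "poly v2 a \<noteq> 0" using v2(2) by (simp add: poly_eq_0_iff_dvd)
    have v20: "v2 \<noteq> 0" using v2a by auto
    define c where "c = poly u a / poly v2 a"
    have "poly (u - smult c v2) a = 0" using v2a by (simp add: c_def)
    then obtain u3 where u3: "u - smult c v2 = [:-a, 1:] * u3" by (metis poly_eq_0_iff_dvd dvdE)
    define v' where "v' = [:-a, 1:] ^ (k - 1) * v2"
    have vv': "v = [:-a, 1:] * v'" using v2(1) k unfolding v'_def
      by (metis (no_types, lifting) Suc_diff_1 less_eq_Suc_le mult.assoc One_nat_def power_Suc)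
    have v'0: "v' \<noteq> 0" using less.prems(1) vv' by auto
    have degv: "degree v = Suc (degree v')" unfolding vv' using v'0 by (subst degree_mult_eq) auto
    have degv2: "degree v2 < degree v"
      unfolding v2(1) using v20 k by (subst degree_mult_eq) (auto simp: degree_power_eq)
    have deg_diff: "degree (u - smult c v2) < degree v"
      using dv degv2 by (intro degree_diff_less) (auto intro: le_less_trans[OF degree_smult_le])
    have "u3 \<in> polys_below (degree v')"
    proof (cases "u3 = 0")
      case False
      then have "degree ([:-a, 1:] * u3) = Suc (degree u3)" by (subst degree_mult_eq) auto
      then show ?thesis using degv deg_diff unfolding u3 polys_below_iff by simp
    qed (simp add: polys_below_0)
    then obtain h where h: "h \<in> cfun.span (?B v')" "\<And>z. poly v' z \<noteq> 0 \<Longrightarrow> poly u3 z / poly v' z = h z"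
      using less.hyps[of v' u3] degv v'0 by auto
    have "?B v' \<subseteq> ?B v"
    proof -
      have "v' dvd v" unfolding vv' by (rule dvd_triv_right)
      then have "order w v' \<le> order w v" for w by (rule dvd_imp_order_le[OF less.prems(1)])
      moreover have "poly v w = 0" if "poly v' w = 0" for w using that vv' by simp
      ultimately show ?thesis using le_trans by blast
    qed
    then have "h \<in> cfun.span (?B v)" using h(1) cfun.span_mono by blast
    moreover have "qpole a k \<in> cfun.span (?B v)" using a k by (intro cfun.span_base) (auto simp: k_def)
    ultimately have "h + fscale c (qpole a k) \<in> cfun.span (?B v)"
      by (intro cfun.span_add cfun.span_scale)
    moreover have "poly u z / poly v z = (h + fscale c (qpole a k)) z" if "poly v z \<noteq> 0" for z
    proof -
      have nz: "z - a \<noteq> 0" "poly v' z \<noteq> 0" "poly v2 z \<noteq> 0"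
        using that vv' by (auto simp: v'_def)
      have "poly u z = c * poly v2 z + (z - a) * poly u3 z"
        using arg_cong[OF u3, of "\<lambda>p. poly p z"] by (simp add: algebra_simps)
      moreover have "poly v z = (z - a) ^ k * poly v2 z" by (simp add: v2(1))
      moreover have "poly v z = (z - a) * poly v' z" by (simp add: vv' algebra_simps)
      ultimately have "poly u z / poly v z
          = c * poly v2 z / ((z - a) ^ k * poly v2 z) + (z - a) * poly u3 z / ((z - a) * poly v' z)"
        by (metis add_divide_distrib)
      then show ?thesis using nz h(2)[of z] by (simp add: fscale_def qpole_def)
    qed
    ultimately show ?thesis by blast
  qed
qed

definition quotient_space :: "(complex \<Rightarrow> complex) \<Rightarrow> complex poly \<Rightarrow> nat \<Rightarrow> (complex \<Rightarrow> complex) set" where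
  "quotient_space g0 Q d = (\<lambda>p z. g0 z * (poly p z / poly Q z)) ` polys_below d"

lemma subspace_quotient_space: "cfun.subspace (quotient_space g0 Q d)"
proof (rule cfun.subspaceI)
  show "0 \<in> quotient_space g0 Q d"
    unfolding quotient_space_def by (rule image_eqI[of _ _ 0]) (auto simp: polys_below_0 fun_eq_iff)
  fix f assume "f \<in> quotient_space g0 Q d"
  then obtain p where p: "p \<in> polys_below d" "f = (\<lambda>z. g0 z * (poly p z / poly Q z))"
    unfolding quotient_space_def by blast
  show "fscale c f \<in> quotient_space g0 Q d" for c
    unfolding quotient_space_def p(2)
    by (rule image_eqI[OF _ polys_below_smult[OF p(1), of c]]) (simp add: fscale_def fun_eq_iff)
  fix g assume "g \<in> quotient_space g0 Q d"
  then obtain q where q: "q \<in> polys_below d" "g = (\<lambda>z. g0 z * (poly q z / poly Q z))"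
    unfolding quotient_space_def by blast
  show "f + g \<in> quotient_space g0 Q d"
    unfolding quotient_space_def p(2) q(2)
    by (rule image_eqI[OF _ polys_below_add[OF p(1) q(1)]])
      (simp add: fun_eq_iff add_divide_distrib algebra_simps)
qed

text \<open>The \<open>Suc\<close> passes from the non-strict bound of \<open>polys_upto\<close> to
  the strict one of \<open>polys_below\<close>; \<open>-\<infinity>\<close> becomes dimension
  \<open>0\<close>.\<close>

definition strict_degree_bound :: "ereal \<Rightarrow> nat" where
  "strict_degree_bound n = (if n = -\<infinity> then 0 else Suc (nat \<lfloor>real_of_ereal n\<rfloor>))"

lemma polys_upto_eq:
  assumes "n \<in> degree_bounds"
  shows "polys_upto n = poly ` polys_below (strict_degree_bound n)"
proof -
  have "{p. pdeg p \<le> n} = polys_below (strict_degree_bound n)"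
  proof (cases "n = -\<infinity>")
    case True
    then show ?thesis by (auto simp: strict_degree_bound_def polys_below_iff pdeg_def)
  next
    case False
    then obtain k :: nat where "n = ereal (real k)" using assms by (auto simp: degree_bounds_def)
    then show ?thesis
      by (auto simp: strict_degree_bound_def polys_below_iff pdeg_def less_Suc_eq_le)
  qed
  then show ?thesis by (auto simp: polys_upto_def)
qed

section \<open>Prescribed poles over a common denominator\<close>

locale pole_divisor =
  fixes \<Lambda> :: "complex set" and m :: "complex \<Rightarrow> nat"
  assumes fin: "finite \<Lambda>" and pos: "\<And>w. w \<in> \<Lambda> \<Longrightarrow> 1 \<le> m w"
begin

definition den :: "complex poly" where "den = (\<Prod>w\<in>\<Lambda>. [:-w, 1:] ^ m w)"

lemma den_nonzero: "den \<noteq> 0"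
  unfolding den_def using fin by simp

lemma den_root: "poly den z = 0 \<longleftrightarrow> z \<in> \<Lambda>"
  unfolding den_def poly_prod using fin pos by (force simp: poly_power)

lemma order_den: "w \<in> \<Lambda> \<Longrightarrow> order w den = m w"
proof -
  assume w: "w \<in> \<Lambda>"
  define q where "q = (\<Prod>x\<in>\<Lambda> - {w}. [:-x, 1:] ^ m x)"
  have den: "den = [:-w, 1:] ^ m w * q"
    unfolding den_def q_def using fin w by (simp add: prod.remove)
  have "poly q w \<noteq> 0" unfolding q_def poly_prod using fin by (auto simp: poly_power)
  then have "order w q = 0" by (rule order_0I)
  then show "order w den = m w"
    using den den_nonzero order_mult[of "[:-w, 1:] ^ m w" q w] by (simp add: order_power_n_n)
qed

lemma degree_den_0: "degree den = 0 \<longleftrightarrow> \<Lambda> = {}"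
proof
  assume "degree den = 0"
  then obtain c where c: "den = [:c:]" by (rule degree_eq_zeroE)
  then have "c \<noteq> 0" using den_nonzero by auto
  then show "\<Lambda> = {}" using den_root c by auto
next
  assume "\<Lambda> = {}"
  then show "degree den = 0" unfolding den_def by simp
qed

lemma pole_space_eq:
  "pole_space (multiple_variety \<Lambda> m) = cfun.span {qpole w k | w k. w \<in> \<Lambda> \<and> 1 \<le> k \<and> k \<le> m w}"
  unfolding pole_space_def multiple_variety_def by (rule arg_cong[where f = cfun.span]) auto

lemma pole_space_common_denominator:
  assumes "h \<in> pole_space (multiple_variety \<Lambda> m)"
  shows "\<exists>p\<in>polys_below (degree den). \<forall>z. z \<notin> \<Lambda> \<longrightarrow> h z = poly p z / poly den z"
proof -
  let ?X = "{h. \<exists>p\<in>polys_below (degree den). \<forall>z. z \<notin> \<Lambda> \<longrightarrow> h z = poly p z / poly den z}"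
  have "cfun.subspace ?X"
  proof (rule cfun.subspaceI)
    show "0 \<in> ?X" by (auto intro!: bexI[of _ 0] polys_below_0)
    fix f assume "f \<in> ?X"
    then obtain p where p: "p \<in> polys_below (degree den)" "\<And>z. z \<notin> \<Lambda> \<Longrightarrow> f z = poly p z / poly den z"
      by blast
    show "fscale c f \<in> ?X" for c
      using p by (auto simp: fscale_def intro!: bexI[OF _ polys_below_smult[OF p(1), of c]])
    fix g assume "g \<in> ?X"
    then obtain q where q: "q \<in> polys_below (degree den)" "\<And>z. z \<notin> \<Lambda> \<Longrightarrow> g z = poly q z / poly den z"
      by blast
    show "f + g \<in> ?X"
      using p q by (auto simp: add_divide_distrib intro!: bexI[OF _ polys_below_add[OF p(1) q(1)]])
  qed
  moreover have "qpole w k \<in> ?X" if wk: "w \<in> \<Lambda>" "1 \<le> k" "k \<le> m w" for w k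
  proof -
    have "[:-w, 1:] ^ k dvd [:-w, 1:] ^ m w" using wk by (simp add: le_imp_power_dvd)
    also have "\<dots> dvd den" unfolding den_def
      using dvd_prodI[OF fin wk(1), of "\<lambda>w. [:-w, 1:] ^ m w"] by simp
    finally obtain q where q: "den = [:-w, 1:] ^ k * q" by (rule dvdE)
    have q0: "q \<noteq> 0" using den_nonzero q by auto
    have "degree den = k + degree q" unfolding q using q0
      by (subst degree_mult_eq) (auto simp: degree_power_eq)
    then have "q \<in> polys_below (degree den)" using wk by (simp add: polys_below_iff)
    moreover have "qpole w k z = poly q z / poly den z" if "z \<notin> \<Lambda>" for z
    proof -
      have "poly q z \<noteq> 0" using that den_root[of z] q by auto
      then show ?thesis by (simp add: qpole_def q)
    qed
    ultimately show ?thesis by blast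
  qed
  ultimately have "cfun.span {qpole w k | w k. w \<in> \<Lambda> \<and> 1 \<le> k \<and> k \<le> m w} \<subseteq> ?X"
    by (intro cfun.span_minimal) auto
  then show ?thesis using assms unfolding pole_space_eq by blast
qed

lemma quotient_mem_pole_space:
  assumes "p \<in> polys_below (degree den)"
  shows "\<exists>h\<in>pole_space (multiple_variety \<Lambda> m). \<forall>z. z \<notin> \<Lambda> \<longrightarrow> poly p z / poly den z = h z"
proof -
  have "{qpole w k | w k. poly den w = 0 \<and> 1 \<le> k \<and> k \<le> order w den}
      = {qpole w k | w k. w \<in> \<Lambda> \<and> 1 \<le> k \<and> k \<le> m w}"
    using den_root order_den by (metis (no_types, opaque_lifting))
  then show ?thesis
    using partial_fractions[OF den_nonzero assms] den_root by (simp add: pole_space_eq)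
qed

text \<open>Division with remainder by \<open>den\<close>: the quotient has degree below
  \<open>e\<close>, the remainder yields a sum of pole terms. At points of \<open>\<Lambda>\<close>
  both sides vanish through \<open>g0\<close>, whatever value the fractions have there.\<close>

lemma sum_space_eq_quotient_space:
  assumes g0: "\<And>z. z \<in> \<Lambda> \<Longrightarrow> g0 z = 0"
  shows "fmult g0 (poly ` polys_below e + pole_space (multiple_variety \<Lambda> m))
    = quotient_space g0 den (e + degree den)"
proof (intro equalityI subsetI)
  fix f assume "f \<in> fmult g0 (poly ` polys_below e + pole_space (multiple_variety \<Lambda> m))"
  then obtain r h where rh: "r \<in> polys_below e" "h \<in> pole_space (multiple_variety \<Lambda> m)" "f = g0 * (poly r + h)"
    unfolding fmult_def set_plus_def by blast
  obtain p where p: "p \<in> polys_below (degree den)" "\<And>z. z \<notin> \<Lambda> \<Longrightarrow> h z = poly p z / poly den z"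
    using pole_space_common_denominator[OF rh(2)] by blast
  have "f = (\<lambda>z. g0 z * (poly (r * den + p) z / poly den z))"
  proof
    fix z show "f z = g0 z * (poly (r * den + p) z / poly den z)"
      by (cases "z \<in> \<Lambda>") (use g0 p(2) den_root[of z] in \<open>auto simp: rh(3) add_divide_distrib\<close>)
  qed
  moreover have "r * den + p \<in> polys_below (e + degree den)"
    by (intro polys_below_add polys_below_mult rh polys_below_mono[OF p(1)]) auto
  ultimately show "f \<in> quotient_space g0 den (e + degree den)"
    unfolding quotient_space_def by blast
next
  fix f assume "f \<in> quotient_space g0 den (e + degree den)"
  then obtain p where p: "p \<in> polys_below (e + degree den)" "f = (\<lambda>z. g0 z * (poly p z / poly den z))"
    unfolding quotient_space_def by blast
  define r where "r = p div den"
  have "p mod den \<in> polys_below (degree den)"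
    using degree_mod_less[OF den_nonzero, of p] by (auto simp: polys_below_iff)
  then obtain h where h: "h \<in> pole_space (multiple_variety \<Lambda> m)"
    "\<And>z. z \<notin> \<Lambda> \<Longrightarrow> poly (p mod den) z / poly den z = h z"
    using quotient_mem_pole_space by blast
  have "r \<in> polys_below e"
  proof (cases "r = 0")
    case False
    have "degree p = degree r + degree den"
    proof -
      have "degree (r * den) = degree r + degree den" using False den_nonzero by (rule degree_mult_eq)
      moreover have "p = r * den + p mod den" by (simp only: r_def div_mult_mod_eq)
      moreover have "p mod den = 0 \<or> degree (p mod den) < degree (r * den)"
        using degree_mod_less[OF den_nonzero, of p] calculation(1) by auto
      ultimately show ?thesis by (metis add.right_neutral degree_add_eq_left)
    qed
    moreover have "p \<noteq> 0" using False by (auto simp: r_def)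
    ultimately show ?thesis using p(1) False by (auto simp: polys_below_iff)
  qed (simp add: polys_below_0)
  moreover have "f = g0 * (poly r + h)"
  proof
    fix z show "f z = (g0 * (poly r + h)) z"
    proof (cases "z \<in> \<Lambda>")
      case False
      have "poly p z = poly (r * den + p mod den) z" by (simp only: r_def div_mult_mod_eq)
      then show ?thesis using False den_root[of z] h(2)[OF False]
        by (simp add: p(2) field_simps flip: h(2)[OF False])
    qed (use g0 in \<open>auto simp: p(2)\<close>)
  qed
  ultimately show "f \<in> fmult g0 (poly ` polys_below e + pole_space (multiple_variety \<Lambda> m))"
    unfolding fmult_def set_plus_def using h(1) by blast
qed

end


section \<open>The action of the Pommiez operator on rational multiples of the base function\<close>

lemma poly_eqI_infinite:
  fixes p q :: "complex poly"
  assumes "infinite A" "\<And>z. z \<in> A \<Longrightarrow> poly p z = poly q z"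
  shows "p = q"
proof (rule ccontr)
  assume "p \<noteq> q"
  then have "finite {z. poly (p - q) z = 0}" by (intro poly_roots_finite) simp
  moreover have "A \<subseteq> {z. poly (p - q) z = 0}" using assms(2) by auto
  ultimately show False using assms(1) finite_subset by blast
qed

lemma coprime_if_no_common_root:
  fixes p q :: "complex poly"
  assumes "q \<noteq> 0" "\<And>z. poly p z = 0 \<Longrightarrow> poly q z = 0 \<Longrightarrow> False"
  shows "coprime p q"
proof -
  have "degree (gcd p q) = 0"
  proof (rule ccontr)
    assume "degree (gcd p q) \<noteq> 0"
    then obtain z where "poly (gcd p q) z = 0" using alg_closed_imp_poly_has_root[of "gcd p q"] by auto
    then have "[:-z, 1:] dvd p" "[:-z, 1:] dvd q"
      by (meson dvd_trans gcd_dvd1 gcd_dvd2 poly_eq_0_iff_dvd)+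
    then show False using assms(2) by (simp flip: poly_eq_0_iff_dvd)
  qed
  moreover have "gcd p q \<noteq> 0" using assms(1) by simp
  ultimately have "is_unit (gcd p q)" using is_unit_iff_degree by blast
  then show ?thesis by (simp only: is_unit_gcd)
qed

locale base_function =
  fixes \<Omega> :: "complex set" and g0 :: "complex \<Rightarrow> complex"
  assumes open_Om: "open \<Omega>" and zero_Om: "0 \<in> \<Omega>" and g0: "g0 \<in> hol_space \<Omega>"
    and g0_0: "g0 0 = 1" and g0_nz: "\<And>z. z \<in> \<Omega> \<Longrightarrow> g0 z \<noteq> 0"
begin

definition quot :: "complex poly \<Rightarrow> complex poly \<Rightarrow> complex \<Rightarrow> complex" where
  "quot Q p = (\<lambda>z. g0 z * (poly p z / poly Q z))"

lemma quotient_space_quot: "quotient_space g0 Q d = quot Q ` polys_below d"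
  by (simp add: quotient_space_def quot_def)

lemma g0_hol: "g0 holomorphic_on \<Omega>" and g0_out: "z \<notin> \<Omega> \<Longrightarrow> g0 z = 0"
  using g0 by (auto simp: hol_space_def)

lemma infinite_Om: "infinite \<Omega>"
  using open_Om zero_Om by (metis empty_iff finite_imp_not_open)

lemma quot_hol_space: "(\<And>z. z \<in> \<Omega> \<Longrightarrow> poly Q z \<noteq> 0) \<Longrightarrow> quot Q p \<in> hol_space \<Omega>"
  unfolding quot_def hol_space_def
  by (auto intro!: holomorphic_intros g0_hol simp: g0_out)

lemma quot_inject:
  assumes "\<And>z. z \<in> \<Omega> \<Longrightarrow> poly Q z \<noteq> 0" "\<And>z. z \<in> \<Omega> \<Longrightarrow> quot Q p z = quot Q q z"
  shows "p = q"
proof (rule poly_eqI_infinite[OF infinite_Om])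
  show "poly p z = poly q z" if "z \<in> \<Omega>" for z
    using assms(2)[OF that] assms(1)[OF that] g0_nz[OF that] by (simp add: quot_def)
qed

text \<open>Division by \<open>g0\<close> turns the operator into \<open>(h z - h 0) / z\<close>. At
  \<open>z = 0\<close> the product rule produces the term \<open>deriv g0 0 * h 0\<close>, which is
  the correction subtracted in \<open>pommiez\<close>, since \<open>f 0 = h 0\<close>.\<close>

lemma pommiez_mult:
  assumes f: "f \<in> hol_space \<Omega>" and h: "h holomorphic_on \<Omega>" "\<And>z. z \<in> \<Omega> \<Longrightarrow> f z = g0 z * h z"
    and k: "k holomorphic_on \<Omega>" "\<And>z. z \<in> \<Omega> \<Longrightarrow> h z = h 0 + z * k z" and z: "z \<in> \<Omega>"
  shows "pommiez \<Omega> g0 f z = g0 z * k z"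
proof (cases "z = 0")
  case False
  then show ?thesis
    using z zero_Om h(2)[OF z] h(2)[OF zero_Om] k(2)[OF z] g0_0 by (simp add: pommiez_def field_simps)
next
  case True
  have "((\<lambda>z. h 0 + z * k z) has_field_derivative k 0) (at 0)"
    using holomorphic_derivI[OF k(1) open_Om zero_Om] by (auto intro!: derivative_eq_intros)
  then have h': "(h has_field_derivative k 0) (at 0)"
    by (rule has_field_derivative_transform_within_open[OF _ open_Om zero_Om]) (use k in auto)
  have "((\<lambda>z. g0 z * h z) has_field_derivative (deriv g0 0 * h 0 + k 0 * g0 0)) (at 0)"
    by (rule DERIV_mult[OF holomorphic_derivI[OF g0_hol open_Om zero_Om] h'])
  then have "(f has_field_derivative (deriv g0 0 * h 0 + k 0 * g0 0)) (at 0)"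
    by (rule has_field_derivative_transform_within_open[OF _ open_Om zero_Om]) (use h in auto)
  then have "deriv f 0 = deriv g0 0 * h 0 + k 0 * g0 0" by (rule DERIV_imp_deriv)
  then show ?thesis using True z h(2)[OF zero_Om] g0_0 by (simp add: pommiez_def)
qed

text \<open>The numerator over \<open>Q\<close> of the backward shift of \<open>p / Q\<close>:
  subtracting the multiple of \<open>Q\<close> kills the constant coefficient, and
  \<open>poly_shift 1\<close> divides by the variable.\<close>

definition shift :: "complex poly \<Rightarrow> complex poly \<Rightarrow> complex poly" where
  "shift Q p = poly_shift 1 (p - smult (poly p 0 / poly Q 0) Q)"

lemma shift_eq:
  assumes "poly Q 0 \<noteq> 0"
  shows "p = smult (poly p 0 / poly Q 0) Q + [:0, 1:] * shift Q p"
proof -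
  let ?r = "p - smult (poly p 0 / poly Q 0) Q"
  have "?r = [:0, 1:] * shift Q p"
  proof (rule poly_eqI)
    fix n show "coeff ?r n = coeff ([:0, 1:] * shift Q p) n"
      using assms by (cases n) (auto simp: shift_def coeff_poly_shift simp flip: poly_0_coeff_0)
  qed
  then show ?thesis by (simp add: algebra_simps)
qed

text \<open>The multiple of \<open>Q\<close> may reach degree \<open>d\<close> exactly; dividing by
  the variable brings it back below \<open>d\<close>.\<close>

lemma shift_below: "degree Q \<le> d \<Longrightarrow> p \<in> polys_below d \<Longrightarrow> shift Q p \<in> polys_below d"
  by (auto simp: polys_below_def shift_def coeff_poly_shift coeff_eq_0)

lemma pommiez_quot:
  assumes Q: "\<And>z. z \<in> \<Omega> \<Longrightarrow> poly Q z \<noteq> 0"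
  shows "pommiez \<Omega> g0 (quot Q p) = quot Q (shift Q p)"
proof
  fix z show "pommiez \<Omega> g0 (quot Q p) z = quot Q (shift Q p) z"
  proof (cases "z \<in> \<Omega>")
    case True
    have Q0: "poly Q 0 \<noteq> 0" by (rule Q[OF zero_Om])
    show ?thesis
      unfolding quot_def[of Q "shift Q p"]
    proof (rule pommiez_mult[OF quot_hol_space[OF Q]])
      fix x assume x: "x \<in> \<Omega>"
      have "poly p x = poly (smult (poly p 0 / poly Q 0) Q + [:0, 1:] * shift Q p) x"
        using shift_eq[OF Q0, of p] by simp
      also have "\<dots> = poly p 0 / poly Q 0 * poly Q x + x * poly (shift Q p) x" by simp
      finally show "poly p x / poly Q x = poly p 0 / poly Q 0 + x * (poly (shift Q p) x / poly Q x)"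
        using Q[OF x] by (simp add: add_divide_distrib)
    qed (use Q True in \<open>auto intro!: holomorphic_intros simp: quot_def\<close>)
  qed (simp add: pommiez_def quot_def g0_out)
qed

text \<open>Evaluation at \<open>d\<close> nodes recovers a polynomial of degree less than \<open>d\<close> by Lagrange interpolation,
  so membership is tested by linear relations between finitely many point evaluations.\<close>

lemma closedin_quotient_space:
  assumes Q: "\<And>z. z \<in> \<Omega> \<Longrightarrow> poly Q z \<noteq> 0"
  shows "closedin (compact_convergence \<Omega>) (quotient_space g0 Q d)"
proof -
  have sub: "quotient_space g0 Q d \<subseteq> hol_space \<Omega>"
    unfolding quotient_space_quot using quot_hol_space[OF Q] by blast
  obtain A where A: "A \<subseteq> \<Omega>" "finite A" "card A = d"
    using infinite_arbitrarily_large[OF infinite_Om] by metis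
  define l where "l a = smult (inverse (\<Prod>b\<in>A - {a}. a - b)) (\<Prod>b\<in>A - {a}. [:-b, 1:])" for a
  have l_deg: "l a \<in> polys_below d" if "a \<in> A" for a
  proof -
    have "degree (\<Prod>b\<in>A - {a}. [:-b, 1:]) \<le> (\<Sum>b\<in>A - {a}. degree [:-b, 1::complex:])"
      using degree_prod_sum_le[of "A - {a}" "\<lambda>b. [:-b, 1:]"] A by (simp add: comp_def)
    also have "\<dots> < d" using that A card_gt_0_iff[of A] by auto
    finally show ?thesis unfolding l_def by (intro polys_below_smult) (simp add: polys_below_iff)
  qed
  have l_val: "poly (l a) b = (if b = a then 1 else 0)" if "a \<in> A" "b \<in> A" for a b
  proof -
    have "(\<Prod>c\<in>A - {a}. a - c) \<noteq> 0" using A by auto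
    moreover have "(\<Prod>c\<in>A - {a}. b - c) = 0" if "b \<noteq> a" using A that \<open>b \<in> A\<close> by auto
    ultimately show ?thesis by (auto simp: l_def poly_prod)
  qed
  have lagrange: "p = (\<Sum>a\<in>A. smult (poly p a) (l a))" if p: "p \<in> polys_below d" for p
  proof -
    define e where "e = p - (\<Sum>a\<in>A. smult (poly p a) (l a))"
    have "e \<in> polys_below d"
      unfolding e_def by (intro polys_below_diff polys_below_sum polys_below_smult l_deg p)
    moreover have "poly e b = 0" if b: "b \<in> A" for b
    proof -
      have "(\<Sum>a\<in>A. poly p a * poly (l a) b) = (\<Sum>a\<in>A. if a = b then poly p a else 0)"
        using b by (intro sum.cong) (auto simp: l_val)
      then show ?thesis using A b by (simp add: e_def poly_sum)
    qed
    ultimately have "e = 0"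
      using poly_eqI_degree[of A e 0] A by (cases "e = 0") (auto simp: polys_below_iff)
    then show ?thesis by (simp add: e_def)
  qed
  define w where "w x = poly Q x / g0 x" for x
  \<comment> \<open>\<open>\<phi>\<close> sends \<open>quot Q p\<close> to the values of
    \<open>p\<close>, and \<open>\<Phi>\<close> measures the failure of interpolation at the nodes
    \<open>A\<close>. For \<open>f\<close> in \<open>hol_space \<Omega>\<close>, membership thus
    means that \<open>\<Phi> f\<close> vanishes on \<open>\<Omega>\<close>.\<close>
  define \<phi> where "\<phi> f z = f z * w z" for f :: "complex \<Rightarrow> complex" and z
  define \<Phi> where "\<Phi> f z = \<phi> f z - (\<Sum>a\<in>A. \<phi> f a * poly (l a) z)" for f z
  have \<phi>_quot: "\<phi> (quot Q p) z = poly p z" if "z \<in> \<Omega>" for p z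
    using g0_nz[OF that] Q[OF that] by (simp add: \<phi>_def w_def quot_def)
  have \<Phi>_0: "\<Phi> f z = 0" if f: "f \<in> quotient_space g0 Q d" and z: "z \<in> \<Omega>" for f z
  proof -
    obtain p where p: "p \<in> polys_below d" "f = quot Q p" using f by (auto simp: quotient_space_quot)
    have "poly p z = poly (\<Sum>a\<in>A. smult (poly p a) (l a)) z" using lagrange[OF p(1)] by simp
    also have "\<dots> = (\<Sum>a\<in>A. \<phi> f a * poly (l a) z)"
      unfolding poly_sum p(2) using A \<phi>_quot by (auto intro!: sum.cong)
    finally show ?thesis using \<phi>_quot[OF z] by (simp add: \<Phi>_def p(2))
  qed
  have \<Phi>_mem: "f \<in> quotient_space g0 Q d" if f: "f \<in> hol_space \<Omega>" and 0: "\<And>z. z \<in> \<Omega> \<Longrightarrow> \<Phi> f z = 0" for f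
  proof -
    define p where "p = (\<Sum>a\<in>A. smult (\<phi> f a) (l a))"
    have "p \<in> polys_below d" unfolding p_def by (intro polys_below_sum polys_below_smult l_deg)
    moreover have "f = quot Q p"
    proof
      fix z show "f z = quot Q p z"
      proof (cases "z \<in> \<Omega>")
        case True
        have "\<phi> f z = poly p z" using 0[OF True] by (simp add: \<Phi>_def p_def poly_sum)
        then show ?thesis using g0_nz[OF True] Q[OF True] by (simp add: \<phi>_def w_def quot_def field_simps)
      next
        case False
        then show ?thesis using f by (simp add: quot_def g0_out hol_space_def)
      qed
    qed
    ultimately show ?thesis by (auto simp: quotient_space_quot)
  qed
  have "openin (compact_convergence \<Omega>) (hol_space \<Omega> - quotient_space g0 Q d)"
    unfolding openin_compact_convergence
  proof (intro conjI ballI)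
    fix f assume f: "f \<in> hol_space \<Omega> - quotient_space g0 Q d"
    then obtain z where z: "z \<in> \<Omega>" "\<Phi> f z \<noteq> 0" using \<Phi>_mem by blast
    define M where "M = norm (w z) + (\<Sum>a\<in>A. norm (w a * poly (l a) z))"
    have M: "0 \<le> M" unfolding M_def by (simp add: sum_nonneg)
    \<comment> \<open>At the fixed point \<open>z\<close>, moving \<open>f\<close> by less than
      \<open>e\<close> on \<open>insert z A\<close> changes \<open>\<Phi> f z\<close> by at most
      \<open>e * M\<close>; the \<open>+ 1\<close> makes this strictly less than its
      modulus.\<close>
    define e where "e = norm (\<Phi> f z) / (M + 1)"
    have e: "e > 0" using z M by (simp add: e_def)
    have "g \<notin> quotient_space g0 Q d" if g: "g \<in> compact_nbhd \<Omega> f (insert z A) e" for g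
    proof
      assume "g \<in> quotient_space g0 Q d"
      then have "\<Phi> f z = \<Phi> f z - \<Phi> g z" using \<Phi>_0 z by simp
      also have "\<dots> = (f z - g z) * w z - (\<Sum>a\<in>A. (f a - g a) * (w a * poly (l a) z))"
        by (simp add: \<Phi>_def \<phi>_def algebra_simps sum_subtractf)
      also have "norm \<dots> \<le> norm ((f z - g z) * w z) + (\<Sum>a\<in>A. norm ((f a - g a) * (w a * poly (l a) z)))"
        by (intro order_trans[OF norm_triangle_ineq4] add_left_mono norm_sum)
      also have "\<dots> \<le> e * norm (w z) + (\<Sum>a\<in>A. e * norm (w a * poly (l a) z))"
        using g e unfolding compact_nbhd_def norm_mult[of "f _ - g _"]
        by (intro add_mono sum_mono mult_right_mono) (auto simp: dist_norm norm_minus_commute intro: less_imp_le)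
      also have "\<dots> = e * M" by (simp add: M_def sum_distrib_left distrib_left)
      also have "\<dots> < e * (M + 1)" using e by simp
      also have "\<dots> = norm (\<Phi> f z)" using M by (simp add: e_def)
      finally show False by simp
    qed
    moreover have "compact_nbhd \<Omega> f (insert z A) e \<subseteq> hol_space \<Omega>" by (auto simp: compact_nbhd_def)
    ultimately show "\<exists>K e. compact K \<and> K \<subseteq> \<Omega> \<and> 0 < e \<and> compact_nbhd \<Omega> f K e \<subseteq> hol_space \<Omega> - quotient_space g0 Q d"
      using A z(1) e by (intro exI[of _ "insert z A"] exI[of _ e]) (auto intro: finite_imp_compact)
  qed auto
  then show ?thesis using sub by (simp add: closedin_def topspace_compact_convergence)
qed

lemma closed_invariant_quotient_space:
  assumes Q: "\<And>z. z \<in> \<Omega> \<Longrightarrow> poly Q z \<noteq> 0" and d: "degree Q \<le> d"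
  shows "closed_invariant_subspace \<Omega> g0 (quotient_space g0 Q d)"
proof -
  have "pommiez \<Omega> g0 ` quotient_space g0 Q d \<subseteq> quotient_space g0 Q d"
    unfolding quotient_space_quot using pommiez_quot[OF Q] shift_below[OF d] by auto
  moreover have "quotient_space g0 Q d \<subseteq> hol_space \<Omega>"
    unfolding quotient_space_quot using quot_hol_space[OF Q] by blast
  ultimately show ?thesis
    unfolding closed_invariant_subspace_def
    using subspace_quotient_space closedin_quotient_space[OF Q] by blast
qed

lemma proper_quotient_space:
  assumes Q: "\<And>z. z \<in> \<Omega> \<Longrightarrow> poly Q z \<noteq> 0"
  shows "proper_in \<Omega> (quotient_space g0 Q d) \<longleftrightarrow> 0 < d"
proof (cases "d = 0")
  case True
  then have "quotient_space g0 Q d = {0}"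
    by (auto simp: quotient_space_def polys_below_iff fun_eq_iff image_def)
  then show ?thesis using True by (simp add: proper_in_def)
next
  case False
  have "quot Q 1 \<in> quotient_space g0 Q d"
    using False by (auto simp: quotient_space_quot polys_below_iff)
  moreover have "quot Q 1 0 \<noteq> 0" using Q zero_Om g0_0 by (simp add: quot_def)
  ultimately have "quotient_space g0 Q d \<noteq> {0}" by (metis singletonD zero_fun_apply)
  moreover have "quot Q (monom 1 d) \<notin> quotient_space g0 Q d"
  proof
    assume "quot Q (monom 1 d) \<in> quotient_space g0 Q d"
    then obtain p where p: "p \<in> polys_below d" "quot Q (monom 1 d) = quot Q p"
      by (auto simp: quotient_space_quot)
    then have "monom 1 d = p" using quot_inject[OF Q] by metis
    then show False using p(1) by (auto simp: polys_below_def)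
  qed
  then have "quotient_space g0 Q d \<noteq> hol_space \<Omega>" using quot_hol_space[OF Q] by blast
  ultimately show ?thesis using False by (simp add: proper_in_def)
qed

end


section \<open>Subspaces generated by a single quotient under the shift\<close>

context base_function begin

text \<open>\<open>B\<close> is the Taylor polynomial of \<open>P / Q\<close> at \<open>0\<close>
  with \<open>j\<close> terms, and the iterated shift is the numerator of the remainder.\<close>

lemma shift_iterate:
  assumes Q: "poly Q 0 \<noteq> 0"
  shows "\<exists>B\<in>polys_below j. P = B * Q + monom 1 j * (shift Q ^^ j) P"
proof (induction j)
  case 0
  then show ?case by (auto intro!: bexI[of _ 0] polys_below_0)
next
  case (Suc j)
  then obtain B where B: "B \<in> polys_below j" "P = B * Q + monom 1 j * (shift Q ^^ j) P" by blast
  let ?p = "(shift Q ^^ j) P"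
  let ?c = "poly ?p 0 / poly Q 0"
  have m: "monom 1 (Suc j) = monom 1 j * [:0, 1::complex:]"
    by (simp add: monom_Suc)
  have "monom 1 j * ?p = monom 1 j * (smult ?c Q + [:0, 1:] * shift Q ?p)"
    using shift_eq[OF Q, of ?p] by (rule arg_cong)
  also have "\<dots> = monom ?c j * Q + monom 1 (Suc j) * shift Q ?p"
    unfolding m by (simp only: distrib_left mult.assoc mult_smult_right flip: smult_monom)
      (simp add: smult_monom mult_smult_left[symmetric] del: mult_smult_left)
  finally have "P = (B + monom ?c j) * Q + monom 1 (Suc j) * (shift Q ^^ Suc j) P"
    using B(2) by (simp add: algebra_simps)
  moreover have "B + monom ?c j \<in> polys_below (Suc j)"
    using B(1) by (intro polys_below_add) (auto simp: polys_below_def)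
  ultimately show ?case by blast
qed

text \<open>Multiplied by \<open>z ^ (d - 1)\<close>, a relation becomes
  \<open>A * P = C * Q\<close> with \<open>A\<close> of degree below \<open>d\<close> and
  \<open>C\<close> of degree below \<open>d - 1\<close>. Were \<open>A\<close> nonzero, coprimality
  would give \<open>degree Q < d\<close> and \<open>degree P + 1 < d\<close>, contrary to the choice
  of \<open>d\<close> as a maximum.\<close>

lemma shift_iterates_independent:
  assumes Q: "poly Q 0 \<noteq> 0" and cop: "coprime P Q" and P: "P \<noteq> 0"
    and d: "d = max (Suc (degree P)) (degree Q)"
    and sum: "(\<Sum>j<d. smult (a j) ((shift Q ^^ j) P)) = 0" and i: "i < d"
  shows "a i = 0"
proof -
  define J where "J = d - 1"
  have J: "d = Suc J" using d by (simp add: J_def)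
  obtain B where B: "\<And>j. B j \<in> polys_below j" "\<And>j. P = B j * Q + monom 1 j * (shift Q ^^ j) P"
    using shift_iterate[OF Q, of _ P] by metis
  \<comment> \<open>The coefficients of \<open>A\<close> are the \<open>a j\<close> in reversed
    order, so \<open>A = 0\<close> settles the claim; \<open>C\<close> collects the terms with
    \<open>B j\<close>.\<close>
  define A where "A = (\<Sum>j<d. monom (a j) (J - j))"
  define C where "C = (\<Sum>j<d. monom (a j) (J - j) * B j)"
  have "A * P - C * Q = (\<Sum>j<d. monom (a j) (J - j) * (P - B j * Q))"
    unfolding A_def C_def sum_distrib_right sum_subtractf[symmetric]
    by (rule sum.cong) (simp_all add: algebra_simps)
  also have "\<dots> = (\<Sum>j<d. monom 1 J * smult (a j) ((shift Q ^^ j) P))"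
  proof (rule sum.cong)
    fix j assume "j \<in> {..<d}"
    then have j: "J - j + j = J" using J by auto
    have "P - B j * Q = monom 1 j * (shift Q ^^ j) P"
      using B(2)[of j] by (metis add_diff_cancel_left')
    then have "monom (a j) (J - j) * (P - B j * Q) = monom (a j) (J - j) * (monom 1 j * (shift Q ^^ j) P)"
      by (rule arg_cong)
    also have "\<dots> = monom (a j) J * (shift Q ^^ j) P"
      using j by (simp add: mult_monom flip: mult.assoc)
    also have "\<dots> = monom 1 J * smult (a j) ((shift Q ^^ j) P)"
      by (simp add: smult_monom flip: mult_smult_left)
    finally show "monom (a j) (J - j) * (P - B j * Q) = monom 1 J * smult (a j) ((shift Q ^^ j) P)" .
  qed simp
  also have "\<dots> = 0" unfolding sum_distrib_left[symmetric] sum by simp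
  finally have AC: "A * P = C * Q" by simp
  have Adeg: "A \<in> polys_below d"
    unfolding A_def by (intro polys_below_sum) (auto simp: polys_below_def J)
  have Cdeg: "C \<in> polys_below J"
    unfolding C_def
  proof (intro polys_below_sum)
    fix j assume "j \<in> {..<d}"
    then have j: "j + (J - j) = J" using J by auto
    have "B j * monom (a j) (J - j) \<in> polys_below (j + (J - j))"
      by (intro polys_below_mult B(1) degree_monom_le)
    then show "monom (a j) (J - j) * B j \<in> polys_below J" using j by (simp add: mult.commute)
  qed
  have "A = 0"
  proof (rule ccontr)
    assume A0: "A \<noteq> 0"
    then have C0: "C \<noteq> 0" using AC P by auto
    have "Q dvd A * P" "P dvd C * Q" using AC by (metis dvd_triv_right)+
    then have "Q dvd A" "P dvd C" using cop
      by (simp_all add: coprime_dvd_mult_left_iff coprime_commute)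
    then have "degree Q \<le> degree A" "degree P \<le> degree C" using A0 C0 by (auto intro: dvd_imp_degree_le)
    then have "degree Q < d" "Suc (degree P) < d" using Adeg Cdeg A0 C0 J by (auto simp: polys_below_iff)
    then show False using d by simp
  qed
  have "coeff A (J - i) = (\<Sum>j<d. if j = i then a j else 0)"
    unfolding A_def coeff_sum using i J by (intro sum.cong) auto
  then show ?thesis using i \<open>A = 0\<close> by simp
qed

text \<open>The first \<open>d\<close> iterates are independent in the \<open>d\<close>-dimensional
  space \<open>polys_below d\<close>, hence span it, and a shift-invariant subspace containing
  \<open>P\<close> contains them all.\<close>

lemma polys_below_le_span_iterates:
  assumes Q: "poly Q 0 \<noteq> 0" and cop: "coprime P Q" and P: "P \<noteq> 0"
    and d: "d = max (Suc (degree P)) (degree Q)"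
    and V0: "0 \<in> V" and Vadd: "\<And>p q. p \<in> V \<Longrightarrow> q \<in> V \<Longrightarrow> p + q \<in> V"
    and Vsmult: "\<And>c p. p \<in> V \<Longrightarrow> smult c p \<in> V"
    and Vshift: "\<And>p. p \<in> V \<Longrightarrow> shift Q p \<in> V" and PV: "P \<in> V"
  shows "polys_below d \<subseteq> V"
proof
  fix p assume p: "p \<in> polys_below d"
  interpret pv: vector_space "smult :: complex \<Rightarrow> complex poly \<Rightarrow> complex poly"
    by unfold_locales (auto simp: smult_add_right smult_add_left)
  define F where "F j = (shift Q ^^ j) P" for j
  define T where "T = (\<lambda>i. monom (1::complex) i) ` {..<d}"
  note ind = shift_iterates_independent[OF Q cop P d, folded F_def]
  \<comment> \<open>Two equal iterates would give a relation with coefficients \<open>1\<close> and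
    \<open>-1\<close>; distinctness allows passing from the indexed family to the set of
    iterates.\<close>
  have inj: "inj_on F {..<d}"
  proof (rule inj_onI, rule ccontr)
    fix i j assume ij: "i \<in> {..<d}" "j \<in> {..<d}" "F i = F j" "i \<noteq> j"
    have "(\<Sum>k<d. smult ((if k = i then 1 else 0) - (if k = j then 1 else 0)) (F k))
        = (\<Sum>k<d. if k = i then F k else 0) - (\<Sum>k<d. if k = j then F k else 0)"
      unfolding sum_subtractf[symmetric] by (rule sum.cong) auto
    also have "\<dots> = 0" using ij by simp
    finally show False using ind[of "\<lambda>k. (if k = i then 1 else 0) - (if k = j then 1 else 0)" i] ij by simp
  qed
  have indep: "pv.independent (F ` {..<d})"
  proof
    assume "pv.dependent (F ` {..<d})"
    then obtain u where u: "\<exists>v\<in>F ` {..<d}. u v \<noteq> 0" "(\<Sum>v\<in>F ` {..<d}. smult (u v) v) = 0"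
      by (subst (asm) pv.dependent_finite) auto
    then have "(\<Sum>j<d. smult (u (F j)) (F j)) = 0" by (simp add: sum.reindex[OF inj])
    then show False using ind[of "\<lambda>j. u (F j)"] u(1) by auto
  qed
  have spanT: "q \<in> pv.span T" if "q \<in> polys_below d" for q
  proof -
    have "q = (\<Sum>i<d. smult (coeff q i) (monom 1 i))"
    proof (rule poly_eqI)
      fix n
      have "coeff (\<Sum>i<d. smult (coeff q i) (monom 1 i)) n = (\<Sum>i<d. if i = n then coeff q i else 0)"
        unfolding coeff_sum by (rule sum.cong) auto
      then show "coeff q n = coeff (\<Sum>i<d. smult (coeff q i) (monom 1 i)) n"
        using that by (auto simp: polys_below_def)
    qed
    also have "\<dots> \<in> pv.span T"
      by (intro pv.span_sum pv.span_scale pv.span_base) (auto simp: T_def)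
    finally show ?thesis .
  qed
  have Fd: "F j \<in> polys_below d" for j
  proof (induction j)
    case 0
    then show ?case using d by (simp add: F_def polys_below_iff less_max_iff_disj)
  next
    case (Suc j)
    then show ?case using shift_below[of Q d] d by (simp add: F_def)
  qed
  \<comment> \<open>Otherwise \<open>p\<close> together with the iterates would give
    \<open>d + 1\<close> independent vectors in the span of \<open>d\<close> monomials.\<close>
  have "p \<in> pv.span (F ` {..<d})"
  proof (rule ccontr)
    assume np: "p \<notin> pv.span (F ` {..<d})"
    then have "pv.independent (insert p (F ` {..<d}))" using indep by (rule pv.independent_insertI)
    moreover have "insert p (F ` {..<d}) \<subseteq> pv.span T" using spanT p Fd by auto
    ultimately have "card (insert p (F ` {..<d})) \<le> card T"
      using pv.independent_span_bound[of T] by (simp add: T_def)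
    moreover have "card T \<le> d" unfolding T_def using card_image_le[of "{..<d}"] by simp
    moreover have "p \<notin> F ` {..<d}" using np pv.span_base[of p "F ` {..<d}"] by (rule contrapos_nn)
    then have "card (insert p (F ` {..<d})) = Suc d" using inj by (simp add: card_image)
    ultimately show False by simp
  qed
  moreover have "F j \<in> V" for j
    by (induction j) (auto simp: F_def PV Vshift)
  then have "F ` {..<d} \<subseteq> V" by blast
  moreover have "pv.subspace V" using V0 Vadd Vsmult by (rule pv.subspaceI)
  ultimately show "p \<in> V" by (meson pv.span_minimal subsetD)
qed

text \<open>The numerators \<open>p\<close> with \<open>quot Q p \<in> S\<close> form a subspace
  stable under \<open>shift Q\<close>, to which the spanning result applies.\<close>

lemma invariant_contains_quotient_space:
  assumes Q: "\<And>z. z \<in> \<Omega> \<Longrightarrow> poly Q z \<noteq> 0" and cop: "coprime P Q" and P: "P \<noteq> 0"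
    and S: "cfun.subspace S" "pommiez \<Omega> g0 ` S \<subseteq> S" and f: "quot Q P \<in> S"
  shows "quotient_space g0 Q (max (Suc (degree P)) (degree Q)) \<subseteq> S"
proof -
  have "polys_below (max (Suc (degree P)) (degree Q)) \<subseteq> {p. quot Q p \<in> S}"
  proof (rule polys_below_le_span_iterates[OF Q[OF zero_Om] cop P refl])
    have "quot Q 0 = 0" by (simp add: quot_def fun_eq_iff)
    then show "0 \<in> {p. quot Q p \<in> S}" using cfun.subspace_0[OF S(1)] by simp
    have "quot Q (p + q) = quot Q p + quot Q q" for p q
      by (simp add: quot_def fun_eq_iff add_divide_distrib algebra_simps)
    then show "p + q \<in> {p. quot Q p \<in> S}" if "p \<in> {p. quot Q p \<in> S}" "q \<in> {p. quot Q p \<in> S}" for p q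
      using that cfun.subspace_add[OF S(1)] by simp
    have "quot Q (smult c p) = fscale c (quot Q p)" for c p
      by (simp add: quot_def fun_eq_iff fscale_def)
    then show "smult c p \<in> {p. quot Q p \<in> S}" if "p \<in> {p. quot Q p \<in> S}" for c p
      using that cfun.subspace_scale[OF S(1)] by simp
    show "shift Q p \<in> {p. quot Q p \<in> S}" if "p \<in> {p. quot Q p \<in> S}" for p
      using that S(2) pommiez_quot[OF Q, of p] by auto
  qed (use f in simp)
  then show ?thesis unfolding quotient_space_quot by blast
qed

section \<open>Existence and uniqueness of the decomposition into polynomial part and proper
  fraction\<close>

lemma is_rat_decomp_exists:
  assumes Q: "\<And>z. z \<in> \<Omega> \<Longrightarrow> poly Q z \<noteq> 0" and f: "\<And>z. z \<in> \<Omega> \<Longrightarrow> f z = quot Q p z"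
  shows "\<exists>d. is_rat_decomp \<Omega> g0 f d"
proof -
  have Q0: "Q \<noteq> 0" using Q[OF zero_Om] by auto
  define h where "h = gcd p Q"
  have h0: "h \<noteq> 0" using Q0 by (simp add: h_def)
  obtain p' where p': "p = h * p'" unfolding h_def by (meson dvdE gcd_dvd1)
  obtain Q' where Q': "Q = h * Q'" unfolding h_def by (meson dvdE gcd_dvd2)
  have Q'0: "Q' \<noteq> 0" using Q0 Q' by auto
  have cop: "coprime p' Q'"
  proof -
    have "p' = p div gcd p Q" "Q' = Q div gcd p Q"
      using p' Q' h0 unfolding h_def[symmetric] by (metis nonzero_mult_div_cancel_left)+
    then show ?thesis using div_gcd_coprime[of p Q] Q0 by simp
  qed
  define l where "l = lead_coeff Q'"
  have l: "l \<noteq> 0" using Q'0 by (simp add: l_def)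
  define v where "v = smult (inverse l) Q'"
  define P where "P = smult (inverse l) p'"
  have v0: "v \<noteq> 0" using Q'0 l by (simp add: v_def)
  have eq: "poly p z / poly Q z = poly (P div v) z + poly (P mod v) z / poly v z" if "z \<in> \<Omega>" for z
  proof -
    have nz: "poly h z \<noteq> 0" "poly Q' z \<noteq> 0" "poly v z \<noteq> 0" using Q[OF that] Q' l by (auto simp: v_def)
    have "poly p z / poly Q z = poly P z / poly v z" using nz l by (simp add: p' Q' P_def v_def)
    also have "poly P z = poly (P div v * v + P mod v) z" by (simp only: div_mult_mod_eq)
    also have "\<dots> = poly (P div v) z * poly v z + poly (P mod v) z" by (simp only: poly_add poly_mult)
    finally show ?thesis using nz by (simp add: add_divide_distrib)
  qed
  have "is_rat_decomp \<Omega> g0 f (P div v, P mod v, v)"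
    unfolding is_rat_decomp_def prod.case
  proof (intro conjI ballI)
    show "f z = g0 z * poly (P div v) z + g0 z * (poly (P mod v) z / poly v z)" if "z \<in> \<Omega>" for z
      using f[OF that] unfolding quot_def eq[OF that] distrib_left .
    show "pdeg (P mod v) < pdeg v"
      using degree_mod_less[OF v0, of P] v0 by (auto simp: pdeg_def)
    show "lead_coeff v = 1" using l by (simp add: v_def l_def)
    show "poly v z \<noteq> 0" if "z \<in> \<Omega>" for z using Q[OF that] Q' l by (auto simp: v_def)
    show "\<nexists>z. poly (P mod v) z = 0 \<and> poly v z = 0"
    proof
      assume "\<exists>z. poly (P mod v) z = 0 \<and> poly v z = 0"
      then obtain z where z: "poly (P mod v) z = 0" "poly v z = 0" by blast
      have "poly P z = poly (P div v * v + P mod v) z" by (simp only: div_mult_mod_eq)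
      then have "poly p' z = 0" "poly Q' z = 0" using z l by (auto simp: P_def v_def)
      then show False using coprime_poly_0[OF cop, of z] by simp
    qed
  qed
  then show ?thesis by blast
qed

text \<open>Passing to the single fraction \<open>(r * v + u) / v\<close> preserves lowest terms: at
  a root of \<open>v\<close> the numerator takes the value of \<open>u\<close>.\<close>

lemma is_rat_decomp_coprime:
  assumes "is_rat_decomp \<Omega> g0 f (r, u, v)"
  shows "v \<noteq> 0" "coprime (r * v + u) v" "u \<in> polys_below (degree v)"
    "\<And>z. z \<in> \<Omega> \<Longrightarrow> f z = quot v (r * v + u) z"
proof -
  have d: "\<And>z. z \<in> \<Omega> \<Longrightarrow> f z = g0 z * poly r z + g0 z * (poly u z / poly v z)"
    "pdeg u < pdeg v" "lead_coeff v = 1" "\<And>z. z \<in> \<Omega> \<Longrightarrow> poly v z \<noteq> 0"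
    "\<And>z. poly u z = 0 \<Longrightarrow> poly v z = 0 \<Longrightarrow> False"
    using assms unfolding is_rat_decomp_def by auto
  show v0: "v \<noteq> 0" using d(3) by auto
  show "coprime (r * v + u) v"
    by (rule coprime_if_no_common_root[OF v0]) (use d(5) in auto)
  show "u \<in> polys_below (degree v)" using d(2) v0 by (auto simp: polys_below_iff pdeg_def split: if_splits)
  show "f z = quot v (r * v + u) z" if "z \<in> \<Omega>" for z
    using d(1)[OF that] d(4)[OF that] by (simp add: quot_def field_simps)
qed

lemma monic_dvd_antisym:
  fixes p q :: "complex poly"
  assumes "p dvd q" "q dvd p" "lead_coeff p = 1" "lead_coeff q = 1"
  shows "p = q"
proof -
  have nz: "p \<noteq> 0" "q \<noteq> 0" using assms by auto
  obtain c where c: "q = p * c" using assms(1) by (rule dvdE)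
  have "degree q \<le> degree p" using dvd_imp_degree_le[OF assms(2)] nz by simp
  then have "degree c = 0" using c nz by (auto simp: degree_mult_eq)
  then obtain a where "c = [:a:]" by (rule degree_eq_zeroE)
  then have q: "q = smult a p" using c by simp
  have "lead_coeff q = a * lead_coeff p" unfolding q by (rule lead_coeff_smult)
  then have "a = 1" unfolding assms(3,4) by simp
  then show ?thesis using q by simp
qed

lemma is_rat_decomp_unique:
  assumes "is_rat_decomp \<Omega> g0 f d" "is_rat_decomp \<Omega> g0 f d'"
  shows "d = d'"
proof -
  obtain r u v r' u' v' where d: "d = (r, u, v)" and d': "d' = (r', u', v')"
    by (cases d, cases d') auto
  note D = is_rat_decomp_coprime[OF assms(1)[unfolded d]]
  note D' = is_rat_decomp_coprime[OF assms(2)[unfolded d']]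
  have nz: "poly v z \<noteq> 0" "poly v' z \<noteq> 0" if "z \<in> \<Omega>" for z
    using assms that by (auto simp: is_rat_decomp_def d d')
  \<comment> \<open>Cross-multiplied, the two fractions agree on the infinite set
    \<open>\<Omega>\<close>, hence as polynomials. Then coprimality makes the monic denominators
    divide each other.\<close>
  have eq: "(r * v + u) * v' = (r' * v' + u') * v"
  proof (rule poly_eqI_infinite[OF infinite_Om])
    fix z assume z: "z \<in> \<Omega>"
    have "poly (r * v + u) z / poly v z = poly (r' * v' + u') z / poly v' z"
    proof -
      have "quot v (r * v + u) z = quot v' (r' * v' + u') z" using D(4)[OF z] D'(4)[OF z] by metis
      then show ?thesis unfolding quot_def mult_left_cancel[OF g0_nz[OF z]] .
    qed
    then show "poly ((r * v + u) * v') z = poly ((r' * v' + u') * v) z"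
      unfolding poly_mult by (rule iffD1[OF frac_eq_eq[OF nz[OF z]]])
  qed
  have "v dvd (r * v + u) * v'" unfolding eq by (rule dvd_triv_right)
  then have "v dvd v'" using D(2) by (simp only: coprime_dvd_mult_right_iff coprime_commute)
  moreover have "v' dvd (r' * v' + u') * v" unfolding eq[symmetric] by (rule dvd_triv_right)
  then have "v' dvd v" using D'(2) by (simp only: coprime_dvd_mult_right_iff coprime_commute)
  moreover have "lead_coeff v = 1" "lead_coeff v' = 1"
    using assms by (auto simp: is_rat_decomp_def d d')
  ultimately have v: "v = v'" by (intro monic_dvd_antisym)
  then have "r * v + u = r' * v + u'" using eq D(1) by simp
  then have "(r - r') * v = u' - u" by (simp add: algebra_simps)
  moreover have "u' - u \<in> polys_below (degree v)" using D(3) D'(3) v by (auto intro: polys_below_diff)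
  ultimately have "(r - r') * v \<in> polys_below (degree v)" by (simp only:)
  then have "r - r' = 0" using D(1) degree_mult_eq[OF _ D(1), of "r - r'"]
    by (cases "r - r' = 0") (auto simp: polys_below_iff simp del: right_minus_eq)
  then have "r = r'" by simp
  then show ?thesis using v \<open>(r - r') * v = u' - u\<close> by (simp add: d d')
qed

lemma rat_decomp_correct:
  assumes "f \<in> hol_space \<Omega>"
    and "\<And>z. z \<in> \<Omega> \<Longrightarrow> poly Q z \<noteq> 0" "\<And>z. z \<in> \<Omega> \<Longrightarrow> f z = quot Q p z"
  shows "is_rat_decomp \<Omega> g0 f (rat_decomp \<Omega> g0 f)"
proof (cases "f = 0")
  case True
  \<comment> \<open>The default \<open>(0, 0, 1)\<close> chosen for \<open>f = 0\<close> is itself a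
    decomposition, because \<open>pdeg 0 = -\<infinity>\<close> lies below
    \<open>pdeg 1\<close>.\<close>
  then show ?thesis by (simp add: rat_decomp_def is_rat_decomp_def pdeg_def)
next
  case False
  have "\<exists>!d. is_rat_decomp \<Omega> g0 f d"
    using is_rat_decomp_exists[OF assms(2,3)] is_rat_decomp_unique by blast
  then show ?thesis using False by (simp add: rat_decomp_def theI')
qed

end


section \<open>Proper closed invariant subspaces\<close>

text \<open>With \<open>g = g0\<close> this turns a functional annihilating \<open>S\<close> into
  one annihilating the quotients \<open>f / g0\<close>.\<close>

lemma sup_functional_mult:
  assumes L: "sup_functional K L" and g: "bounded (g ` K)"
  shows "sup_functional K (\<lambda>f. L (\<lambda>z. g z * f z))"
proof -
  obtain M where M: "\<And>z. z \<in> K \<Longrightarrow> norm (g z) \<le> M" using g by (auto simp: bounded_image_iff)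
  obtain C where C: "0 \<le> C" "\<And>f B. (\<And>z. z \<in> K \<Longrightarrow> norm (f z) \<le> B) \<Longrightarrow> norm (L f) \<le> C * B"
    using L unfolding sup_functional_def by blast
  have mult: "norm (g z * f z) \<le> \<bar>M\<bar> * B" if "z \<in> K" "norm (f z) \<le> B" for z f B
    unfolding norm_mult using M[OF that(1)] that(2) norm_ge_zero[of "f z"]
    by (intro mult_mono) (auto simp del: norm_ge_zero)
  have b: "bounded ((\<lambda>z. g z * f z) ` K)" if "bounded (f ` K)" for f
    using that mult unfolding bounded_image_iff by meson
  show ?thesis
    unfolding sup_functional_def
  proof (intro conjI allI impI)
    fix f h :: "complex \<Rightarrow> complex" assume "bounded (f ` K)" "bounded (h ` K)"
    then show "L (\<lambda>z. g z * (f z + h z)) = L (\<lambda>z. g z * f z) + L (\<lambda>z. g z * h z)"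
      using L b unfolding sup_functional_def distrib_left by blast
  next
    fix c and f :: "complex \<Rightarrow> complex" assume "bounded (f ` K)"
    then have "L (\<lambda>z. c * (g z * f z)) = c * L (\<lambda>z. g z * f z)"
      using L b unfolding sup_functional_def by blast
    then show "L (\<lambda>z. g z * (c * f z)) = c * L (\<lambda>z. g z * f z)" by (simp add: mult.left_commute)
  next
    show "\<exists>C\<ge>0. \<forall>f B. (\<forall>z\<in>K. norm (f z) \<le> B) \<longrightarrow> norm (L (\<lambda>z. g z * f z)) \<le> C * B"
    proof (intro exI[of _ "C * \<bar>M\<bar>"] conjI allI impI)
      fix f :: "complex \<Rightarrow> complex" and B assume "\<forall>z\<in>K. norm (f z) \<le> B"
      then have "norm (L (\<lambda>z. g z * f z)) \<le> C * (\<bar>M\<bar> * B)" by (intro C(2) mult) auto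
      then show "norm (L (\<lambda>z. g z * f z)) \<le> C * \<bar>M\<bar> * B" by (simp add: mult.assoc)
    qed (use C in simp)
  qed
qed

context base_function begin

theorem invariant_subspace_common_denominator:
  assumes conn: "connected \<Omega>" "simply_connected \<Omega>"
    and S: "closed_invariant_subspace \<Omega> g0 S" "proper_in \<Omega> S"
  shows "\<exists>Q n. (\<forall>z\<in>\<Omega>. poly Q z \<noteq> 0) \<and> (\<forall>f\<in>S. \<exists>p. degree p \<le> n \<and> (\<forall>z\<in>\<Omega>. f z = quot Q p z))"
proof -
  have S': "S \<subseteq> hol_space \<Omega>" "cfun.subspace S" "closedin (compact_convergence \<Omega>) S"
    "pommiez \<Omega> g0 ` S \<subseteq> S"
    using S(1) unfolding closed_invariant_subspace_def by auto
  then obtain f0 where f0: "f0 \<in> hol_space \<Omega>" "f0 \<notin> S" using S(2) unfolding proper_in_def by blast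
  obtain K L where K: "compact K" "K \<subseteq> \<Omega>" "K \<noteq> {}" and L: "sup_functional K L"
    and L0: "\<And>f. f \<in> S \<Longrightarrow> L f = 0" and Lf0: "L f0 \<noteq> 0"
    by (rule separating_functional[OF S'(1-3) f0]) (rule that; assumption)
  interpret L: bounded_functional K L using K L by unfold_locales
  define D where "D f z = f z / g0 z" for f :: "complex \<Rightarrow> complex" and z
  have D: "D f holomorphic_on \<Omega>" if "f \<in> hol_space \<Omega>" for f
    unfolding D_def[abs_def] using that g0_hol g0_nz
    by (intro holomorphic_intros) (auto simp: hol_space_def)
  have LD: "L (\<lambda>z. g0 z * D f z) = L f" if f: "f \<in> hol_space \<Omega>" for f
  proof (rule L.L_cong)
    show "g0 z * D f z = f z" if "z \<in> K" for z using that K(2) g0_nz by (auto simp: D_def)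
    show "bounded ((\<lambda>z. g0 z * D f z) ` K)"
      by (rule L.bounded_holomorphic[OF _ K(2)]) (intro holomorphic_intros g0_hol D f)
  qed
  \<comment> \<open>The quotient \<open>D f\<close> satisfies the shift identity with
    \<open>D (pommiez \<Omega> g0 f)\<close> as witness. Composing \<open>L\<close> with
    multiplication by \<open>g0\<close> undoes the division, so the values on \<open>S\<close> and
    at \<open>f0\<close> are kept.\<close>
  interpret sa: shift_annihilator K "\<lambda>h. L (\<lambda>z. g0 z * h z)" \<Omega> "D ` S" "D f0"
  proof unfold_locales
    show "sup_functional K (\<lambda>h. L (\<lambda>z. g0 z * h z))"
      by (rule sup_functional_mult[OF L L.bounded_holomorphic[OF g0_hol K(2)]])
    fix h assume "h \<in> D ` S"
    then obtain f where f: "f \<in> S" "h = D f" by blast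
    then have fh: "f \<in> hol_space \<Omega>" using S'(1) by blast
    show "h holomorphic_on \<Omega>" unfolding f by (rule D[OF fh])
    show "L (\<lambda>z. g0 z * h z) = 0" unfolding f LD[OF fh] by (rule L0[OF f(1)])
    have "D f z = D f 0 + z * D (pommiez \<Omega> g0 f) z" if "z \<in> \<Omega>" for z
    proof (cases "z = 0")
      case False
      then have "z * D (pommiez \<Omega> g0 f) z = (f z - g0 z * f 0) / g0 z"
        using that by (simp add: D_def pommiez_def)
      also have "\<dots> = D f z - D f 0"
        using g0_nz[OF that] g0_0 by (simp add: D_def diff_divide_distrib)
      finally show ?thesis by simp
    qed simp
    moreover have "D (pommiez \<Omega> g0 f) \<in> D ` S" using f(1) S'(4) by blast
    ultimately show "\<exists>g\<in>D ` S. \<forall>z\<in>\<Omega>. h z = h 0 + z * g z" unfolding f(2) by blast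
  next
    show "L (\<lambda>z. g0 z * D f0 z) \<noteq> 0" using LD[OF f0(1)] Lf0 by simp
  qed (use K conn open_Om zero_Om D[OF f0(1)] in auto)
  obtain Q n where Q: "\<forall>z\<in>\<Omega>. poly Q z \<noteq> 0"
    and p: "\<forall>h\<in>D ` S. \<exists>p. degree p \<le> n \<and> (\<forall>z\<in>\<Omega>. poly Q z * h z = poly p z)"
    using sa.common_denominator by blast
  have "\<exists>p. degree p \<le> n \<and> (\<forall>z\<in>\<Omega>. f z = quot Q p z)" if fS: "f \<in> S" for f
  proof -
    obtain q where q: "degree q \<le> n" "\<forall>z\<in>\<Omega>. poly Q z * D f z = poly q z"
      using bspec[OF p imageI[OF fS]] by blast
    have "f z = quot Q q z" if z: "z \<in> \<Omega>" for z
    proof -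
      have "poly q z / poly Q z = D f z"
        using q(2) Q z by (metis nonzero_mult_div_cancel_left)
      then show ?thesis using g0_nz[OF z] by (simp add: quot_def D_def del: times_divide_eq_right) simp
    qed
    then show ?thesis using q(1) by (intro exI[of _ q]) simp
  qed
  then show ?thesis using Q by (intro exI[of _ Q] exI[of _ n]) simp
qed

end

section \<open>From a common denominator to the exact description of the subspace\<close>

lemma Sup_attained:
  fixes f :: "'a \<Rightarrow> 'b :: {complete_linorder}"
  assumes "finite (f ` S)" "S \<noteq> {}"
  shows "\<exists>x\<in>S. Sup (f ` S) = f x"
proof -
  have "Sup (f ` S) = Max (f ` S)" using assms by (simp add: Max_Sup)
  moreover have "Max (f ` S) \<in> f ` S" using assms by (intro Max_in) auto
  ultimately show ?thesis by auto
qed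

text \<open>Records the outcome of the analytic part: one \<open>Q\<close> and one degree bound
  \<open>n\<close> serve all elements of \<open>S\<close>. What follows is algebra.\<close>

locale rational_invariant_subspace = base_function +
  fixes S :: "(complex \<Rightarrow> complex) set" and Q :: "complex poly" and n :: nat
  assumes S_hol: "S \<subseteq> hol_space \<Omega>" and S_sub: "cfun.subspace S"
    and S_inv: "pommiez \<Omega> g0 ` S \<subseteq> S"
    and Q_nz: "\<And>z. z \<in> \<Omega> \<Longrightarrow> poly Q z \<noteq> 0"
    and S_quot: "\<And>f. f \<in> S \<Longrightarrow> \<exists>p. degree p \<le> n \<and> (\<forall>z\<in>\<Omega>. f z = quot Q p z)"
begin

lemma Q0: "Q \<noteq> 0"
  using Q_nz[OF zero_Om] by auto

definition num_part :: "(complex \<Rightarrow> complex) \<Rightarrow> complex poly" where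
  "num_part f = fst (snd (rat_decomp \<Omega> g0 f))"

abbreviation (input) "r \<equiv> poly_part \<Omega> g0"
abbreviation (input) "v \<equiv> denom_part \<Omega> g0"

definition whole_num :: "(complex \<Rightarrow> complex) \<Rightarrow> complex poly" where
  "whole_num f = r f * v f + num_part f"

lemma decomp: "f \<in> S \<Longrightarrow> is_rat_decomp \<Omega> g0 f (r f, num_part f, v f)"
proof -
  assume f: "f \<in> S"
  then obtain p where "\<And>z. z \<in> \<Omega> \<Longrightarrow> f z = quot Q p z" using S_quot by blast
  then show ?thesis
    using rat_decomp_correct[OF _ Q_nz, of f p] f S_hol
    by (auto simp: poly_part_def num_part_def denom_part_def)
qed

lemma v_nz: "f \<in> S \<Longrightarrow> z \<in> \<Omega> \<Longrightarrow> poly (v f) z \<noteq> 0"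
  using decomp by (auto simp: is_rat_decomp_def)

lemma f_eq: "f \<in> S \<Longrightarrow> f = quot (v f) (whole_num f)"
proof
  fix z assume f: "f \<in> S"
  show "f z = quot (v f) (whole_num f) z"
  proof (cases "z \<in> \<Omega>")
    case True
    then show ?thesis using is_rat_decomp_coprime(4)[OF decomp[OF f]] by (simp add: whole_num_def)
  next
    case False
    then show ?thesis using f S_hol by (auto simp: quot_def g0_out hol_space_def)
  qed
qed

lemma coprime_whole: "f \<in> S \<Longrightarrow> coprime (whole_num f) (v f)"
  unfolding whole_num_def by (rule is_rat_decomp_coprime(2)[OF decomp])

lemma v_nonzero: "f \<in> S \<Longrightarrow> v f \<noteq> 0"
  by (rule is_rat_decomp_coprime(1)[OF decomp])

lemma num_below: "f \<in> S \<Longrightarrow> num_part f \<in> polys_below (degree (v f))"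
  by (rule is_rat_decomp_coprime(3)[OF decomp])

lemma degree_whole: "f \<in> S \<Longrightarrow> r f \<noteq> 0 \<Longrightarrow> degree (whole_num f) = degree (r f) + degree (v f)"
proof -
  assume f: "f \<in> S" "r f \<noteq> 0"
  have d: "degree (r f * v f) = degree (r f) + degree (v f)"
    using f v_nonzero by (intro degree_mult_eq) auto
  show ?thesis
    using num_below[OF f(1)] d degree_add_eq_left[of "num_part f" "r f * v f"]
    by (cases "num_part f = 0") (auto simp: whole_num_def polys_below_iff)
qed

lemma whole_eq:
  assumes f: "f \<in> S"
  shows "\<exists>p. degree p \<le> n \<and> p * v f = Q * whole_num f"
proof -
  obtain p where p: "degree p \<le> n" "\<And>z. z \<in> \<Omega> \<Longrightarrow> f z = quot Q p z" using S_quot[OF f] by blast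
  have "p * v f = Q * whole_num f"
  proof (rule poly_eqI_infinite[OF infinite_Om])
    fix z assume z: "z \<in> \<Omega>"
    have "quot Q p z = quot (v f) (whole_num f) z" using p(2)[OF z] f_eq[OF f] by metis
    then have "poly p z / poly Q z = poly (whole_num f) z / poly (v f) z"
      unfolding quot_def mult_left_cancel[OF g0_nz[OF z]] .
    then show "poly (p * v f) z = poly (Q * whole_num f) z"
      using Q_nz[OF z] v_nz[OF f z] by (simp add: frac_eq_eq mult.commute)
  qed
  then show ?thesis using p(1) by blast
qed

text \<open>The reduced denominator of a fraction divides every other denominator; this confines the
  poles to the roots of \<open>Q\<close> and bounds their orders.\<close>

lemma v_dvd: "f \<in> S \<Longrightarrow> v f dvd Q"
proof -
  assume f: "f \<in> S"
  obtain p where "p * v f = Q * whole_num f" using whole_eq[OF f] by blast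
  then have "v f dvd Q * whole_num f" by (metis dvd_triv_right)
  then show ?thesis
    using coprime_whole[OF f] by (simp add: coprime_dvd_mult_left_iff coprime_commute)
qed

text \<open>Comparing degrees in \<open>p * v f = Q * whole_num f\<close> gives
  \<open>degree p = degree Q + degree (r f)\<close> when \<open>r f \<noteq> 0\<close>.\<close>

lemma degree_r: "f \<in> S \<Longrightarrow> degree (r f) \<le> n"
proof (cases "r f = 0")
  case False
  assume f: "f \<in> S"
  obtain p where p: "degree p \<le> n" "p * v f = Q * whole_num f" using whole_eq[OF f] by blast
  have "whole_num f \<noteq> 0"
  proof
    assume "whole_num f = 0"
    then have "r f * v f = - num_part f" by (simp add: whole_num_def eq_neg_iff_add_eq_0)
    then have "r f * v f \<in> polys_below (degree (v f))" using num_below[OF f] by (simp add: polys_below_def)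
    then show False using False v_nonzero[OF f] by (simp add: polys_below_iff degree_mult_eq)
  qed
  then have p0: "p \<noteq> 0" using p(2) Q0 by auto
  have "degree p + degree (v f) = degree Q + (degree (r f) + degree (v f))"
    using arg_cong[OF p(2), of degree] p0 v_nonzero[OF f] Q0 \<open>whole_num f \<noteq> 0\<close> degree_whole[OF f False]
    by (simp add: degree_mult_eq)
  then show ?thesis using p(1) by simp
qed simp

lemma quot_mem:
  assumes f: "f \<in> S" and "whole_num f \<noteq> 0" and q: "q \<in> polys_below (max (Suc (degree (whole_num f))) (degree (v f)))"
  shows "quot (v f) q \<in> S"
proof -
  have "quot (v f) (whole_num f) \<in> S" using f f_eq by metis
  then have "quotient_space g0 (v f) (max (Suc (degree (whole_num f))) (degree (v f))) \<subseteq> S"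
    by (intro invariant_contains_quotient_space v_nz[OF f] coprime_whole[OF f] assms S_sub S_inv)
  then show ?thesis using q by (auto simp: quotient_space_quot)
qed

text \<open>Over the denominator \<open>v f\<close>, \<open>q\<close> has numerator
  \<open>q * v f\<close>, whose degree does not exceed that of \<open>whole_num f\<close>; so it
  lies in the quotient space generated by \<open>f\<close>.\<close>

lemma poly_mem:
  assumes f: "f \<in> S" and q: "pdeg q \<le> pdeg (r f)"
  shows "g0 * poly q \<in> S"
proof (cases "q = 0")
  case True
  then have "g0 * poly q = 0" by (auto simp: fun_eq_iff)
  then show ?thesis using cfun.subspace_0[OF S_sub] by simp
next
  case False
  then have rq: "r f \<noteq> 0" "degree q \<le> degree (r f)" using q by (auto simp: pdeg_def split: if_splits)
  note dw = degree_whole[OF f rq(1)]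
  have "quot (v f) (q * v f) \<in> S"
  proof (rule quot_mem[OF f])
    show "q * v f \<in> polys_below (max (Suc (degree (whole_num f))) (degree (v f)))"
      using rq(2) dw degree_mult_le[of q "v f"] by (auto simp: polys_below_iff less_max_iff_disj)
    show "whole_num f \<noteq> 0"
    proof
      assume w: "whole_num f = 0"
      then have "degree (v f) = 0" using dw by simp
      then have "num_part f = 0" using num_below[OF f] by (simp add: polys_below_iff)
      then show False using w rq(1) v_nonzero[OF f] by (simp add: whole_num_def)
    qed
  qed
  also have "quot (v f) (q * v f) = g0 * poly q"
  proof
    fix z show "quot (v f) (q * v f) z = (g0 * poly q) z"
      using v_nz[OF f, of z] g0_out[of z] by (cases "z \<in> \<Omega>") (auto simp: quot_def)
  qed
  finally show ?thesis .
qed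

text \<open>Over the denominator \<open>v f\<close>, the pole term has as numerator the cofactor of
  \<open>(z - w) ^ k\<close> in \<open>v f\<close>, of degree below
  \<open>degree (v f)\<close>.\<close>

lemma qpole_mem:
  assumes f: "f \<in> S" and k: "1 \<le> k" "k \<le> order w (v f)"
  shows "g0 * qpole w k \<in> S"
proof -
  have "[:-w, 1:] ^ k dvd v f"
    using order_1[of w "v f"] k(2) by (meson dvd_trans le_imp_power_dvd)
  then obtain q where q: "v f = [:-w, 1:] ^ k * q" by (rule dvdE)
  have q0: "q \<noteq> 0" using q v_nonzero[OF f] by auto
  have "degree (v f) = k + degree q" unfolding q using q0
    by (subst degree_mult_eq) (auto simp: degree_power_eq)
  then have deg: "degree q < degree (v f)" using k by simp
  have "quot (v f) q \<in> S"
  proof (rule quot_mem[OF f])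
    show "whole_num f \<noteq> 0"
    proof
      assume "whole_num f = 0"
      then have "is_unit (v f)" using coprime_whole[OF f] by simp
      then show False using deg v_nonzero[OF f] by (simp add: is_unit_iff_degree)
    qed
  qed (use deg in \<open>auto simp: polys_below_iff less_max_iff_disj\<close>)
  also have "quot (v f) q = g0 * qpole w k"
  proof
    fix z show "quot (v f) q z = (g0 * qpole w k) z"
    proof (cases "z \<in> \<Omega>")
      case True
      have "poly ([:-w, 1:] ^ k * q) z \<noteq> 0" using v_nz[OF f True] q by metis
      then have "poly q z \<noteq> 0" "(z - w) ^ k \<noteq> 0" by (auto simp: poly_power)
      moreover have "poly (v f) z = (z - w) ^ k * poly q z" by (simp add: q poly_power)
      ultimately show ?thesis by (simp add: quot_def qpole_def)
    qed (simp add: quot_def g0_out)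
  qed
  finally show ?thesis .
qed

lemma S_nonempty: "S \<noteq> {}"
  using cfun.subspace_0[OF S_sub] by blast

text \<open>The degrees take finitely many values by \<open>degree_r\<close>, so the supremum is a
  maximum. A single element of \<open>S\<close> then yields every admissible polynomial through
  \<open>poly_mem\<close>.\<close>

lemma max_degree_attained: "\<exists>f\<in>S. max_degree \<Omega> g0 S = pdeg (r f)"
  unfolding max_degree_def
proof (rule Sup_attained[OF _ S_nonempty])
  have "(\<lambda>f. pdeg (r f)) ` S \<subseteq> insert (-\<infinity>) ((\<lambda>k. ereal (real k)) ` {..n})"
    using degree_r by (auto simp: pdeg_def)
  then show "finite ((\<lambda>f. pdeg (r f)) ` S)" by (rule finite_subset) simp
qed

lemma pole_mult_attained: "\<exists>f\<in>S. pole_mult \<Omega> g0 S w = enat (order w (v f))"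
  unfolding pole_mult_def
proof (rule Sup_attained[OF _ S_nonempty])
  have "(\<lambda>f. enat (order w (v f))) ` S \<subseteq> enat ` {..order w Q}"
    using dvd_imp_order_le[OF Q0 v_dvd] by auto
  then show "finite ((\<lambda>f. enat (order w (v f))) ` S)" by (rule finite_subset) simp
qed

lemma pole_mult_upper: "f \<in> S \<Longrightarrow> enat (order w (v f)) \<le> pole_mult \<Omega> g0 S w"
  unfolding pole_mult_def by (rule SUP_upper)

lemma root_in_pole_set:
  assumes f: "f \<in> S" and w: "poly (v f) w = 0"
  shows "w \<in> pole_set \<Omega> g0 S"
proof -
  \<comment> \<open>For \<open>f = 0\<close> the denominator is \<open>1\<close> by convention and
    has no root.\<close>
  have "f \<noteq> 0" using w by (auto simp: denom_part_def rat_decomp_def)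
  then show ?thesis using f w v_nz[OF f, of w] unfolding pole_set_def by blast
qed

lemma finite_pole_variety: "finite_multiple_variety_outside \<Omega> (pole_variety \<Omega> g0 S)"
  unfolding finite_multiple_variety_outside_def
proof (intro exI conjI ballI)
  let ?m = "\<lambda>w. the_enat (pole_mult \<Omega> g0 S w)"
  have "pole_set \<Omega> g0 S \<subseteq> {w. poly Q w = 0}"
    using v_dvd unfolding pole_set_def by (auto simp: poly_eq_0_iff_dvd intro: dvd_trans)
  then show "finite (pole_set \<Omega> g0 S)" using poly_roots_finite[OF Q0] finite_subset by blast
  show "pole_set \<Omega> g0 S \<subseteq> - \<Omega>" by (auto simp: pole_set_def)
  \<comment> \<open>Attainment makes the multiplicity finite, so \<open>the_enat\<close> loses
    nothing.\<close>
  have en: "enat (?m w) = pole_mult \<Omega> g0 S w" for w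
    using pole_mult_attained[of w] by auto
  show "pole_variety \<Omega> g0 S = multiple_variety (pole_set \<Omega> g0 S) ?m"
    by (simp add: pole_variety_def multiple_variety_def en)
  fix w assume "w \<in> pole_set \<Omega> g0 S"
  then obtain f where f: "f \<in> S" "poly (v f) w = 0" by (auto simp: pole_set_def)
  then have "1 \<le> order w (v f)" using v_nonzero[OF f(1)] by (simp add: order_root Suc_le_eq)
  then have "enat 1 \<le> enat (?m w)"
    unfolding en using pole_mult_upper[OF f(1), of w] by (metis enat_ord_simps(1) order_trans)
  then show "1 \<le> ?m w" by simp
qed

lemma S_rational: "S \<subseteq> rational_multiples \<Omega> g0"
proof
  fix f assume "f \<in> S"
  then obtain p where "\<forall>z\<in>\<Omega>. f z = quot Q p z" using S_quot by blast
  then show "f \<in> rational_multiples \<Omega> g0"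
    unfolding rational_multiples_def quot_def using Q_nz by blast
qed

text \<open>One inclusion is the partial fraction expansion of each \<open>f\<close>. For the other,
  the suprema are attained, so \<open>poly_mem\<close> and \<open>qpole_mem\<close> place the
  polynomial part and every generating pole term in \<open>S\<close>.\<close>

lemma S_eq: "S = fmult g0 (polys_upto (max_degree \<Omega> g0 S) + pole_space (pole_variety \<Omega> g0 S))"
proof (intro equalityI subsetI)
  fix f assume f: "f \<in> S"
  obtain h where h: "h \<in> cfun.span {qpole w k | w k. poly (v f) w = 0 \<and> 1 \<le> k \<and> k \<le> order w (v f)}"
    "\<And>z. poly (v f) z \<noteq> 0 \<Longrightarrow> poly (num_part f) z / poly (v f) z = h z"
    using partial_fractions[OF v_nonzero[OF f] num_below[OF f]] by blast
  have "{qpole w k | w k. poly (v f) w = 0 \<and> 1 \<le> k \<and> k \<le> order w (v f)}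
      \<subseteq> {qpole w k | w k. \<exists>m. (w, m) \<in> pole_variety \<Omega> g0 S \<and> 1 \<le> k \<and> enat k \<le> m}"
  proof clarify
    fix w k assume wk: "poly (v f) w = 0" "1 \<le> k" "k \<le> order w (v f)"
    have "(w, pole_mult \<Omega> g0 S w) \<in> pole_variety \<Omega> g0 S"
      using root_in_pole_set[OF f wk(1)] by (auto simp: pole_variety_def)
    moreover have "enat k \<le> pole_mult \<Omega> g0 S w"
      using pole_mult_upper[OF f, of w] wk(3) by (meson enat_ord_simps(1) order_trans)
    ultimately show "\<exists>w' k'. qpole w k = qpole w' k' \<and> (\<exists>m. (w', m) \<in> pole_variety \<Omega> g0 S \<and> 1 \<le> k' \<and> enat k' \<le> m)"
      using wk(2) by blast
  qed
  then have "h \<in> pole_space (pole_variety \<Omega> g0 S)"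
    unfolding pole_space_def using h(1) cfun.span_mono by blast
  moreover have "pdeg (r f) \<le> max_degree \<Omega> g0 S" unfolding max_degree_def using f by (rule SUP_upper)
  then have "poly (r f) \<in> polys_upto (max_degree \<Omega> g0 S)" unfolding polys_upto_def by blast
  moreover have "f = g0 * (poly (r f) + h)"
  proof
    fix z show "f z = (g0 * (poly (r f) + h)) z"
    proof (cases "z \<in> \<Omega>")
      case True
      have "f z = g0 z * poly (r f) z + g0 z * (poly (num_part f) z / poly (v f) z)"
        using decomp[OF f] True by (simp add: is_rat_decomp_def)
      then show ?thesis using h(2)[OF v_nz[OF f True]] by (simp add: distrib_left)
    next
      case False
      then show ?thesis using f S_hol by (auto simp: g0_out hol_space_def)
    qed
  qed
  ultimately show "f \<in> fmult g0 (polys_upto (max_degree \<Omega> g0 S) + pole_space (pole_variety \<Omega> g0 S))"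
    unfolding fmult_def set_plus_def by blast
next
  fix f assume "f \<in> fmult g0 (polys_upto (max_degree \<Omega> g0 S) + pole_space (pole_variety \<Omega> g0 S))"
  then obtain q h where q: "pdeg q \<le> max_degree \<Omega> g0 S" and h: "h \<in> pole_space (pole_variety \<Omega> g0 S)"
    and f: "f = g0 * (poly q + h)"
    unfolding fmult_def set_plus_def polys_upto_def by blast
  have "g0 * poly q \<in> S" using max_degree_attained q poly_mem by auto
  moreover have "pole_space (pole_variety \<Omega> g0 S) \<subseteq> {h. g0 * h \<in> S}"
    unfolding pole_space_def
  proof (rule cfun.span_minimal)
    show "cfun.subspace {h. g0 * h \<in> S}"
    proof (rule cfun.subspaceI)
      show "0 \<in> {h. g0 * h \<in> S}" using cfun.subspace_0[OF S_sub] by simp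
      have "g0 * (a + b) = g0 * a + g0 * b" for a b by (simp add: fun_eq_iff distrib_left)
      then show "a + b \<in> {h. g0 * h \<in> S}" if "a \<in> {h. g0 * h \<in> S}" "b \<in> {h. g0 * h \<in> S}" for a b
        using that cfun.subspace_add[OF S_sub] by simp
      have "g0 * fscale c a = fscale c (g0 * a)" for c a by (simp add: fun_eq_iff fscale_def)
      then show "fscale c a \<in> {h. g0 * h \<in> S}" if "a \<in> {h. g0 * h \<in> S}" for c a
        using that cfun.subspace_scale[OF S_sub] by simp
    qed
    show "{qpole w k | w k. \<exists>m. (w, m) \<in> pole_variety \<Omega> g0 S \<and> 1 \<le> k \<and> enat k \<le> m} \<subseteq> {h. g0 * h \<in> S}"
    proof clarify
      fix w k m assume wk: "(w, m) \<in> pole_variety \<Omega> g0 S" "1 \<le> k" "enat k \<le> m"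
      then have "enat k \<le> pole_mult \<Omega> g0 S w" by (auto simp: pole_variety_def)
      then obtain f where "f \<in> S" "k \<le> order w (v f)" using pole_mult_attained[of w] by auto
      then show "g0 * qpole w k \<in> S" using qpole_mem wk(2) by blast
    qed
  qed
  then have "g0 * h \<in> S" using h by blast
  ultimately have "g0 * poly q + g0 * h \<in> S" by (rule cfun.subspace_add[OF S_sub])
  then show "f \<in> S" by (simp add: f distrib_left)
qed

end


theorem mainTheorem1:
  fixes \<Omega> :: "complex set" and g0 :: "complex \<Rightarrow> complex"
  assumes "open \<Omega>" and "connected \<Omega>" and "simply_connected \<Omega>"
    and "0 \<in> \<Omega>" and "\<Omega> \<noteq> UNIV"
    and "g0 \<in> hol_space \<Omega>" and "g0 0 = 1" and "\<forall>z\<in>\<Omega>. g0 z \<noteq> 0"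
  shows
    "(\<forall>n\<in>degree_bounds. \<forall>\<Lambda> (m :: complex \<Rightarrow> nat).
        finite \<Lambda> \<and> \<Lambda> \<subseteq> - \<Omega> \<and> (\<forall>w\<in>\<Lambda>. 1 \<le> m w) \<longrightarrow>
        closed_invariant_subspace \<Omega> g0
          (fmult g0 (polys_upto n + pole_space (multiple_variety \<Lambda> m))) \<and>
        (proper_in \<Omega> (fmult g0 (polys_upto n + pole_space (multiple_variety \<Lambda> m))) \<longleftrightarrow>
          n \<noteq> -\<infinity> \<or> \<Lambda> \<noteq> {})) \<and>
     (\<forall>S. closed_invariant_subspace \<Omega> g0 S \<and> proper_in \<Omega> S \<longrightarrow>
        S \<subseteq> rational_multiples \<Omega> g0 \<and>
        max_degree \<Omega> g0 S \<in> degree_bounds \<and>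
        finite_multiple_variety_outside \<Omega> (pole_variety \<Omega> g0 S) \<and>
        S = fmult g0 (polys_upto (max_degree \<Omega> g0 S) + pole_space (pole_variety \<Omega> g0 S)))"
proof (rule conjI; intro ballI allI impI)
  interpret base_function \<Omega> g0
    using assms by unfold_locales auto
  {
    fix n \<Lambda> and m :: "complex \<Rightarrow> nat"
    assume n: "n \<in> degree_bounds" and \<Lambda>: "finite \<Lambda> \<and> \<Lambda> \<subseteq> - \<Omega> \<and> (\<forall>w\<in>\<Lambda>. 1 \<le> m w)"
    interpret pole_divisor \<Lambda> m using \<Lambda> by unfold_locales auto
    \<comment> \<open>All claims of the first part are read off from the quotient space over
      \<open>den\<close>. Its bound is at least \<open>degree den\<close>, as
      \<open>closed_invariant_quotient_space\<close> asks, and it is \<open>0\<close> exactly when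
      both summands are.\<close>
    have eq: "fmult g0 (polys_upto n + pole_space (multiple_variety \<Lambda> m))
        = quotient_space g0 den (strict_degree_bound n + degree den)"
      unfolding polys_upto_eq[OF n] by (rule sum_space_eq_quotient_space) (use \<Lambda> g0_out in blast)
    have nz: "poly den z \<noteq> 0" if "z \<in> \<Omega>" for z using \<Lambda> that den_root by blast
    have "0 < strict_degree_bound n + degree den \<longleftrightarrow> n \<noteq> -\<infinity> \<or> \<Lambda> \<noteq> {}"
      using degree_den_0 by (auto simp: strict_degree_bound_def)
    then show "closed_invariant_subspace \<Omega> g0 (fmult g0 (polys_upto n + pole_space (multiple_variety \<Lambda> m))) \<and>
        (proper_in \<Omega> (fmult g0 (polys_upto n + pole_space (multiple_variety \<Lambda> m))) \<longleftrightarrow>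
          n \<noteq> -\<infinity> \<or> \<Lambda> \<noteq> {})"
      unfolding eq using closed_invariant_quotient_space[OF nz] proper_quotient_space[OF nz] by simp
  next
    fix S assume S: "closed_invariant_subspace \<Omega> g0 S \<and> proper_in \<Omega> S"
    obtain Q n where Q: "\<forall>z\<in>\<Omega>. poly Q z \<noteq> 0"
      "\<forall>f\<in>S. \<exists>p. degree p \<le> n \<and> (\<forall>z\<in>\<Omega>. f z = quot Q p z)"
      using invariant_subspace_common_denominator assms(2,3) S by blast
    interpret rational_invariant_subspace \<Omega> g0 S Q n
      using S Q by unfold_locales (auto simp: closed_invariant_subspace_def)
    \<comment> \<open>Being attained, the supremum is an actual degree or
      \<open>-\<infinity>\<close>, never \<open>\<infinity>\<close>.\<close>
    have "max_degree \<Omega> g0 S \<in> degree_bounds"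
      using max_degree_attained by (auto simp: degree_bounds_def pdeg_def split: if_splits)
    then show "S \<subseteq> rational_multiples \<Omega> g0 \<and> max_degree \<Omega> g0 S \<in> degree_bounds \<and>
        finite_multiple_variety_outside \<Omega> (pole_variety \<Omega> g0 S) \<and>
        S = fmult g0 (polys_upto (max_degree \<Omega> g0 S) + pole_space (pole_variety \<Omega> g0 S))"
      using S_rational finite_pole_variety S_eq by blast
  }
qed

end
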